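(* There exist a word $u \in \{0,1,2\}^*$ of length $352$ and a word $v$ of length $75019$ whose first letter is $0'$ and whose remaining letters lie in $\{0,1,2\}$, such that $\textbf{w}_{27/23} = \tau(\varphi^\infty(0'))$, where $\varphi$ is the morphism on $\mathbb{Z}_{\geq 0} \cup \{0'\}$ given by $\varphi(0') = v\,\varphi(0)$ and $\varphi(n) = u\,n$ for $n \in \mathbb{Z}_{\geq 0}$. In particular, $\textbf{w}_{27/23}$ is a $353$-automatic sequence on the alphabet $\{0,1,2\}$.
   Context: Words are indexed from position $0$; a factor is a contiguous subword. For relatively prime positive integers $a,b$ and a nonempty word $v$ whose length is divisible by $b$, define $v^{a/b} = v^{\lfloor a/b \rfloor} v_0 v_1 \cdots v_{t-1}$, where $t = |v|\,(a/b - \lfloor a/b\rfloor)$; such a word is called an $\frac{a}{b}$-power. A word is $\frac{a}{b}$-power-free if none of its factors is an $\frac{a}{b}$-power. For $\frac{a}{b} > 1$, $\textbf{w}_{a/b}$ denotes the lexicographically least infinite word over $\mathbb{Z}_{\geq 0}$ that is $\frac{a}{b}$-power-free. A morphism $\varphi$ on $\Sigma$ is a map $\Sigma \to \Sigma^*$ extended by concatenation; if $\varphi(c)$ begins with $c$, $\varphi^\infty(c)$ is the infinite fixed point beginning with $c$. Here $0'$ is a new letter not in $\mathbb{Z}_{\geq 0}$ and $\tau$ is the coding with $\tau(0')=0$, $\tau(n)=n$ for $n \in \mathbb{Z}_{\geq 0}$. *)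

theory Defs
  imports Main "HOL-Library.Omega_Words_Fun" "HOL-Library.Fun_Lexorder"
begin

section \<open>Fractional powers\<close>

text \<open>
  The word \<open>v\<^sup>a\<^sup>/\<^sup>b\<close>, for coprime positive \<open>a\<close>, \<open>b\<close> and \<open>b\<close> dividing \<open>length v\<close>.  Since
  \<open>a/b - \<lfloor>a/b\<rfloor> = (a mod b)/b\<close>, the length of the trailing partial copy is
  \<open>length v * (a mod b) / b\<close>, and this division is exact.
\<close>

definition frac_power :: "nat \<Rightarrow> nat \<Rightarrow> 'a list \<Rightarrow> 'a list" where
  "frac_power a b v =
     concat (replicate (a div b) v) @ take (length v * (a mod b) div b) v"

definition is_frac_power :: "nat \<Rightarrow> nat \<Rightarrow> 'a list \<Rightarrow> bool" where
  "is_frac_power a b y \<longleftrightarrow> (\<exists>v. v \<noteq> [] \<and> b dvd length v \<and> y = frac_power a b v)"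

definition frac_power_free :: "nat \<Rightarrow> nat \<Rightarrow> 'a word \<Rightarrow> bool" where
  "frac_power_free a b w \<longleftrightarrow> (\<forall>i j. \<not> is_frac_power a b (w [i \<rightarrow> j]))"

definition is_lex_least :: "nat word set \<Rightarrow> nat word \<Rightarrow> bool" where
  "is_lex_least S w \<longleftrightarrow> w \<in> S \<and> (\<forall>x\<in>S. x \<noteq> w \<longrightarrow> less_fun w x)"

definition lex_least_free :: "nat \<Rightarrow> nat \<Rightarrow> nat word" where
  "lex_least_free a b = (THE w. is_lex_least {w. frac_power_free a b w} w)"


section \<open>Morphisms\<close>

text \<open>
  A morphism is given by its values on letters; its value on a finite word \<open>xs\<close> is
  \<open>concat (map \<phi> xs)\<close>.  The image of an infinite word is the infinite concatenation of the
  images of its letters.  (The definition is meaningful only if that concatenation is infinite,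
  e.g. if no letter is erased.)
\<close>

definition word_image :: "('a \<Rightarrow> 'b list) \<Rightarrow> 'a word \<Rightarrow> 'b word" where
  "word_image \<phi> x n =
     (let m = LEAST m. n < length (concat (map \<phi> (prefix m x)))
      in concat (map \<phi> (prefix m x)) ! n)"

definition fixed_point :: "('a \<Rightarrow> 'a list) \<Rightarrow> 'a \<Rightarrow> 'a word" where
  "fixed_point \<phi> c = (THE x. x 0 = c \<and> word_image \<phi> x = x)"

datatype letter = Zero' | Num nat

primrec \<tau> :: "letter \<Rightarrow> nat" where
  "\<tau> Zero' = 0"
| "\<tau> (Num n) = n"

primrec \<phi>_of :: "letter list \<Rightarrow> letter list \<Rightarrow> letter \<Rightarrow> letter list" where
  "\<phi>_of u v Zero' = v @ (u @ [Num 0])"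
| "\<phi>_of u v (Num n) = u @ [Num n]"


section \<open>Automatic sequences\<close>

definition digits_value :: "nat \<Rightarrow> nat list \<Rightarrow> nat" where
  "digits_value k ds = foldl (\<lambda>n d. k * n + d) 0 ds"

text \<open>
  A deterministic finite automaton with output, with state set \<open>Q\<close>, reads base-\<open>k\<close>
  representations (most significant digit first, leading zeros allowed) and outputs the terms of
  the sequence.  States are natural numbers without loss of generality.
\<close>

definition k_automatic :: "nat \<Rightarrow> 'a word \<Rightarrow> bool" where
  "k_automatic k w \<longleftrightarrow> 2 \<le> k \<and>
     (\<exists>(Q :: nat set) (q\<^sub>0 :: nat) (\<delta> :: nat \<Rightarrow> nat \<Rightarrow> nat) (out :: nat \<Rightarrow> 'a).
        finite Q \<and> q\<^sub>0 \<in> Q \<and> (\<forall>q\<in>Q. \<forall>d<k. \<delta> q d \<in> Q) \<and>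
        (\<forall>ds. set ds \<subseteq> {..<k} \<longrightarrow> w (digits_value k ds) = out (foldl \<delta> q\<^sub>0 ds)))"


section \<open>The definite descriptions are well-defined\<close>

lemma is_lex_least_unique:
  assumes "is_lex_least S w" "is_lex_least S w'"
  shows "w = w'"
proof (rule ccontr)
  assume "w \<noteq> w'"
  hence "less_fun w w'" "less_fun w' w" using assms by (simp_all add: is_lex_least_def)
  thus False by (simp add: less_fun_asym)
qed

lemma is_lex_least_exists:
  assumes ne: "S \<noteq> {}"
    and closed: "\<And>w. (\<And>n. \<exists>x\<in>S. \<forall>i<n. x i = w i) \<Longrightarrow> w \<in> S"
  shows "\<exists>w. is_lex_least S w"
proof -
  define nxt where "nxt l = (LEAST c. \<exists>x\<in>S. prefix (Suc (length l)) x = l @ [c])" for l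
  define pre where "pre = rec_nat [] (\<lambda>_ l. l @ [nxt l])"
  have pre0: "pre 0 = []" and preS: "pre (Suc n) = pre n @ [nxt (pre n)]" for n
    by (simp_all add: pre_def)
  have len: "length (pre n) = n" for n by (induction n) (simp_all add: pre0 preS)
  define w where "w n = nxt (pre n)" for n
  have pre_w: "pre n = prefix n w" for n
  proof (induction n)
    case (Suc n)
    have "prefix (Suc n) w = prefix n w @ [w n]" by (simp add: subsequence_def)
    thus ?case by (simp only: preS w_def[of n] flip: Suc.IH)
  qed (simp add: pre0)
  have Suc_w: "prefix (Suc n) x = prefix n w @ [c] \<longleftrightarrow> (\<forall>i<n. x i = w i) \<and> x n = c"
    for x :: "nat word" and n c
    by (auto simp: subsequence_def)
  have w_eq: "w n = (LEAST c. \<exists>x\<in>S. (\<forall>i<n. x i = w i) \<and> x n = c)" for n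
  proof -
    have "w n = (LEAST c. \<exists>x\<in>S. prefix (Suc n) x = prefix n w @ [c])"
      by (simp only: w_def[of n] nxt_def len flip: pre_w)
    thus ?thesis unfolding Suc_w .
  qed
  have ex: "\<exists>x\<in>S. \<forall>i<n. x i = w i" for n
  proof (induction n)
    case 0 show ?case using ne by auto
  next
    case (Suc n)
    then obtain x where "x \<in> S" "\<forall>i<n. x i = w i" by blast
    hence "\<exists>c. \<exists>x\<in>S. (\<forall>i<n. x i = w i) \<and> x n = c" by (intro exI[of _ "x n"] bexI[of _ x] conjI refl)
    from LeastI_ex[OF this] have "\<exists>x\<in>S. (\<forall>i<n. x i = w i) \<and> x n = w n"
      by (simp only: w_eq[of n, symmetric])
    thus ?case by (auto simp: less_Suc_eq)
  qed
  have "w \<in> S" by (rule closed) (rule ex)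
  moreover have "less_fun w x" if x: "x \<in> S" "x \<noteq> w" for x
  proof -
    define k where "k = (LEAST k. x k \<noteq> w k)"
    have "\<exists>k. x k \<noteq> w k" using x by auto
    hence k: "x k \<noteq> w k" unfolding k_def by (rule LeastI_ex)
    have eq: "\<forall>i<k. x i = w i" using not_less_Least unfolding k_def by blast
    have "w k \<le> x k" unfolding w_eq[of k] by (rule Least_le) (intro bexI[of _ x] conjI eq x refl)
    thus ?thesis using k eq by (intro less_funI exI[of _ k]) simp
  qed
  ultimately show ?thesis unfolding is_lex_least_def by blast
qed

lemma length_frac_power:
  assumes "0 < b" "b dvd length v"
  shows "length (frac_power a b v) = length v div b * a"
proof -
  obtain m where m: "length v = b * m" using assms by blast
  have "m * (a mod b) \<le> b * m" using assms by (simp add: mult.commute)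
  hence "length (frac_power a b v) = (a div b) * (b * m) + m * (a mod b)"
    using assms by (simp add: frac_power_def m length_concat sum_list_replicate mult.assoc)
  also have "\<dots> = m * (b * (a div b) + a mod b)"
    by (simp only: distrib_left ac_simps)
  finally show ?thesis using assms m by (simp only: mult_div_mod_eq) simp
qed

lemma frac_power_free_id:
  assumes "0 < b" "b < a"
  shows "frac_power_free a b (\<lambda>n. n)"
  unfolding frac_power_free_def is_frac_power_def
proof (intro allI notI, elim exE conjE)
  fix i j :: nat and v :: "nat list"
  assume v: "v \<noteq> []" "b dvd length v" and eq: "(\<lambda>n. n) [i \<rightarrow> j] = frac_power a b v"
  have sub: "set (frac_power a b v) \<subseteq> set v"
    by (auto simp: frac_power_def dest: in_set_takeD)
  have "distinct ((\<lambda>n. n) [i \<rightarrow> j])" by (simp add: subsequence_def)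
  hence "length (frac_power a b v) = card (set (frac_power a b v))"
    using eq by (simp add: distinct_card)
  also have "\<dots> \<le> length v" using card_mono[OF _ sub] card_length[of v] by simp
  finally have "length v div b * a \<le> length v div b * b"
    using length_frac_power[OF assms(1) v(2)] v by simp
  moreover have "0 < length v div b" using v assms by (simp add: div_greater_zero_iff dvd_imp_le)
  ultimately show False using assms by simp
qed

theorem lex_least_free_is_lex_least:
  assumes "0 < b" "b < a"
  shows "is_lex_least {w. frac_power_free a b w} (lex_least_free a b)"
proof -
  have "\<exists>w. is_lex_least {w. frac_power_free a b w} w"
  proof (rule is_lex_least_exists)
    show "{w :: nat word. frac_power_free a b w} \<noteq> {}"
      using frac_power_free_id[OF assms] by blast
    fix w :: "nat word"
    assume *: "\<And>n. \<exists>x\<in>{w. frac_power_free a b w}. \<forall>i<n. x i = w i"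
    have "\<not> is_frac_power a b (w [i \<rightarrow> j])" for i j
    proof -
      from *[of j] obtain x where x: "frac_power_free a b x" "\<forall>i<j. x i = w i" by blast
      hence "(x [i \<rightarrow> j]) = (w [i \<rightarrow> j])" by (simp add: subsequence_def)
      thus ?thesis using x by (metis frac_power_free_def)
    qed
    thus "w \<in> {w. frac_power_free a b w}" by (simp add: frac_power_free_def)
  qed
  thus ?thesis unfolding lex_least_free_def by (metis is_lex_least_unique theI)
qed

lemma word_image_nth:
  assumes "n < length (concat (map \<phi> (prefix m x)))"
  shows "word_image \<phi> x n = concat (map \<phi> (prefix m x)) ! n"
proof -
  define k where "k = (LEAST m. n < length (concat (map \<phi> (prefix m x))))"
  have k: "n < length (concat (map \<phi> (prefix k x)))"
    unfolding k_def using assms by (rule LeastI)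
  have "k \<le> m" unfolding k_def using assms by (rule Least_le)
  then obtain l where "m = k + l" using le_Suc_ex by blast
  hence "concat (map \<phi> (prefix m x)) =
      concat (map \<phi> (prefix k x)) @ concat (map \<phi> (x [k \<rightarrow> m]))"
    using subsequence_append[of x k l] by simp
  thus ?thesis using k by (simp add: word_image_def Let_def nth_append flip: k_def)
qed

lemma length_image_ge:
  assumes "\<And>a. \<phi> a \<noteq> []"
  shows "length xs \<le> length (concat (map \<phi> xs))"
proof (induction xs)
  case (Cons a xs)
  have "0 < length (\<phi> a)" using assms by simp
  with Cons show ?case by (simp only: list.map concat.simps length_append list.size)
qed simp

lemma length_image_gt:
  assumes "\<And>a. \<phi> a \<noteq> []" "\<phi> c = c # t" "t \<noteq> []" "x 0 = c" "0 < n"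
  shows "n < length (concat (map \<phi> (prefix n x)))"
proof -
  have "prefix n x = c # (x [1 \<rightarrow> n])" using assms by (simp add: subsequence_def upt_rec)
  moreover have "n - 1 \<le> length (concat (map \<phi> (x [1 \<rightarrow> n])))"
    using length_image_ge[of \<phi> "x [1 \<rightarrow> n]"] assms by simp
  moreover have "0 < length t" using assms by simp
  ultimately show ?thesis using assms(2,5)
    by (simp only: list.map concat.simps length_append list.size)
qed

theorem fixed_point_is_fixed_point:
  assumes ne: "\<And>a. \<phi> a \<noteq> []" and c: "\<phi> c = c # t" "t \<noteq> []"
  shows "fixed_point \<phi> c 0 = c \<and> word_image \<phi> (fixed_point \<phi> c) = fixed_point \<phi> c"
    and "x 0 = c \<Longrightarrow> word_image \<phi> x = x \<Longrightarrow> x = fixed_point \<phi> c"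
proof -
  let ?P = "\<lambda>x. x 0 = c \<and> word_image \<phi> x = x"
  have unique: "x = y" if "?P x" "?P y" for x y
  proof
    fix n show "x n = y n"
    proof (induction n rule: less_induct)
      case (less n)
      show ?case
      proof (cases "n = 0")
        case False
        have "prefix n x = prefix n y" using less by (simp add: subsequence_def)
        moreover have "x n = concat (map \<phi> (prefix n x)) ! n"
          using word_image_nth[of n \<phi> _ n] length_image_gt[of \<phi> c t _ n] ne c that False by (metis gr0I)
        moreover have "y n = concat (map \<phi> (prefix n y)) ! n"
          using word_image_nth[of n \<phi> _ n] length_image_gt[of \<phi> c t _ n] ne c that False by (metis gr0I)
        ultimately show ?thesis by simp
      qed (use that in simp)
    qed
  qed
  define pre where
    "pre = rec_nat [c] (\<lambda>n l. l @ [concat (map \<phi> l) ! Suc n])"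
  have pre0: "pre 0 = [c]" and preS: "pre (Suc n) = pre n @ [concat (map \<phi> (pre n)) ! Suc n]" for n
    by (simp_all add: pre_def)
  define x where "x n = last (pre n)" for n
  have pre_x: "pre n = prefix (Suc n) x" for n
  proof (induction n)
    case 0 show ?case by (simp add: pre0 x_def subsequence_def)
  next
    case (Suc n)
    have "prefix (Suc (Suc n)) x = prefix (Suc n) x @ [x (Suc n)]" by (simp add: subsequence_def)
    moreover have "pre (Suc n) = pre n @ [x (Suc n)]" by (simp add: x_def preS)
    ultimately show ?case by (simp only: Suc.IH)
  qed
  have x0: "x 0 = c" by (simp add: x_def pre0)
  have "word_image \<phi> x n = x n" for n
  proof (cases n)
    case 0
    have "prefix (Suc 0) x = [c]" by (simp add: x0)
    thus ?thesis using word_image_nth[of 0 \<phi> x "Suc 0"] 0 c x0 by simp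
  next
    case (Suc k)
    have "x n = concat (map \<phi> (pre k)) ! n" by (simp add: Suc x_def preS)
    hence "x n = concat (map \<phi> (prefix n x)) ! n" by (simp only: pre_x Suc)
    thus ?thesis using word_image_nth[of n \<phi> x n] length_image_gt[of \<phi> c t x n] ne c x0 Suc by simp
  qed
  hence Px: "?P x" using x0 by blast
  hence P: "?P (fixed_point \<phi> c)" unfolding fixed_point_def
    using theI[of ?P x, OF Px] unique[OF _ Px] by blast
  show "?P (fixed_point \<phi> c)" by (rule P)
  show "x = fixed_point \<phi> c" if "x 0 = c" "word_image \<phi> x = x" for x
    using unique P that by blast
qed

end

theory Submission
  imports Defs "HOL-Library.Countable"
begin

text \<open>
  A 27/23-power of length \<open>27 * m\<close> is a match of length \<open>4 * m\<close> at distance \<open>23 * m\<close>.  Except at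
  twelve positions, every letter of \<open>v\<close> is the least one avoiding such powers with \<open>m \<le> 3\<close>.
  This is a rule with memory 80, so \<open>v\<close> keeps running into cycles (of periods 668, 151, 224, 1138,
  151 and 151), and it leaves a cycle only where a 27/23-power of large period is about to be
  completed; the block \<open>u\<close> is the last cycle.  Hence about 4000 letters determine the whole word.

  Factors of bounded length only depend on boundedly many repetitions of each cycle, so freeness
  for \<open>m < 20\<close> and leastness at all but the twelve positions are finite checks, in which the last
  letter of each block is treated as unknown.  At the twelve positions, and at the last letters of
  the blocks, the forcing power is obtained from periodicity and from the morphism, respectively.

  For \<open>m \<ge> 20\<close>, a decision tree locates a nonzero letter from the 52 letters after it, up to the
  phase in its cycle.  Two matching windows therefore lie in stretches of the same cycle, which
  determines \<open>m\<close> modulo its period; the few remaining cases in \<open>v\<close> are refuted by letters at which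
  the cycles are left.  Among the blocks, \<open>m\<close> is a multiple of 353 and the last letters of the
  blocks contain a repetition with \<open>m div 353\<close> in place of \<open>m\<close>.
\<close>

section \<open>Bounded factors do not see long repetitions\<close>

section \<open>Windows of words with repeated blocks\<close>

text \<open>The threshold 20 meets two demands. A match of length \<open>4 * m\<close> has to
  contain a nonzero letter together with the 52 letters after it. Freeness for \<open>m = 1\<close>
  puts a nonzero letter among any 27 positions, and \<open>27 \<le> 4 * m - 53\<close> from
  \<open>m = 20\<close> on. Below that, a power has length at most \<open>27 * 19 = 513\<close>, so
  513 bounds the windows that the shortened cycles must preserve.

  Equal labels at distance \<open>23 * m\<close> can be solved for \<open>m\<close> because 23 is
  invertible modulo 668, 151, 224, 1138 and 353.

  The seam between \<open>v\<close> and the blocks is the delicate point. The last letter of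
  \<open>v\<close> is a 1 followed by \<open>u\<close>, just like the end of a block whose last
  letter is 1, so no decision tree can tell them apart and it is labelled as such an end. When a
  repetition among the blocks is scaled down by 353, this 1 therefore acts as a letter at position
  -1, and freeness is also needed for the word with a 1 put in front of it.\<close>

definition all_windows :: "nat \<Rightarrow> ('a list \<Rightarrow> bool) \<Rightarrow> 'a list \<Rightarrow> bool" where
  "all_windows L Q w \<longleftrightarrow> (\<forall>i. i + L \<le> length w \<longrightarrow> Q (take L (drop i w)))"

lemma all_windows_map: "all_windows L Q (map f w) \<longleftrightarrow> all_windows L (\<lambda>x. Q (map f x)) w"
  by (simp add: all_windows_def take_map drop_map)

abbreviation list_power :: "'a list \<Rightarrow> nat \<Rightarrow> 'a list" where
  "list_power w k \<equiv> concat (replicate k w)"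

lemma length_list_power: "length (list_power w k) = k * length w"
  by (induction k) auto

lemma list_power_Suc': "list_power w (Suc k) = list_power w k @ w"
  by (induction k) auto

lemma nth_list_power: "i < k * length w \<Longrightarrow> list_power w k ! i = w ! (i mod length w)"
proof (induction k arbitrary: i)
  case (Suc k)
  then show ?case by (cases "i < length w") (auto simp: nth_append le_mod_geq)
qed simp

text \<open>A window starting in \<open>u\<close> or in the first copy of \<open>w\<close> ends
  within the first \<open>k\<close> copies, so the extra copy is invisible to it. Any later window
  is unchanged when one copy of \<open>w\<close> in front of it is deleted.\<close>

lemma all_windows_pump_Suc:
  assumes "all_windows L Q (u @ list_power w k @ v)" "length w + L \<le> k * length w"
  shows "all_windows L Q (u @ list_power w (Suc k) @ v)"
  unfolding all_windows_def
proof (intro allI impI)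
  fix i assume i: "i + L \<le> length (u @ list_power w (Suc k) @ v)"
  show "Q (take L (drop i (u @ list_power w (Suc k) @ v)))"
  proof (cases "i < length u + length w")
    case True
    have "take L (drop i (u @ list_power w (Suc k) @ v)) = take L (drop i (u @ list_power w k @ v))"
      using True assms(2) unfolding list_power_Suc'
      by (simp add: take_append drop_append length_list_power)
    moreover have "i + L \<le> length (u @ list_power w k @ v)"
      using True assms(2) by (simp add: length_list_power)
    ultimately show ?thesis using assms(1) by (simp add: all_windows_def)
  next
    case False
    then have "drop i (u @ list_power w (Suc k) @ v) = drop (i - length w) (u @ list_power w k @ v)"
      by (simp add: drop_append add.commute)
    moreover have "i - length w + L \<le> length (u @ list_power w k @ v)"
      using False i by simp
    ultimately show ?thesis using assms(1) unfolding all_windows_def by metis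
  qed
qed

lemma all_windows_pump:
  assumes "all_windows L Q (u @ list_power w k @ v)" "length w + L \<le> k * length w" "k \<le> l"
  shows "all_windows L Q (u @ list_power w l @ v)"
  using assms(3)
proof (induction l rule: dec_induct)
  case (step n)
  then have "length w + L \<le> n * length w" using assms(2) by (meson le_trans less_imp_le mult_le_mono1)
  then show ?case using step all_windows_pump_Suc by blast
qed (rule assms(1))

definition blocks :: "('a list \<times> nat) list \<Rightarrow> 'a list" where
  "blocks bs = concat (map (\<lambda>(w, k). list_power w k) bs)"

text \<open>An unchanged count carries no length condition, which serves the aperiodic pieces. A
  growing count requires that the copies already exceed a window by a full period.\<close>

definition pumped :: "nat \<Rightarrow> 'a list \<times> nat \<Rightarrow> 'a list \<times> nat \<Rightarrow> bool" where
  "pumped L = (\<lambda>(w, k) (w', l). w = w' \<and> (k = l \<or> k \<le> l \<and> length w + L \<le> k * length w))"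

text \<open>The prefix \<open>u\<close> is arbitrary so that it can absorb the head block while the
  tail is pumped.\<close>

lemma all_windows_blocks:
  assumes "list_all2 (pumped L) bs cs" "all_windows L Q (u @ blocks bs @ v)"
  shows "all_windows L Q (u @ blocks cs @ v)"
  using assms
proof (induction arbitrary: u rule: list_all2_induct)
  case (Cons b bs c cs)
  obtain w k l where bc: "b = (w, k)" "c = (w, l)" "k = l \<or> k \<le> l \<and> length w + L \<le> k * length w"
    using Cons.hyps by (auto simp: pumped_def split: prod.splits)
  have "all_windows L Q ((u @ list_power w k) @ blocks cs @ v)"
    using Cons.prems by (intro Cons.IH) (simp add: blocks_def bc)
  then have "all_windows L Q (u @ list_power w k @ blocks cs @ v)" by simp
  then have "all_windows L Q (u @ list_power w l @ blocks cs @ v)"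
    using bc(3) all_windows_pump by metis
  then show ?case by (simp add: blocks_def bc)
qed simp


section \<open>Checks on partially known words\<close>

section \<open>Letters and their scanners\<close>

text \<open>
  \<open>J\<close> and \<open>E\<close> are marked copies of \<open>I\<close> and \<open>D\<close>, placed where the letter is forced by a power of
  large period; \<open>W\<close> stands for an unknown letter in \<open>{0, 1, 2}\<close>.
\<close>

datatype sym = Z | I | D | W | J | E

fun um :: "sym \<Rightarrow> sym" where
  "um J = I" | "um E = D" | "um Z = Z" | "um I = I" | "um D = D" | "um W = W"

fun val :: "sym \<Rightarrow> nat" where
  "val J = 1" | "val E = 2" | "val Z = 0" | "val I = 1" | "val D = 2" | "val W = 0"

definition agrees :: "sym \<Rightarrow> nat \<Rightarrow> bool" where
  "agrees a n \<longleftrightarrow> (if um a = W then n \<le> 2 else n = val a)"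

text \<open>With \<open>eqs\<close> this forms a three-valued comparison: as soon as
  \<open>W\<close> is involved neither holds, so both verdicts stay valid for every value of the
  unknown letter.\<close>

definition mis :: "sym \<Rightarrow> sym \<Rightarrow> bool" where
  "mis a b \<longleftrightarrow> um a \<noteq> W \<and> um b \<noteq> W \<and> um a \<noteq> um b"

definition eqs :: "sym \<Rightarrow> sym \<Rightarrow> bool" where
  "eqs a b \<longleftrightarrow> um a = um b \<and> um a \<noteq> W"

lemma val_um [simp]: "val (um a) = val a" by (cases a) auto

lemma um_um [simp]: "um (um a) = um a" by (cases a) auto

lemma mis_agrees: "mis a b \<Longrightarrow> agrees a x \<Longrightarrow> agrees b y \<Longrightarrow> x \<noteq> y"
  by (cases a; cases b) (auto simp: mis_def agrees_def)

lemma eqs_agrees: "eqs a b \<Longrightarrow> agrees a x \<Longrightarrow> agrees b y \<Longrightarrow> x = y"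
  by (cases a; cases b) (auto simp: eqs_def agrees_def)

subsection \<open>Runs of matches\<close>

text \<open>\<open>c\<close> is the number of further matches allowed before a mismatch is due.\<close>

fun chk :: "nat \<Rightarrow> nat \<Rightarrow> sym list \<Rightarrow> sym list \<Rightarrow> bool" where
  "chk k c (a # v) (b # w) = (if mis a b then chk k k v w else c \<noteq> 0 \<and> chk k (c - 1) v w)"
| "chk k c _ _ = True"

text \<open>The second claim at \<open>i = 0\<close> falls back on the first, since the budget left
  at the head is at most \<open>k\<close>. For a later start it recurs on itself.\<close>

lemma chk_D:
  assumes "chk k c v w" "c \<le> k"
  shows "c < length v \<Longrightarrow> c < length w \<Longrightarrow> \<exists>t\<le>c. mis (v ! t) (w ! t)"
    and "i + k < length v \<Longrightarrow> i + k < length w \<Longrightarrow> \<exists>t\<le>k. mis (v ! (i + t)) (w ! (i + t))"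
  using assms
proof (induction k c v w arbitrary: i rule: chk.induct)
  case (1 k c a v b w)
  { case 1
    show ?case
    proof (cases "mis a b")
      case False
      then obtain d where d: "c = Suc d" "chk k d v w" using 1 by (cases c) auto
      then have "\<exists>t\<le>d. mis (v ! t) (w ! t)" using "1.IH"(3)[OF False] 1 by auto
      then show ?thesis using d by force
    qed auto
  next
    case 2
    show ?case
    proof (cases i)
      case i: 0
      show ?thesis
      proof (cases "mis a b")
        case True
        then show ?thesis using i by (auto intro: exI[of _ 0])
      next
        case False
        then obtain d where d: "c = Suc d" "chk k d v w" using 2 by (cases c) auto
        then have "\<exists>t\<le>d. mis (v ! t) (w ! t)" using "1.IH"(3)[OF False] 2 by auto
        then obtain t where "t \<le> d" "mis (v ! t) (w ! t)" by blast
        then show ?thesis using d i 2 by (intro exI[of _ "Suc t"]) auto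
      qed
    next
      case (Suc j)
      show ?thesis
      proof (cases "mis a b")
        case True
        then show ?thesis using "1.IH"(2)[OF True, of j] 2 Suc by auto
      next
        case False
        then show ?thesis using "1.IH"(4)[OF False, of j] 2 Suc by auto
      qed
    qed
  }
qed auto

lemma chk_all_windows:
  assumes "chk (4 * m - 1) (4 * m - 1) w (drop (23 * m) w)" "0 < m"
  shows "all_windows (27 * m) (\<lambda>x. \<exists>k<4 * m. mis (x ! k) (x ! (23 * m + k))) w"
  unfolding all_windows_def
proof (intro allI impI)
  fix i assume i: "i + 27 * m \<le> length w"
  have "i + (4 * m - 1) < length w" "i + (4 * m - 1) < length (drop (23 * m) w)"
    using i assms(2) by simp_all
  from chk_D(2)[OF assms(1) order_refl this]
  obtain t where "t \<le> 4 * m - 1" "mis (w ! (i + t)) (drop (23 * m) w ! (i + t))" by blast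
  then show "\<exists>k<4 * m. mis (take (27 * m) (drop i w) ! k) (take (27 * m) (drop i w) ! (23 * m + k))"
    using i assms(2) by (intro exI[of _ t]) (auto simp: ac_simps)
qed

text \<open>
  The streaming variants traverse a list of named chunks; a chunk is unfolded only when it is
  reached, which keeps the terms small.
\<close>

definition chk_stream :: "nat \<Rightarrow> nat \<Rightarrow> sym list \<Rightarrow> sym list list \<Rightarrow> sym list \<Rightarrow> sym list list \<Rightarrow>
    bool" where
  "chk_stream k c v vs w ws = chk k c (v @ concat vs) (w @ concat ws)"

definition chk_skip :: "nat \<Rightarrow> nat \<Rightarrow> sym list list \<Rightarrow> sym list \<Rightarrow> sym list list \<Rightarrow> bool" where
  "chk_skip d k vs w ws = chk k k (concat vs) (drop d (w @ concat ws))"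

text \<open>Marks are invisible to the comparison. This yields the rewrite rules that turn
  \<open>J\<close> and \<open>E\<close> into \<open>I\<close> and \<open>D\<close> when they are
  reached.\<close>

lemma chk_um: "chk k c v w = chk k c (map um v) (map um w)"
  by (induction k c v w rule: chk.induct) (auto simp: mis_def)

lemma chk_Nil2: "chk k c v [] = True"
  by (cases v) auto

lemma chk_stream_simps:
  "chk_stream k c (Z # v) vs (I # w) ws = chk_stream k k v vs w ws"
  "chk_stream k c (Z # v) vs (D # w) ws = chk_stream k k v vs w ws"
  "chk_stream k c (I # v) vs (Z # w) ws = chk_stream k k v vs w ws"
  "chk_stream k c (I # v) vs (D # w) ws = chk_stream k k v vs w ws"
  "chk_stream k c (D # v) vs (Z # w) ws = chk_stream k k v vs w ws"
  "chk_stream k c (D # v) vs (I # w) ws = chk_stream k k v vs w ws"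
  "chk_stream k (Suc c) (Z # v) vs (Z # w) ws = chk_stream k c v vs w ws"
  "chk_stream k (Suc c) (I # v) vs (I # w) ws = chk_stream k c v vs w ws"
  "chk_stream k (Suc c) (D # v) vs (D # w) ws = chk_stream k c v vs w ws"
  "chk_stream k (Suc c) (a # v) vs (W # w) ws = chk_stream k c v vs w ws"
  "chk_stream k (Suc c) (W # v) vs (b # w) ws = chk_stream k c v vs w ws"
  "chk_stream k c (J # v) vs w ws = chk_stream k c (I # v) vs w ws"
  "chk_stream k c (E # v) vs w ws = chk_stream k c (D # v) vs w ws"
  "chk_stream k c v vs (J # w) ws = chk_stream k c v vs (I # w) ws"
  "chk_stream k c v vs (E # w) ws = chk_stream k c v vs (D # w) ws"
  "chk_stream k c [] (x # vs) w ws = chk_stream k c x vs w ws"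
  "chk_stream k c v vs [] (y # ws) = chk_stream k c v vs y ws"
  "chk_stream k c v vs [] [] = True"
  "chk_skip 0 k vs w ws = chk_stream k k [] vs w ws"
  "chk_skip (Suc d) k vs (a # w) ws = chk_skip d k vs w ws"
  "chk_skip (Suc d) k vs [] (x # ws) = chk_skip (Suc d) k vs x ws"
  by (simp_all add: chk_stream_def chk_skip_def chk_Nil2 mis_def)
     (subst (1 2) chk_um, simp)+

lemma chk_stream_unfold:
  assumes "c = l"
  shows "chk_stream k n c vs w ws = chk_stream k n l vs w ws"
    and "chk_stream k n v vs c ws = chk_stream k n v vs l ws"
    and "chk_skip d k vs c ws = chk_skip d k vs l ws"
  using assms by simp_all

subsection \<open>Letters forced by a power of small period\<close>

fun match_upto :: "nat \<Rightarrow> sym list \<Rightarrow> sym list \<Rightarrow> bool" where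
  "match_upto 0 h g = True"
| "match_upto (Suc k) (a # h) (b # g) = (eqs a b \<and> match_upto k h g)"
| "match_upto (Suc k) _ _ = False"

fun ends_match :: "sym list \<Rightarrow> sym \<Rightarrow> nat \<Rightarrow> sym list \<Rightarrow> bool" where
  "ends_match [] s k h = False"
| "ends_match (a # g) s k h = (eqs a s \<and> match_upto k h g)"

text \<open>
  The history \<open>h\<close> lists the preceding letters, most recent first: appending \<open>s\<close> would complete
  a 27/23-power of length \<open>27 * m\<close>.
\<close>

definition forbids :: "nat \<Rightarrow> sym \<Rightarrow> sym list \<Rightarrow> bool" where
  "forbids m s h = ends_match (drop (23 * m - 1) h) s (4 * m - 1) h"

definition forbidden :: "sym \<Rightarrow> sym list \<Rightarrow> bool" where
  "forbidden s h \<longleftrightarrow> forbids 1 s h \<or> forbids 2 s h \<or> forbids 3 s h"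

text \<open>\<open>J\<close> demands nothing and \<open>E\<close> only the exclusion of 0: at these
  positions the remaining smaller letter is excluded by a power of larger period. \<open>W\<close>
  demands nothing because leastness there is inherited through the morphism.\<close>

fun minimal :: "sym \<Rightarrow> sym list \<Rightarrow> bool" where
  "minimal I h = forbidden Z h"
| "minimal D h = (forbidden Z h \<and> forbidden I h)"
| "minimal E h = forbidden Z h"
| "minimal _ h = True"

lemma match_upto_iff:
  "match_upto k h g \<longleftrightarrow> k \<le> length h \<and> k \<le> length g \<and> (\<forall>t<k. eqs (h ! t) (g ! t))"
  by (induction k h g rule: match_upto.induct) (auto simp: less_Suc_eq_0_disj)

lemma forbids_iff:
  assumes "0 < m"
  shows "forbids m s h \<longleftrightarrow> 27 * m \<le> length h + 1 \<and> eqs (h ! (23 * m - 1)) s \<and>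
    (\<forall>t<4 * m - 1. eqs (h ! t) (h ! (23 * m + t)))"
proof (cases "23 * m - 1 < length h")
  case True
  then have "drop (23 * m - 1) h = h ! (23 * m - 1) # drop (23 * m) h"
    using Cons_nth_drop_Suc[OF True] assms by simp
  then show ?thesis using True assms by (auto simp: forbids_def match_upto_iff)
qed (use assms in \<open>auto simp: forbids_def\<close>)

text \<open>\<open>80 = 27 * 3 - 1\<close> letters precede the last letter of the longest power
  considered.\<close>

lemma forbids_take:
  assumes "0 < m" "m \<le> 3"
  shows "forbids m s (take 80 h) \<longleftrightarrow> forbids m s h"
proof -
  have "27 * m \<le> 81" using assms by simp
  then show ?thesis using assms by (subst (1 2) forbids_iff) auto
qed

lemma forbidden_take: "forbidden s (take 80 h) \<longleftrightarrow> forbidden s h"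
  by (simp add: forbidden_def forbids_take)

lemma minimal_take: "minimal a (take 80 h) \<longleftrightarrow> minimal a h"
  by (cases a) (simp_all add: forbidden_take)

lemma forbids_append: "0 < m \<Longrightarrow> forbids m s h \<Longrightarrow> forbids m s (h @ h')"
  by (auto simp: forbids_iff nth_append)

lemma minimal_append: "minimal a h \<Longrightarrow> minimal a (h @ h')"
  by (cases a) (auto simp: forbidden_def dest: forbids_append[of _ _ _ h', rotated])

text \<open>Trimming the history at chunk boundaries keeps the terms bounded. It is sound by
  \<open>minimal_append\<close>: a power found in a shorter history is also found in a longer
  one.\<close>

fun all_minimal :: "sym list \<Rightarrow> sym list \<Rightarrow> sym list list \<Rightarrow> bool" where
  "all_minimal h [] [] = True"
| "all_minimal h [] (x # vs) = all_minimal (take 80 h) x vs"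
| "all_minimal h (a # v) vs = (minimal a h \<and> all_minimal (a # h) v vs)"

lemma all_minimal_D:
  "all_minimal h v vs \<Longrightarrow> i < length (v @ concat vs) \<Longrightarrow>
    minimal ((v @ concat vs) ! i) (rev (take i (v @ concat vs)) @ h)"
proof (induction h v vs arbitrary: i rule: all_minimal.induct)
  case (2 h x vs)
  then have "minimal (concat (x # vs) ! i) (rev (take i (concat (x # vs))) @ take 80 h)" by simp
  then have "minimal (concat (x # vs) ! i) ((rev (take i (concat (x # vs))) @ take 80 h) @ drop 80 h)"
    by (rule minimal_append)
  then show ?case by simp
next
  case (3 h a v vs)
  then show ?case by (cases i) auto
qed simp

text \<open>The padding by \<open>W\<close> lets positions with a short history be treated by
  windows of full length. As \<open>W\<close> matches nothing, no power found can reach into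
  it.\<close>

lemma all_minimal_windows:
  assumes "all_minimal [] [] vs"
  shows "all_windows 81 (\<lambda>x. minimal (x ! 80) (rev (take 80 x))) (replicate 80 W @ concat vs)"
  unfolding all_windows_def
proof (intro allI impI)
  let ?p = "replicate 80 W" and ?w = "concat vs"
  let ?v = "?p @ ?w"
  fix i assume i: "i + 81 \<le> length ?v"
  then have "minimal (?w ! i) (rev (take i ?w))"
    using all_minimal_D[OF assms, of i] by simp
  then have "minimal (?w ! i) (take 80 (rev (take i ?w) @ rev ?p))"
    unfolding minimal_take by (rule minimal_append)
  moreover have "rev (take i ?w) @ rev ?p = rev (take (i + 80) ?v)"
    by (simp add: take_append)
  moreover have "take 80 (rev (take (i + 80) ?v)) = rev (take 80 (drop i ?v))"
    using i by (simp only: take_rev take_drop length_take) (simp add: add.commute min_def)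
  moreover have "?w ! i = ?v ! (i + 80)" by (simp add: nth_append)
  moreover have "?v ! (i + 80) = take 81 (drop i ?v) ! 80"
    using i by (simp only: nth_take nth_drop)
  moreover have "take 80 (take 81 (drop i ?v)) = take 80 (drop i ?v)"
    by (simp only: take_take) simp
  ultimately show "minimal (take 81 (drop i ?v) ! 80) (rev (take 80 (take 81 (drop i ?v))))"
    by (simp only:)
qed

lemma all_minimal_unfold: "c = l \<Longrightarrow> all_minimal h c vs = all_minimal h l vs"
  by simp

subsection \<open>Locating a factor by a decision tree\<close>

text \<open>\<open>L\<close> gives the label, \<open>N\<close> is a branch that never occurs,
  \<open>S\<close> reads a letter without branching, \<open>B\<close> branches on 0, 1 or 2.\<close>

datatype tree = L nat | N | S tree | B tree tree tree

fun walk :: "tree \<Rightarrow> nat list \<Rightarrow> nat" where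
  "walk (L n) w = n"
| "walk (S a) (x # w) = walk a w"
| "walk (B a b c) (x # w) = walk (if x = 0 then a else if x = 1 then b else c) w"
| "walk _ _ = 0"

text \<open>Running out of letters counts as success, which makes the predicate stable under
  truncation (\<open>locates_append\<close>). The bound \<open>depth_le\<close> ensures that this
  case decides nothing on windows of full length.\<close>

fun locates :: "tree \<Rightarrow> sym list \<Rightarrow> nat \<Rightarrow> bool" where
  "locates (L n) w l = (n = l)"
| "locates N w l = False"
| "locates t [] l = True"
| "locates (S a) (x # w) l = locates a w l"
| "locates (B a b c) (Z # w) l = locates a w l"
| "locates (B a b c) (I # w) l = locates b w l"
| "locates (B a b c) (J # w) l = locates b w l"
| "locates (B a b c) (D # w) l = locates c w l"
| "locates (B a b c) (E # w) l = locates c w l"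
| "locates (B a b c) (W # w) l = (locates a w l \<and> locates b w l \<and> locates c w l)"

fun depth_le :: "nat \<Rightarrow> tree \<Rightarrow> bool" where
  "depth_le n (L i) = True"
| "depth_le n N = True"
| "depth_le (Suc n) (S a) = depth_le n a"
| "depth_le (Suc n) (B a b c) = (depth_le n a \<and> depth_le n b \<and> depth_le n c)"
| "depth_le 0 _ = False"

lemma walk_locates:
  "locates t w l \<Longrightarrow> list_all2 agrees w x \<Longrightarrow> depth_le (length w) t \<Longrightarrow> walk t x = l"
proof (induction t w l arbitrary: x rule: locates.induct)
  case (10 a b c w l)
  then obtain y z where "x = y # z" "list_all2 agrees w z"
    by (auto simp: list_all2_Cons1)
  then show ?case using 10 by auto
qed (auto simp: agrees_def list_all2_Cons1)

lemma locates_append: "locates t (w @ w') l \<Longrightarrow> locates t w l"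
  by (induction t w l rule: locates.induct) auto

definition locates_stream :: "tree \<Rightarrow> sym list \<Rightarrow> (nat \<times> sym list) list \<Rightarrow> nat \<Rightarrow> bool" where
  "locates_stream t w ws l = locates t (w @ concat (map snd ws)) l"

lemma locates_stream_simps:
  "locates_stream (L n) w ws l = (n = l)"
  "locates_stream (S a) (x # w) ws l = locates_stream a w ws l"
  "locates_stream (B a b c) (Z # w) ws l = locates_stream a w ws l"
  "locates_stream (B a b c) (I # w) ws l = locates_stream b w ws l"
  "locates_stream (B a b c) (J # w) ws l = locates_stream b w ws l"
  "locates_stream (B a b c) (D # w) ws l = locates_stream c w ws l"
  "locates_stream (B a b c) (E # w) ws l = locates_stream c w ws l"
  "locates_stream (B a b c) (W # w) ws l =
    (locates_stream a w ws l \<and> locates_stream b w ws l \<and> locates_stream c w ws l)"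
  "locates_stream t [] ((i, y) # ws) l = locates_stream t y ws l"
  "locates_stream (S a) [] [] l = True"
  "locates_stream (B a b c) [] [] l = True"
  by (simp_all add: locates_stream_def)

lemma locates_stream_unfold:
  assumes "c = d"
  shows "locates_stream t c ws l = locates_stream t d ws l"
  using assms by simp

lemma tree_unfold:
  assumes "t = u"
  shows "locates_stream t w ws l = locates_stream u w ws l" "depth_le n t = depth_le n u"
  using assms by simp_all

fun located :: "tree \<Rightarrow> tree \<Rightarrow> sym \<Rightarrow> sym list \<Rightarrow> nat \<Rightarrow> bool" where
  "located t u Z w l = True"
| "located t u I w l = locates t w l"
| "located t u J w l = locates t w l"
| "located t u D w l = locates u w l"
| "located t u E w l = locates u w l"
| "located t u W w l = (locates t w l \<and> locates u w l)"

definition labelled :: "nat \<times> sym list \<Rightarrow> (nat \<times> sym) list" where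
  "labelled = (\<lambda>(l, w). zip [l..<l + length w] w)"

fun all_located :: "tree \<Rightarrow> tree \<Rightarrow> nat \<Rightarrow> sym list \<Rightarrow> (nat \<times> sym list) list \<Rightarrow> bool" where
  "all_located t u l [] [] = True"
| "all_located t u l [] ((i, x) # ws) = all_located t u i x ws"
| "all_located t u l (a # w) ws =
    (located t u a (w @ concat (map snd ws)) l \<and> all_located t u (Suc l) w ws)"

lemma all_located_simps:
  "all_located t u l (Z # w) ws = all_located t u (Suc l) w ws"
  "all_located t u l (I # w) ws = (locates_stream t w ws l \<and> all_located t u (Suc l) w ws)"
  "all_located t u l (J # w) ws = (locates_stream t w ws l \<and> all_located t u (Suc l) w ws)"
  "all_located t u l (D # w) ws = (locates_stream u w ws l \<and> all_located t u (Suc l) w ws)"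
  "all_located t u l (E # w) ws = (locates_stream u w ws l \<and> all_located t u (Suc l) w ws)"
  "all_located t u l (W # w) ws =
    (locates_stream t w ws l \<and> locates_stream u w ws l \<and> all_located t u (Suc l) w ws)"
  by (simp_all add: locates_stream_def)

lemma all_located_unfold: "c = d \<Longrightarrow> all_located t u l c ws = all_located t u l d ws"
  by simp

lemma map_snd_labelled: "map snd (labelled p) = snd p"
  by (cases p) (simp add: labelled_def)

lemma labelled_Cons: "labelled (l, a # w) = (l, a) # labelled (Suc l, w)"
  by (simp add: labelled_def upt_rec)

lemma labelled_append: "labelled (l, v @ w) = labelled (l, v) @ labelled (l + length v, w)"
  by (induction v arbitrary: l) (simp_all add: labelled_Cons, simp add: labelled_def)

lemma all_located_D:
  assumes "all_located t u l w ws"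
    "i < length (labelled (l, w) @ concat (map labelled ws))"
  shows "case (labelled (l, w) @ concat (map labelled ws)) ! i of (n, a) \<Rightarrow>
    located t u a (map snd (drop (Suc i) (labelled (l, w) @ concat (map labelled ws)))) n"
  using assms
proof (induction t u l w ws arbitrary: i rule: all_located.induct)
  case (1 t u l)
  then show ?case by (simp add: labelled_def)
next
  case (2 t u l n x ws)
  then show ?case by (simp add: labelled_def)
next
  case (3 t u l a w ws)
  then show ?case
    by (cases i) (auto simp: labelled_Cons map_snd_labelled map_concat o_def)
qed

lemma located_append: "located t u a (w @ w') l \<Longrightarrow> located t u a w l"
  by (cases a) (auto dest: locates_append)

lemma all_located_windows:
  assumes "all_located t u 0 [] ws" "0 < k"
  shows "all_windows k (\<lambda>x. located t u (snd (x ! 0)) (map snd (tl x)) (fst (x ! 0)))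
    (concat (map labelled ws))"
  unfolding all_windows_def
proof (intro allI impI)
  let ?w = "concat (map labelled ws)"
  fix i assume i: "i + k \<le> length ?w"
  have e: "labelled (0, []) = []" by (simp add: labelled_def)
  have "located t u (snd (?w ! i)) (map snd (drop (Suc i) ?w)) (fst (?w ! i))"
    using all_located_D[OF assms(1), of i] i assms(2) by (simp add: e split: prod.splits)
  moreover have "drop (Suc i) ?w = tl (take k (drop i ?w)) @ drop (i + k) ?w"
  proof -
    have "take k (drop i ?w) \<noteq> []" using i assms(2) by auto
    then have "tl (take k (drop i ?w) @ drop k (drop i ?w)) = tl (take k (drop i ?w)) @ drop k (drop i ?w)"
      by (rule tl_append2)
    then have "tl (drop i ?w) = tl (take k (drop i ?w)) @ drop k (drop i ?w)"
      by (simp only: append_take_drop_id)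
    then show ?thesis by (simp add: drop_Suc tl_drop add.commute)
  qed
  ultimately show "located t u (snd (take k (drop i ?w) ! 0)) (map snd (tl (take k (drop i ?w))))
      (fst (take k (drop i ?w) ! 0))"
    using i assms(2) by (auto dest: located_append)
qed

section \<open>Cycles, interruptions and decision trees\<close>

section \<open>The data\<close>

text \<open>
  A segment \<open>(b, cs, k)\<close> stands for \<open>k\<close> copies of \<open>concat cs\<close>, the letters of each copy being
  labelled \<open>b, b + 1, \<dots>\<close>.  Letters in the same phase of the same cycle get the same label, namely
  the first position of that phase, and all other letters are labelled by their position.  The
  cycles are \<open>pa\<close> to \<open>pf\<close>, and \<open>pu\<close> is the block \<open>u\<close> followed by an unknown letter.
\<close>

definition pa1 :: "sym list" where
  "pa1 = [I,Z,Z,Z,Z]"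

definition pa2 :: "sym list" where
  "pa2 = [Z,Z,Z,I,Z,Z,Z,Z,Z,Z,Z,I,Z,Z,Z,I,Z,Z,Z,Z,Z,Z,I,Z,Z,Z,Z,Z,Z,Z,I,Z,Z,Z,Z,Z,Z,Z,Z,Z,Z,Z,I,Z,
   Z,Z,Z,Z,Z,I,I,Z,Z,Z,Z,Z,Z,I,I,Z,Z,Z,I,Z,Z,Z,Z,Z,Z,I,Z,Z,Z,Z,Z,Z,Z,I,Z,Z,Z,Z,Z,Z,Z,D,Z,Z,Z,I,Z,
   Z,Z,Z,Z,Z,I,Z,Z,Z,Z,Z,Z,Z,I,Z,Z,Z,Z,Z,Z,Z,Z,Z,Z,Z,I,Z,Z,Z,Z,Z,Z,I,I,Z,Z,Z,Z,Z,Z,I,Z,Z,Z]"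

definition pa3 :: "sym list" where
  "pa3 = [I,Z,Z,Z,D,Z,Z,Z,I,Z,Z,Z,Z,Z,Z,Z]"

definition pa4 :: "sym list" where
  "pa4 = [I,Z,Z,Z,Z,Z,Z,Z,I,Z,Z,Z,Z,Z,Z,Z,Z,Z,Z,I]"

definition pa5 :: "sym list" where
  "pa5 = [Z,Z,Z,Z,Z,Z,Z,I,Z,Z,Z,Z,Z,Z,Z]"

definition pa6 :: "sym list" where
  "pa6 = [I]"

definition pa7 :: "sym list" where
  "pa7 = [Z,Z,Z,I,Z,Z,Z,Z,Z,Z,I,I,Z,Z,Z]"

definition pa8 :: "sym list" where
  "pa8 = [Z,Z,Z,I,I,Z,Z,Z,Z,Z,Z,Z,I,Z,Z,Z,I,Z,Z,Z,Z,Z,Z,I,Z,Z,Z,Z,Z,Z,Z,I,Z,Z,Z,Z,Z,Z,Z,Z,Z,Z,Z,I,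
   Z,Z,Z,Z,Z,Z,I,Z,Z,Z,Z,Z,Z,I,Z,Z,Z,I,Z,Z,Z,I,Z,Z,Z,Z,I,Z,Z,Z,Z,Z,Z,I,I,Z,Z,Z,Z,Z,Z,Z,I,Z,Z,Z,Z,
   Z,I,Z,Z,Z,Z,I,Z,Z,Z,Z,Z,Z,Z,I,Z,Z,Z,Z,Z,Z,Z,I,Z,Z,Z,Z,Z,I,Z,Z,Z,Z,I,Z,Z,Z,Z,Z,Z,I,Z,Z,Z,I,Z,Z,
   Z,Z,I,Z,Z]"

definition pa9 :: "sym list" where
  "pa9 = [Z,Z,Z,I,Z,Z,Z,Z,I,Z,Z,I,I,Z,Z,Z,Z,Z,Z,I,Z,Z,Z,Z,I,Z,Z,Z,Z,Z,I,Z,Z,Z,Z,Z,Z,Z,Z,I,Z,Z,Z,I,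
   Z,Z,Z,D,Z,Z,Z,I,Z,Z,Z,Z,Z,I,Z,Z,Z,I,Z,I,Z,Z,Z,Z,Z,Z,Z,Z,Z,Z,Z,Z,Z,Z,I,Z,Z,Z,Z,Z,Z,Z,Z,Z,Z,Z,I,
   Z,Z,Z,I,Z,Z,Z,I,Z,Z,Z,Z,Z,Z,I,Z,Z,Z,I,Z,Z,Z,Z,Z,I,Z,Z,Z,Z,Z,Z,Z,I,Z,Z,Z,I,Z,Z,Z,Z,Z,Z,Z,I,Z,Z,
   Z,Z,Z,Z,I,Z,Z,Z,Z,Z,Z,Z]"

definition pa10 :: "sym list" where
  "pa10 = [Z,Z,Z,Z,I,Z,Z,Z,Z,Z,Z,Z,I,Z,Z,Z,Z,Z,Z,I,I,Z,Z,Z,I,Z,Z,Z,Z,Z,Z,I,I,Z,Z,Z,Z,Z,Z,I,Z,Z,Z,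
   Z,Z,Z,Z,D,Z,Z,Z,I,Z,Z,Z,Z,Z,Z,Z,I,Z,Z,Z,Z,Z,Z,I,Z,Z,Z,Z,Z,Z,Z,Z,Z,Z,Z,I,Z,Z,Z,Z,Z,Z,Z,I,Z,Z,Z,
   Z,Z,Z,I,Z,Z,Z,I,Z,Z,Z,D]"

definition pa11 :: "sym list" where
  "pa11 = [Z,Z,Z]"

definition pa12 :: "sym list" where
  "pa12 = [I,Z,Z,Z,D,Z,Z,Z,I]"

definition pa13 :: "sym list" where
  "pa13 = [Z,Z,Z,Z,Z,Z,Z]"

definition pa14 :: "sym list" where
  "pa14 = [I,Z,Z,Z,Z,Z,Z,Z,Z,Z,Z,Z,Z,Z,Z,Z,Z,Z,Z,I,Z,Z,Z,Z,Z,Z,Z,I,Z,Z,Z,I,Z,Z,Z,I,Z,Z,Z,I,Z,Z,Z,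
   Z,Z,Z]"

definition pa15 :: "sym list" where
  "pa15 = [I]"

definition pb1 :: "sym list" where
  "pb1 = [I,Z,Z,Z,Z]"

definition pb2 :: "sym list" where
  "pb2 = [I]"

definition pb3 :: "sym list" where
  "pb3 = [Z,Z,Z,Z,Z,Z,Z,I,Z,Z,Z,Z,Z,I,Z,Z,Z,Z,Z,Z,Z,I,Z,Z,Z,Z,I,Z,Z,Z,Z,Z,Z,Z]"

definition pb4 :: "sym list" where
  "pb4 = [I,Z,Z,Z,Z,Z,I,Z,Z,Z,Z,Z,Z,Z,I,Z,Z,Z,Z,I,Z,Z,I,Z,Z,Z,Z,I,Z,Z,Z,Z,Z,I,Z,I,Z,Z,Z,Z,Z,I,Z,Z,
   Z]"

definition pb5 :: "sym list" where
  "pb5 = [Z,Z,Z,Z,I,Z,Z,Z,Z,I,Z,Z,Z,Z,Z,Z,Z]"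

definition pb6 :: "sym list" where
  "pb6 = [I,Z,Z,Z,Z,Z,I,Z,Z,Z,Z,Z,Z,Z,I,Z,Z,Z,Z,I,Z,Z]"

definition pb7 :: "sym list" where
  "pb7 = [Z,Z,Z,Z,Z,I,Z,Z,Z,Z,Z,I,Z,I,Z,Z,Z,Z,Z,I,Z,Z,Z,Z]"

definition pb8 :: "sym list" where
  "pb8 = [I]"

definition pb9 :: "sym list" where
  "pb9 = [Z]"

definition pb10 :: "sym list" where
  "pb10 = [Z]"

definition pc1 :: "sym list" where
  "pc1 = [Z]"

definition pc2 :: "sym list" where
  "pc2 = [I]"

definition pc3 :: "sym list" where
  "pc3 = [Z,Z,Z,Z,Z,I,Z,Z,Z,Z,Z,Z,Z,I,Z,Z,Z,Z,Z,I,Z,Z,Z,Z,Z,Z,I,Z,Z,Z,Z,Z,I,Z,Z,Z,Z,Z,Z,Z,I,Z,Z,Z,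
   Z,Z,I,Z,Z,Z,Z,Z,Z,I,Z,Z,Z,Z,Z,I,Z,I,Z,Z,Z,Z,Z,I,Z,Z,Z,Z,Z,I,Z,Z,Z,Z,Z,Z,I,Z,Z,Z,Z,Z,Z,Z,I,Z,Z,
   Z,Z,Z,I,Z,Z,Z,Z,Z,I,Z,Z,Z,Z,Z,Z,I,Z,Z,Z,Z,Z,Z,Z,I,Z,Z,Z,Z,Z,I,Z,Z,Z,Z,Z,I,Z,Z,Z,Z,Z,Z,I,I,Z,Z,
   Z,Z,Z,Z,I,Z,Z,Z,Z,Z,I,Z,Z,Z,Z,Z,I,Z,Z,Z,Z,Z,Z,Z,I,Z,Z,Z,Z,Z,Z]"

definition pc4 :: "sym list" where
  "pc4 = [I,Z,Z,Z,Z,Z,I,Z,Z,Z,Z,Z,I,Z,Z,Z,Z,Z,Z,Z,I,Z,Z,Z,Z,Z,Z,I]"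

definition pc5 :: "sym list" where
  "pc5 = [Z,Z,Z,Z,Z,I,Z,Z,Z,Z,Z,I,Z,I,Z,Z,Z,Z,Z,I,Z,Z,Z,Z]"

definition pc6 :: "sym list" where
  "pc6 = [Z]"

definition pd1 :: "sym list" where
  "pd1 = [I,Z,Z,Z,I,Z,Z,Z,Z,Z,I,Z,Z,Z,Z,Z,Z,Z,Z,I,Z,Z,Z,Z,Z,Z,Z,D,Z,Z,Z,I,Z,Z,Z,Z,Z,I,Z,Z,Z,I,Z,Z,
   Z,Z,I,Z,Z,Z,Z,Z,Z,Z,Z,Z,Z,Z,I,Z,Z,Z,Z,Z,Z,Z,Z,Z,I,Z,Z,Z,Z,I,Z,Z,Z,I,Z,Z,Z,D,Z,Z,Z,I,Z,Z,Z,I,Z,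
   Z,Z,Z,Z,I,Z,Z,Z,Z,Z,Z,Z,I,Z,Z,Z,Z,Z,Z,Z,Z,D,Z,Z,Z,I,Z,Z,Z,Z,Z,I,Z,Z,Z,Z,Z,Z,Z,I,Z,Z,Z,I,Z,Z,Z,
   Z,Z,Z,Z,Z,I,Z,Z,Z,Z,Z,I,Z,I,Z,Z,Z,Z,Z,Z,Z,Z,Z,I,Z,Z,Z,I,Z,Z,Z,Z,I,Z,Z,Z,Z,Z,Z,Z,I,Z]"

definition pd2 :: "sym list" where
  "pd2 = [Z,Z,I,Z,Z,Z,Z,Z,Z,Z,Z,Z,I,Z,Z,Z,Z,I,Z,Z,Z,Z,Z,I,Z,Z,Z,Z,Z,I,Z,Z,Z,I,Z,Z,Z,Z,Z,I,Z,Z,Z,Z,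
   I,Z,Z,I,Z,Z,Z,I,Z,Z,Z,Z,Z,Z,Z,Z,I,Z,Z,Z,Z,Z,I,Z,Z,Z,Z,Z,Z,Z,Z,Z,Z,Z,I,Z,Z,Z,I,Z,Z,Z,Z,I,Z,Z,Z,
   Z,Z,I,Z,Z,Z,I,I,Z,Z,Z,Z,Z,Z,Z,Z,Z,Z,I,Z,Z,Z,Z,I,Z,Z,Z,Z,Z,Z,Z,I,Z,Z,Z,I,Z,Z,Z,I,Z,Z,Z,Z,Z,I,Z,
   Z,Z,Z,I,Z,Z,Z,Z,Z,Z,Z,Z,Z,Z,I,Z,Z,Z,Z,I,Z,Z,Z,Z,Z,I,Z,Z,Z,Z,I,Z,Z,I,Z,Z,Z,Z,Z,Z,Z,I]"

definition pd3 :: "sym list" where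
  "pd3 = [Z,Z,Z,Z,I,Z,Z,Z,Z,Z,I,Z,Z,Z,Z,Z,Z,Z,D,Z,Z,Z,Z,Z,Z,Z,I,Z,Z,Z,Z,I,Z,Z,Z,Z,Z,I,Z,Z,Z,Z,I,Z,
   Z,Z,I,Z,Z,Z,Z,Z,Z,I,Z,Z,Z,Z,I,Z,Z,Z,Z,Z,I,Z,Z,Z,Z,Z,Z,Z,Z,I,Z,Z,Z,Z,Z,Z,I,Z,Z,Z,Z,I,Z,Z,Z,Z,Z,
   I,Z,Z,Z,I,Z,Z,Z,Z,I,Z,Z,I,I,Z,Z,Z,Z,Z,Z,Z,I,Z,Z,Z,Z,Z,Z,Z,Z,Z,I,Z,Z,Z,Z,Z,Z,Z,Z,I,Z,Z,I,Z,Z,Z,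
   Z,I,Z,Z,Z,I,Z,Z,Z,Z,Z,I,Z,Z,Z,I,Z,Z,Z,Z,Z,Z,Z,I,Z,Z,Z,Z,Z,Z,Z,Z,I]"

definition pd4 :: "sym list" where
  "pd4 = [Z,Z,Z,Z,Z,Z,Z,Z,Z,I,Z,Z,Z,Z,Z,Z,Z,I,Z,Z,Z,I,Z,Z,Z,Z,I,Z,Z,Z,I,Z,Z,Z,Z,Z,I,Z,I,Z,Z,Z,Z,Z,
   Z,Z,Z,Z,I,Z,Z,Z,Z,Z,Z,Z,Z,I,Z,Z,Z,Z,Z,Z,Z,I,Z,Z,Z,I,Z,Z,Z,Z,Z,I,Z,Z,Z,I,Z,Z,Z,Z,I,Z,Z,Z,Z,Z,I,
   Z,Z,Z,Z,Z,I,Z,Z,Z,Z,Z,Z,Z,Z,Z,I,Z,Z,Z,Z,I,Z,Z,I,Z,Z,Z,I,Z,Z,Z,Z,I,Z,Z,Z,I,Z,Z,Z,Z,Z,I,Z,Z,Z,Z,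
   Z,Z,Z,Z,Z,Z,Z,I,Z,Z,Z,Z,Z,Z,Z,Z,I,Z,Z,Z,Z,Z,I,Z,Z,Z,I,I,Z,Z,Z]"

definition pd5 :: "sym list" where
  "pd5 = [Z,Z,Z,I,Z,Z,Z,I,Z,Z,Z,Z,I,Z,Z,Z,Z,Z,Z,Z,I,Z,Z,Z,I,Z,Z,Z,Z,Z,Z,Z,Z,Z,I,Z,Z,Z,Z,I,Z,Z,Z,Z,
   Z,Z,Z,Z,Z,Z,Z,I,Z,Z,Z,I,Z,Z,Z,Z,Z,I,Z,Z,Z,Z,I,Z,Z,I,Z,Z,Z,I,Z,Z,Z,Z,Z,Z,Z,Z,I,Z,Z,Z,Z,Z,I,Z,Z,
   Z,Z,Z,Z,Z,D,Z,Z,Z,I,Z,Z,Z,I,Z,Z,Z,Z,I,Z,Z,Z,Z,Z,I,Z,Z,Z,Z,Z,Z,Z,Z,Z,Z,Z,D,Z,Z,Z,I,Z,Z,Z,Z,I,Z,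
   Z,Z,Z,Z,I,Z,Z,Z,I,Z,Z,Z,Z,Z,Z,Z,Z,Z,Z,Z,I,Z]"

definition pd6 :: "sym list" where
  "pd6 = [Z,Z,Z,I,Z,Z,Z,Z,Z,Z,Z,I,Z,Z,Z,I,Z,Z,Z,I,Z,Z,Z,Z,Z,I,Z,Z,Z,Z,I,Z,Z,Z,Z,Z,Z,Z,Z,Z,I,Z,Z,Z,
   Z,Z,I,Z,Z,Z,Z,Z,I,Z,Z,Z,Z,I,Z,Z,I,Z,Z,Z,Z,Z,Z,I,Z,Z,Z,Z,Z,I,Z,Z,Z,Z,Z,I,Z,Z,Z,Z,Z,Z,Z,I,Z,Z,Z,
   Z,Z,Z,I,Z,Z,Z,Z,Z,I,Z,Z,Z,Z,Z,I,Z,Z,Z,Z,I,Z,Z,Z,I,Z,Z,Z,Z,Z,I,Z,I,Z,I,Z,Z,Z,Z,Z,I,Z,Z,Z,Z,Z,Z,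
   Z,Z,Z,Z,I,Z,Z,Z,Z,Z,Z,Z,Z,Z,I,Z,I,Z,I,Z,Z,Z,I,Z,Z,Z,I,Z,Z,Z,Z]"

definition pd7 :: "sym list" where
  "pd7 = [I,Z,Z,Z,I,Z,Z,Z,Z,Z,Z,Z,Z,Z,Z,Z,I,Z,Z,Z,Z,Z,I,Z,Z,Z,Z,Z,Z,Z,Z,I,Z,Z,Z,I,Z,Z,Z,Z,Z,Z,Z,I,
   Z,Z,Z,Z,Z,I,Z]"

definition pd8 :: "sym list" where
  "pd8 = [Z,Z,I,Z,Z,Z,Z,Z,Z,Z]"

definition pd9 :: "sym list" where
  "pd9 = [I,Z,Z,Z,I,Z,Z,Z,Z,I,Z,Z,Z,Z,Z,Z,Z,Z,Z,I,Z,Z,Z,Z,Z,Z,Z,Z,Z,Z,Z,I,Z,Z,Z,Z,I,Z,Z,Z,I,Z,Z,Z,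
   Z,Z,I]"

definition pd10 :: "sym list" where
  "pd10 = [Z]"

definition pe1 :: "sym list" where
  "pe1 = [Z,Z,Z,I,Z,Z,Z,Z,Z,I,Z,Z,Z,Z,Z,Z,Z,I,Z,Z,Z,Z,Z,Z,Z,I,Z,Z,Z,Z,I,Z,Z,Z,Z,Z,I,Z,Z,Z,Z,Z,Z,Z,
   I,Z,Z,Z,Z,Z,Z,Z,I,Z,Z,Z,Z,I,Z,Z,Z,Z,Z,I,Z,I,Z,Z,Z,Z,Z,I,Z,I,Z,Z,Z,Z,Z,I,Z,Z,Z,Z,I,Z,Z,Z,Z,Z,Z,
   Z,I,Z,Z,Z,Z,Z,Z,Z]"

definition pe2 :: "sym list" where
  "pe2 = [I,Z,Z,Z,Z,Z,I,Z,Z,Z,Z,I,Z,Z,Z,Z,Z,Z,Z,I,Z,Z,Z,Z,Z,Z,Z,I,Z,Z,Z,Z,Z,I,Z,Z,Z,Z,I,Z,Z,I,Z,Z,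
   Z,Z,I,Z,Z,I]"

definition pe3 :: "sym list" where
  "pe3 = [Z]"

definition pf1 :: "sym list" where
  "pf1 = [I,Z,Z,Z,I,Z,Z,Z,Z,Z,Z,I,Z,Z,Z,Z,Z,I,Z,Z,Z,I,Z,Z,Z,Z,Z,Z,Z,I,Z,Z,Z,I,Z,Z,Z,Z,I,Z,Z,I,Z,Z,
   Z,Z,Z,Z,I,Z,Z,Z,Z,Z,Z,Z,Z,Z,Z,Z,I,Z,Z,Z,Z,Z,Z,Z,I,Z,Z,Z,Z,Z,Z,I,I,Z,Z,Z,I,Z,Z,Z,Z,Z,Z,I,Z,Z,Z,
   Z,I,Z,Z,Z,I,Z,Z,Z,Z,Z,Z,Z]"

definition pf2 :: "sym list" where
  "pf2 = [I,Z,Z,Z,I,Z,Z,Z,Z,Z,I,Z,I,Z,Z,Z,Z,Z,Z,I,Z,Z,Z,Z,Z,Z,Z,Z,Z,Z,Z,I,Z,Z,Z,Z,Z,Z,Z,I,Z,Z,Z,Z,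
   Z,Z]"

definition pf3 :: "sym list" where
  "pf3 = [I]"

definition px1 :: "sym list" where
  "px1 = [Z,Z,Z,Z,Z,Z,Z,Z,Z,I,Z,Z,Z,Z,I]"

definition px2 :: "sym list" where
  "px2 = [Z]"

definition pu1 :: "sym list" where
  "pu1 = [Z,Z,Z,Z,Z,I,Z,Z,Z,Z,I,Z,Z,Z,Z,I,Z,Z,Z,Z,I,Z,Z,I,Z,Z,Z,I,Z,Z,Z,Z,I,Z,Z,Z,Z,I,Z,Z,Z,Z,I,Z,
   Z,Z,Z,Z,Z,Z,Z,Z,Z,Z,I,Z,Z,Z,Z,I,Z,Z,Z,Z,I,Z,Z,Z,Z,I,Z,Z,Z,I,I,Z,Z,Z,Z,Z,Z,I,Z,Z,Z,Z,I,Z,Z,Z,Z,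
   I,Z,Z,Z,Z,Z,Z,Z,I,Z,Z,Z,I,Z,Z,Z,Z,I,Z,Z,Z,Z,I,Z,Z,Z,Z,I,Z,Z,Z,Z,Z,Z,Z,Z,Z,Z,Z,I,Z,Z,Z,Z,I,Z,Z,
   Z,Z,I,Z,Z,Z,Z,I,Z,Z,I,Z,Z,Z,I,Z,Z,Z,Z,I,Z,Z,Z,Z,I,Z,Z,Z,Z,I,Z,Z,Z,Z,Z,Z,Z,D]"

definition pu2 :: "sym list" where
  "pu2 = [Z,Z,Z,I,Z,Z,Z,Z,I,Z,Z,Z,Z,I,Z,Z,Z,Z,I,Z,Z,Z,Z,Z,Z,Z,Z,Z,Z,Z,I,Z,Z,Z,Z,I,Z,Z,Z,Z,I,Z,Z,Z,
   Z,I,Z,Z,Z,I,Z,Z,Z,D,Z,Z,Z,I,Z,Z,Z,Z,I,Z,Z,Z,Z,I,Z,Z,Z,Z,Z,Z,Z,I,Z,Z,Z,Z,Z,Z,Z,Z,I,Z,Z,Z,Z,I,Z,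
   Z,Z,Z,I,Z,Z,Z,Z,Z,Z,Z,I,Z,Z,Z,I,Z,Z,Z,Z,I,Z,Z,Z,Z,I,Z,Z,Z,Z,I,Z,Z,I,Z,Z,Z,Z,Z,Z,Z,Z,I,Z,Z,Z,Z,
   I,Z,Z,Z,Z,I,Z,Z,Z,Z,Z,Z,Z,I,Z,Z,Z,I,Z,Z,Z,Z,I,Z,Z,Z,Z,I,Z,Z,Z,Z,I,Z,Z,Z,Z,I]"

definition pu3 :: "sym list" where
  "pu3 = [W]"

definition li1 :: "sym list" where
  "li1 = [Z,Z,Z,Z,Z,Z,Z,Z,Z,Z,Z,Z,Z,Z,Z,Z,Z,Z,Z,Z,Z,Z,Z,Z,Z,Z,I,Z,Z,Z,I,Z,Z,Z,I,Z,Z,Z,I,Z,Z,Z,I,Z,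
   Z,Z,I,Z,Z,Z,Z,Z,Z,Z]"

definition li2 :: "sym list" where
  "li2 = [E,Z,Z,Z,Z,Z,Z,Z,D,Z,Z,Z,Z,Z,Z,Z,D,Z,Z,Z,I,Z,Z,Z,Z,Z,Z,I,I,Z,Z,Z,Z,Z,Z,I,Z,Z,Z,Z,Z,Z,Z,Z,
   Z,Z,Z,I,Z,Z,Z,Z,Z,Z,Z,I,Z,Z,Z,Z,Z,Z,I,Z,Z,Z,I,Z,Z,Z,D,Z,Z,Z,I,Z,Z,Z,Z,Z,Z,Z,I,Z,Z,Z,Z,Z,Z,Z,I,
   Z,Z,Z,Z,Z,Z,Z,Z,Z,Z,D]"

definition li3 :: "sym list" where
  "li3 = [E]"

definition li4 :: "sym list" where
  "li4 = [J,Z,Z,Z,I,Z,Z,Z,Z,Z,Z,Z,I,Z,Z,Z,I,Z,Z,Z,Z,Z,Z,Z,Z,Z,Z,Z,Z,Z,Z,I,Z,Z,Z,Z,Z,Z,Z,Z,Z,Z,Z,I,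
   Z,Z,Z,I,Z,Z,Z,I,Z,Z,Z,Z,Z,Z,I,I,Z,Z,Z,I,Z,Z,Z,Z,Z,Z,Z,I,Z,Z,Z,Z,Z,Z,I,Z,Z,Z,Z,Z,Z,Z,D,Z,Z,Z,I,
   Z,Z,Z,Z,Z,Z,Z,I,Z,Z,Z,Z,Z,Z,I,Z,Z,Z,Z,Z,Z,Z,Z,Z,Z,Z,D,Z,Z,Z,Z,Z,Z,Z,I,Z,Z,Z,Z,Z,Z,I,Z,Z,Z,I,Z,
   Z,Z,I]"

definition li5 :: "sym list" where
  "li5 = [J]"

definition li6 :: "sym list" where
  "li6 = [J]"

definition li7 :: "sym list" where
  "li7 = [J]"

definition li8 :: "sym list" where
  "li8 = [J,I,Z,Z,Z,Z,Z,Z,Z,I,Z,Z,Z,Z,Z,Z,Z,I,Z,Z,Z,Z,Z,Z,Z,Z,Z,Z,I,Z,Z,I,Z,Z,Z,Z,I,Z,Z,Z,Z,Z,Z,Z,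
   I,Z,Z,Z,I,Z,Z,Z,Z,Z,Z,Z,Z,Z,I,Z,Z,Z,Z,I,Z,Z,I,Z,Z,Z,Z,Z,Z,Z,Z,I,Z,Z,Z,I,Z,Z,Z,Z,Z,I,Z,Z,Z,Z,Z,
   Z,Z,I,Z,Z,Z,I,Z,Z,Z,Z,Z,Z,Z,Z,I,Z,Z,Z,Z,Z,I,Z,Z,Z,Z,I,Z,Z,Z,Z,Z,Z,I,Z,Z,Z,I,Z,Z,Z,Z,I,Z,Z,Z,Z,
   Z,I,Z,I,Z,Z,Z,I]"

definition li9 :: "sym list" where
  "li9 = [Z,Z,Z,Z,Z,Z,Z,Z,Z,Z,I,Z,Z,Z,I,Z,Z,Z,Z,Z,I,Z,Z,Z,Z,I,Z,Z,Z,I,Z,I,Z,Z,Z,Z,Z,Z,Z,Z,Z,I,Z,Z,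
   Z,Z,Z,I,Z,Z,Z,Z,Z,Z,Z,I,Z,Z,Z,I,Z,Z,Z,I,Z,Z,Z,Z,I,Z,Z,Z,Z,Z,I,Z]"

definition li10 :: "sym list" where
  "li10 = [J,Z,Z,I,Z,Z,Z,Z,Z,Z,I]"

definition li11 :: "sym list" where
  "li11 = [J,Z,Z,Z,I,Z,Z,Z,Z,Z,Z,I,Z,Z,Z,Z,Z,Z,Z,Z,I,Z,Z,Z,Z,Z,Z,Z,I,Z,Z,Z,I,Z,Z,Z,Z,Z,I,Z,Z,Z,I,
   Z,Z,Z,Z,I,Z,Z,Z,Z,Z,Z,Z,Z,Z,Z,Z,I,Z,Z,Z,Z,Z,Z,Z,Z,Z,I,Z,Z,Z,Z,I,Z,Z,I,Z,Z,Z,I,Z,Z,Z,Z,I,Z,Z,Z,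
   I,Z,Z,Z,Z,Z,I,Z,Z,Z,Z,Z,Z,Z,D,Z,Z,Z,I,Z,Z,Z,Z,Z,Z,Z,Z,I,Z,Z,Z,Z,Z,I,Z,Z,Z,Z,Z,Z,Z,Z,Z,Z,Z,I,Z,
   Z,Z,I,Z,Z,Z,Z,I,Z,Z,Z,Z,Z,I,Z,Z,Z,I,Z,Z,Z,D,Z,Z,Z,Z,Z,Z,Z,I,Z,Z,Z,Z,I,Z,Z,Z,Z,Z,Z,Z,I,Z,Z,Z,Z,
   Z,I,Z,Z,Z,D,Z,Z,Z,I,Z,Z,Z,Z,I,Z]"

definition li12 :: "sym list" where
  "li12 = [Z,Z,Z,Z,Z,Z,I,Z,Z,Z,Z,Z,Z,Z,Z,Z,Z,Z,Z,Z,I,Z,Z,Z,Z,I,Z,Z,I,Z,Z,Z,Z,I,Z,Z,Z,I]"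

definition li13 :: "sym list" where
  "li13 = [J,Z,Z,I,Z,Z,Z,Z,Z,Z,I,Z,Z,Z,Z,Z,Z,Z,I,Z,Z,Z,Z,Z,Z,Z,Z,Z,Z,Z,I,Z,Z,Z,Z,Z,Z,I,Z,Z,Z,Z,Z,
   Z,Z,I,Z,Z,Z,I,Z,Z,Z,Z,I,Z,Z,Z,I,Z,Z,Z,Z,Z,I,Z,I,Z,Z,Z,Z,Z,Z,Z,I,Z,Z,Z,Z,Z,Z,Z,Z,Z,Z,I,Z,Z,Z,Z,
   Z,Z,Z,I,Z,Z,Z,Z,Z,Z,Z]"

definition li14 :: "sym list" where
  "li14 = [E,Z,Z,Z,I,Z,Z,Z,D,Z,Z,Z,I,Z,Z,Z,Z,Z,I,Z,Z,Z,I,Z,Z,Z,Z,Z,Z,Z,I,Z,Z,Z,Z,Z,Z,Z,Z,D]"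

definition li15 :: "sym list" where
  "li15 = [J,Z,Z,Z,Z,Z,Z,Z,I,Z,Z,Z,I,Z,Z,Z,Z,Z,Z,I,Z,Z,Z,Z,Z,Z,Z,I,Z,Z,Z,Z,Z,Z,Z,Z,Z,Z,Z,I,Z,Z,Z,
   Z,Z,Z,I,Z,Z,Z,Z,Z,I,Z,Z,Z,I,Z,Z,Z,I,Z,Z,Z,Z,Z,I,Z,Z,Z,Z,Z,Z,I,I,Z,Z,Z,Z,Z,Z,Z,I,Z,Z,Z,Z,I,Z,Z,
   Z,Z,Z,I,Z,Z,Z,Z,Z,Z,Z,I,Z,Z,Z,Z,Z,Z,Z,I,Z,Z,Z,Z,I,Z,Z,Z,Z,Z,I,Z,Z,Z,Z,Z,Z,I,Z,Z,Z,I,Z,Z,Z,Z,I,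
   Z,Z,Z,Z,I,Z,Z,Z,Z,Z,I,Z,I,Z,Z,Z,Z,Z,Z,Z,Z,I,Z,Z,Z,Z,I,Z,Z,Z,Z,I,Z,Z,Z,Z,Z,Z,Z,I,Z,Z,Z,I,Z,Z,Z,
   Z,I,Z,Z,Z,Z,I,Z,Z,Z,Z,I,Z,Z,Z,Z]"

definition li16 :: "sym list" where
  "li16 = [Z]"

definition li17 :: "sym list" where
  "li17 = [I]"

lemmas chunk_defs = pa1_def pa2_def pa3_def pa4_def pa5_def pa6_def pa7_def pa8_def pa9_def
  pa10_def pa11_def pa12_def pa13_def pa14_def pa15_def pb1_def pb2_def pb3_def pb4_def pb5_def
  pb6_def pb7_def pb8_def pb9_def pb10_def pc1_def pc2_def pc3_def pc4_def pc5_def pc6_def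
  pd1_def pd2_def pd3_def pd4_def pd5_def pd6_def pd7_def pd8_def pd9_def pd10_def pe1_def
  pe2_def pe3_def pf1_def pf2_def pf3_def px1_def px2_def pu1_def pu2_def pu3_def li1_def li2_def
  li3_def li4_def li5_def li6_def li7_def li8_def li9_def li10_def li11_def li12_def li13_def
  li14_def li15_def li16_def li17_def

lemma chunk_length:
  "length pa1 = 5" "length pa2 = 135" "length pa3 = 16" "length pa4 = 20" "length pa5 = 15"
  "length pa6 = 1" "length pa7 = 15" "length pa8 = 143" "length pa9 = 150" "length pa10 = 102"
  "length pa11 = 3" "length pa12 = 9" "length pa13 = 7" "length pa14 = 46" "length pa15 = 1"
  "length pb1 = 5" "length pb2 = 1" "length pb3 = 34" "length pb4 = 45" "length pb5 = 17"
  "length pb6 = 22" "length pb7 = 24" "length pb8 = 1" "length pb9 = 1" "length pb10 = 1"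
  "length pc1 = 1" "length pc2 = 1" "length pc3 = 169" "length pc4 = 28" "length pc5 = 24"
  "length pc6 = 1" "length pd1 = 180" "length pd2 = 180" "length pd3 = 171" "length pd4 = 169"
  "length pd5 = 160" "length pd6 = 169" "length pd7 = 51" "length pd8 = 10" "length pd9 = 47"
  "length pd10 = 1" "length pe1 = 100" "length pe2 = 50" "length pe3 = 1" "length pf1 = 104"
  "length pf2 = 46" "length pf3 = 1" "length px1 = 15" "length px2 = 1" "length pu1 = 176"
  "length pu2 = 176" "length pu3 = 1" "length li1 = 54" "length li2 = 102" "length li3 = 1"
  "length li4 = 141" "length li5 = 1" "length li6 = 1" "length li7 = 1" "length li8 = 146"
  "length li9 = 76" "length li10 = 11" "length li11 = 200" "length li12 = 38" "length li13 = 101"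
  "length li14 = 40" "length li15 = 200" "length li16 = 1" "length li17 = 1"
  by (simp_all add: chunk_defs)

definition pa :: "sym list list" where
  "pa = [pa1,pa2,pa3,pa4,pa5,pa6,pa7,pa8,pa9,pa10,pa11,pa12,pa13,pa14,pa15]"

definition pb :: "sym list list" where
  "pb = [pb1,pb2,pb3,pb4,pb5,pb6,pb7,pb8,pb9,pb10]"

definition pc :: "sym list list" where
  "pc = [pc1,pc2,pc3,pc4,pc5,pc6]"

definition pd :: "sym list list" where
  "pd = [pd1,pd2,pd3,pd4,pd5,pd6,pd7,pd8,pd9,pd10]"

definition pe :: "sym list list" where
  "pe = [pe1,pe2,pe3]"

definition pf :: "sym list list" where
  "pf = [pf1,pf2,pf3]"

definition px :: "sym list list" where
  "px = [px1,px2]"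

definition pu :: "sym list list" where
  "pu = [pu1,pu2,pu3]"

type_synonym segment = "nat \<times> sym list list \<times> nat"

text \<open>The arguments count full copies of the cycles, the only point in which the word and its
  shortening differ. Two labels need a reason. The nine letters from 19702 on carry labels of
  \<open>pa\<close> because the 52 letters after each nonzero one of them still follow that cycle.
  The final letter, at 75018, carries \<open>75371 = 75019 + 352\<close>, the label of the last
  letter of a block.\<close>

definition segs ::
  "nat \<Rightarrow> nat \<Rightarrow> nat \<Rightarrow> nat \<Rightarrow> nat \<Rightarrow> nat \<Rightarrow> nat \<Rightarrow> nat \<Rightarrow> segment list"
where
  "segs k1 k2 k3 k4 k5 k6 k7 k8 = [
    (0, [li1], 1),
    (54, pa, k1),
    (54, [pa1, pa2, pa3, pa4, pa5, pa6, pa7, pa8, pa9, pa10, pa11, pa12, pa13], 1),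
    (18043, [pa14], 1),
    (18089, [li2], 1),
    (230, [pa5, pa6, pa7, pa8, pa9, pa10, pa11, pa12, pa13, pa14, pa15], 1),
    (54, [pa1, pa2], 1),
    (18823, [pa3, pa4, pa5], 1),
    (18874, [li3], 1),
    (246, [pa7, pa8, pa9, pa10, pa11, pa12, pa13, pa14, pa15], 1),
    (54, [pa1, pa2, pa3], 1),
    (19507, [pa4, pa5, pa6, pa7], 1),
    (19558, [li4], 1),
    (19699, [pa11], 1),
    (659, [pa12], 1),
    (19711, [pa13, pa14, pa15], 1),
    (19765, [pa1], 1),
    (19770, [li5], 1),
    (19771, [pb3, pb4, pb5, pb6, pb7, pb8, pb9, pb10], 1),
    (19765, pb, k2),
    (19765, [pb1, pb2, pb3, pb4, pb5], 1),
    (23793, [pb6, pb7, pb8], 1),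
    (23840, [pb9], 1),
    (23841, [li6], 1),
    (23842, [pc3, pc4, pc5, pc6], 1),
    (23840, pc, k3),
    (23840, [pc1, pc2, pc3], 1),
    (29835, [pc4], 1),
    (19889, [pb7], 1),
    (19913, [li7], 1),
    (19914, [pb9, pb10], 1),
    (19765, pb, k4),
    (19765, [pb1, pb2, pb3], 1),
    (31289, [pb4], 1),
    (31334, [li8], 1),
    (31480, [px1], 1),
    (31495, [px2], 1),
    (31496, [li9], 1),
    (31572, [px1], 1),
    (31587, [li10], 1),
    (31598, pd, k5),
    (31598, [pd1, pd2, pd3, pd4, pd5, pd6, pd7, pd8], 1),
    (62276, [pd9], 1),
    (62323, [li11, li12], 1),
    (62561, pe, k6),
    (62561, [pe1], 1),
    (66587, [pe2], 1),
    (66637, [li13], 1),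
    (66738, pf, k7),
    (66738, [pf1], 1),
    (70768, [pf2], 1),
    (70814, [li14], 1),
    (32129, [pd4, pd5, pd6, pd7, pd8, pd9, pd10], 1),
    (31598, pd, k8),
    (31598, [pd1, pd2, pd3, pd4, pd5, pd6], 1),
    (74766, [pd7], 1),
    (74817, [li15, li16], 1),
    (75371, [li17], 1)]"

text \<open>This and the other numbered trees are pieces of \<open>one_tree\<close> and
  \<open>two_tree\<close>, named so that a piece is unfolded only where a search enters it.\<close>

definition tree1 :: tree where
  "tree1 = S (S (S (B (B (B (B (B (B (S (S (S (S (S (S (S (S (B (L 31644) (L 62370) N))))))))) (L
  32262) N) (S (S (S (S (S (S (B N (B (S (S (S (S (S (S (S (S (S (S (S (S (S (S (B (L 18124) N (L
  620)))))))))))))))) (S (S (S (S (S (S (S (S (S (S (S (B (S (S (S (B (L 66861) (L 66786) N))))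
  (L 546) N)))))))))))) N) (L 70787)))))))) N) (B (S (S (S (S (B (B (L 66655) (L 292) N) (L
  74844) N))))) (S (S (S (S (S (S (S (B (L 163) (L 89) N)))))))) N) N) (S (S (S (S (S (S (S (S (S
  (S (S (S (S (S (S (S (S (S (S (S (S (S (S (S (S (S (S (S (B (L 32631) (L 74770)
  N))))))))))))))))))))))))))))) N) (S (S (S (B (B (L 32444) (S (S (S (S (S (S (S (B (S (B (L
  75213) (L 75061) N)) (L 75137) N)))))))) N) (S (S (S (S (S (S (B (L 32707) (L 62295) N)))))))
  N)))) N) (S (S (S (B (B (S (S (S (S (S (S (S (S (B (L 31494) (L 32337) N))))))))) (S (S (S (S
  (S (S (S (S (S (S (B (L 62446) (L 31844) N))))))))))) N) (S (S (S (S (S (S (S (B (L 482) (L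
  19589) N)))))))) N)))) N)))"

definition tree2 :: tree where
  "tree2 = S (B (S (B (B (B (S (B (B (S (S (S (S (S (S (S (S (S (S (S (S (S (S (S (S (S (S (B (L
  32697) (L 62285) N))))))))))))))))))) (S (S (B (L 32167) (L 32070) N))) N) (L 32128) N)) (S (S
  (S (S (S (B (L 31527) (L 32488) N)))))) N) (S (S (B (B (S (B (S (S (S (S (S (S (S (S (S (S (S
  (S (S (S (S (S (S (S (S (S (S (S (S (B (L 31479) (L 32322) N)))))))))))))))))))))))) (L 31780)
  N)) (L 31656) N) (S (S (S (B (L 31382) (S (S (S (S (S (S (S (S (S (S (S (S (S (S (S (S (S (S (S
  (S (S (S (B (L 32225) N (L 62382)))))))))))))))))))))))) N)))) N))) N) (L 31749) N)) (L 32600)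
  N)"

definition tree3 :: tree where
  "tree3 = S (S (B (B (B (B (B (B (L 32119) (S (S (S (S (S (S (S (S (S (S (S (S (S (S (S (S (S (S
  (S (S (S (S (S (S (B (L 62334) (L 32177) N))))))))))))))))))))))))) (L 31608)) (L 32022) N) (S
  (B (S (B (B (S (S (B (S (S (S (S (S (S (S (S (S (S (S (S (S (S (S (S (S (S (S (S (S (S (S (B (L
  62431) (L 31829) N)))))))))))))))))))))))) N (L 32371)))) (L 31431) N) (L 32274) N)) (L 31732)
  N)) N) (S (S (S (S (S (S (S (S (S (S (S (S (S (S (S (S (S (S (S (S (S (S (S (S (S (S (S (S (S
  (S (S (S (S (S (B (S (B (L 74966) (L 75319) N)) (L 75270) N)))))))))))))))))))))))))))))))))))
  N) (S (S (S (B (S (B (S (S (S (S (S (S (S (S (S (B (L 32649) (L 74788) N)))))))))) (L 31400)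
  N)) N (L 434))))) N) (L 32080) N))"

definition tree4 :: tree where
  "tree4 = B (B (B (B (S (B (L 667) (L 62521) N)) (S (S (S (S (S (S (S (B (S (S (S (S (B (B (L
  66647) (L 284) N) (L 74836) N))))) (S (S (S (S (S (S (S (B (L 155) (L 81) N)))))))) N))))))))
  N) (S (S (B (S (S (S (S (S (S (S (S (S (S (S (S (B N (S (S (S (S (S (S (S (S (S (S (S (B (L
  66703) (S (S (S (B (L 210) (L 19507) N)))) N)))))))))))) (L 18839)))))))))))))) (L 31343) N)))
  (L 18171)) (L 32062) N) (S (S (S (S (B (L 32111) (L 75262) N))))) (S (S (S (B (L 70836) (L
  31693) N))))"

definition tree5 :: tree where
  "tree5 = S (S (S (B (B (B (S (B (S (S (B N (S (S (B (S (S (S (S (S (S (S (S (S (S (S (S (B N (L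
  202) (L 18831)))))))))))))) (L 31335) N))) (L 18163)))) (L 46) N)) (S (S (S (S (S (S (S (B (S
  (S (S (B (L 62645) (L 358) N)))) (S (S (S (S (S (S (S (S (B (L 62672) (L 66598) N)))))))))
  N)))))))) N) (S (S (S (S (S (S (S (B (S (S (S (S (B (L 62570) (L 74910) N))))) (L 62597)
  N)))))))) N) (S (S (S (S (S (S (S (B (S (S (S (S (B (L 54) (L 66722) N))))) (S (S (S (B (L 229)
  (L 19526) N)))) N)))))))) N)))"

definition tree6 :: tree where
  "tree6 = S (B (S (B (B (B (B (S (S (S (S (S (S (S (S (B (S (S (S (S (S (S (S (S (S (S (S (S (B
  (L 19770) (L 19859) N))))))))))))) (L 19797) N))))))))) (S (S (S (S (S (S (S (B (L 23847) (L
  23874) N)))))))) N) (S (S (S (S (S (S (S (B (L 23922) (L 23949) N)))))))) N) (S (S (B (S (S (S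
  (B (S (S (S (S (S (S (S (S (S (S (S (S (S (S (S (S (S (S (S (S (S (S (B (L 339) (L 62653)
  N))))))))))))))))))))))) (L 366) N)))) (S (S (S (S (S (S (S (S (B (L 62680) (L 66606)
  N))))))))) N))) N) (L 32662) (L 62494))) (S (S (S (S (S (B (L 74801) (S (S (S (S (S (S (B (L
  19886) (L 23812) N))))))) N)))))) N)"

definition tree7 :: tree where
  "tree7 = S (S (S (B (B (B (B (B (B (B (L 19562) (S (S (S (S (S (S (S (B (S (S (B (L 32310) (L
  31768) N))) (L 31370) N)))))))) N) (S (S (S (S (S (S (S (B (L 31419) (L 31720) N)))))))) N) (L
  519) N) (B (S (S (S (S (B (S (S (S (S (S (S (S (S (S (S (S (S (S (S (S (S (S (S (S (S (S (B (S
  (S (S (S (B (L 265) (L 74817) N))))) (L 62) N)))))))))))))))))))))) (L 66730) N))))) (S (S (S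
  (B (L 237) (L 19534) N)))) N) N) (S (B (S (S (S (S (S (S (S (S (S (S (S (S (B (L 62343) (L
  32186) N))))))))))))) (L 66834) N)) N) (S (S (B (B (B (L 32680) (S (S (S (S (S (S (S (B (S (B
  (B (L 75110) (L 74985) N) (L 75338) N)) (L 75289) N)))))))) N) (S (S (S (S (S (S (S (S (S (S (S
  (S (S (S (S (B (L 32138) (L 66674) N)))))))))))))))) N) (L 66759) N))) N) (S (S (S (B (B (S (S
  (S (S (S (S (S (S (S (S (S (S (S (S (S (B (L 31892) (L 32461) N)))))))))))))))) (L 31543) N) (S
  (S (S (S (S (S (B N (S (S (S (S (S (B (L 694) (L 19737) N)))))) (L 18062)))))))) N)))) N)))"

definition tree8 :: tree where
  "tree8 = B (B (B (S (S (B N (S (S (S (S (S (S (S (S (S (S (S (S (S (S (B N (B (S (S (S (S (S (S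
  (S (S (S (S (S (S (S (S (B (L 18117) N (L 613)))))))))))))))) (S (S (S (S (S (S (S (S (S (S (S
  (B (S (S (S (B (L 66854) (L 66779) N)))) (L 539) N)))))))))))) N) (L 70780)))))))))))))))) (L
  19656)))) (L 62327) N) (S (S (S (B (S (B (S (B (S (S (S (S (S (S (S (S (S (S (S (B (S (S (S (S
  (B (B (L 66640) (L 277) N) (L 74829) N))))) (S (S (S (S (S (S (S (B (L 148) (L 74) N))))))))
  N)))))))))))) N (L 121))) (S (S (S (S (S (S (S (S (S (S (S (S (S (B (L 23915) (L 23942)
  N)))))))))))))) N)) (L 66667) N)))) (S (S (S (S (S (S (S (S (S (S (S (S (S (S (S (S (S (S (S (S
  (S (S (S (S (S (S (S (S (S (S (B N (L 586) (L 19629))))))))))))))))))))))))))))))))) (L 304) N"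

definition tree9 :: tree where
  "tree9 = S (S (S (B (B (S (B (S (S (S (S (B (B (B (L 714) (L 331) N) (L 74883) N) (L 257)
  N))))) (B (S (S (B (S (B (S (B (L 18109) N (L 578))) (L 23969) N)) (L 175) N))) (S (S (S (B (L
  249) (L 101) N)))) N) N)) (L 19757) N) (S (S (S (B (S (B (B (L 19609) (B (S (S (S (B (B (L 109)
  (L 66881) N) (L 66806) N)))) (L 566) N) N) (L 31590) N)) (L 19546) N)))) N)))"

definition tree10 :: tree where
  "tree10 = S (S (S (B (B (B (B (B (L 31687) (S (S (S (S (S (S (S (S (S (S (S (S (B (S (S (S (S
  (B (L 62564) (L 74904) N))))) (L 62591) N))))))))))))) N) (S (S (S (S (S (S (S (S (S (S (S (S
  (S (B (S (S (B (L 23990) (L 32531) N))) (S (S (S (S (S (S (S (S (S (S (B (L 24017) (L 29841)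
  N))))))))))) N)))))))))))))) N) (S (S (S (S (S (S (S (S (S (S (S (S (S (S (B (L 23841) (L
  23868) N))))))))))))))) N) (S (S (B (S (S (S (S (S (S (S (S (S (S (S (S (B (S (S (S (S (S (S (S
  (S (S (S (S (S (S (B (L 19840) (L 19778) N)))))))))))))) (S (S (S (S (S (S (S (S (S (S (S (S (B
  (L 19867) (L 23793) N))))))))))))) N))))))))))))) (S (S (S (S (S (S (S (S (S (S (S (S (S (S (S
  (S (S (S (S (S (S (S (B (L 19805) (L 31289) N))))))))))))))))))))))) N))) N) (S (S (S (B (S (S
  (S (B (S (S (S (S (S (S (S (S (B (L 31413) (L 31714) N))))))))) (L 513) N)))) (L 31537) N))))
  N)))"

definition tree11 :: tree where
  "tree11 = S (B (S (B (B (S (B (B (L 32213) (S (S (S (S (S (S (S (S (S (S (S (S (S (S (S (S (S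
  (S (S (S (B (S (S (B (L 23984) (L 32525) N))) (S (S (S (S (S (S (S (S (S (S (B (L 24011) (L
  29835) N))))))))))) N))))))))))))))))))))) N) (B (S (S (S (S (S (S (S (S (S (S (S (S (S (S (S
  (S (S (S (S (S (S (S (S (S (S (S (B (L 23903) (L 23930) N))))))))))))))))))))))))))) (L 23957)
  N) N)) (S (S (B (B (L 75012) (L 32552) N) (L 32498) N))) N) (L 31795) N)) (S (S (S (S (S (S (S
  (S (S (S (B (L 24038) (L 29862) N))))))))))) N)"

definition tree12 :: tree where
  "tree12 = S (B (B (B (B (S (B (B (S (B (L 31908) (L 32477) N)) (S (S (S (S (S (S (S (S (S (S (S
  (S (S (S (S (S (S (S (S (S (S (B (S (S (S (B (L 62634) (L 347) N)))) (S (S (S (S (S (S (S (S (B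
  (L 62661) (L 66587) N))))))))) N)))))))))))))))))))))) N) (S (S (S (S (S (S (S (S (S (S (S (S
  (S (S (S (S (B (L 374) (L 31440) N))))))))))))))))) N)) (L 75371) N) (S (B (S (S (S (B (L
  31989) (L 32558) N)))) (L 31510) N)) N) (B (S (S (B (B (S (B (L 31935) (L 32504) N)) (S (S (B
  (L 19902) (B (L 62688) (L 66614) N) N))) N) (S (S (S (S (S (S (S (S (S (S (S (S (S (S (S (S (S
  (S (S (S (S (S (B (L 31811) N (L 32353)))))))))))))))))))))))) N))) (L 401) N) N) (L 23828) N)"

definition tree13 :: tree where
  "tree13 = B (B (S (B (B (B (S (B (L 32434) (S (S (S (B (S (S (S (S (B N (L 32101) (L
  70826)))))) (S (S (S (S (S (S (S (B (L 32670) (L 66749) N)))))))) N)))) N)) (L 31801) N) (S (S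
  (B (S (S (B (S (S (S (S (S (S (S (S (S (S (S (S (S (S (S (S (S (S (S (S (S (S (S (B (L 31629)
  (L 62355) N)))))))))))))))))))))))) (L 32198) N))) (L 32043) N))) N) (L 74863) (L 62467))) (L
  455) N) (S (S (S (S (S (S (B (B (L 31865) (L 31324) N) (L 32283) N))))))) N"

definition tree14 :: tree where
  "tree14 = S (B (S (B (S (B (B (B (B (S (S (S (S (B (L 32159) (L 31741) N))))) (L 74958) N) (S
  (S (S (B (L 66695) (L 74809) N)))) N) (S (S (S (S (S (S (S (S (S (S (S (S (S (S (S (S (S (S (S
  (S (S (S (S (S (S (S (B N (L 66846) (L 70772)))))))))))))))))))))))))))) N) (S (B (S (B (B (B
  (B (L 19832) (L 24044) N) (L 23895) N) (S (B (B (L 62626) (L 19894) N) (L 23820) N)) N) (L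
  31316) N)) (L 62618) N)) N)) (S (S (S (S (S (B (L 31467) (L 32728) N)))))) N)) (L 32573) N)"

definition tree15 :: tree where
  "tree15 = S (S (S (B (S (B (S (B (B (L 62516) (L 75257) N) (S (S (S (S (S (S (S (S (S (S (S (S
  (S (B (S (S (S (B (L 62640) (L 353) N)))) (S (S (S (S (S (S (S (S (B (L 62667) (L 66593)
  N))))))))) N)))))))))))))) N)) (S (B (S (B (S (S (S (S (S (S (S (S (S (S (S (B (S (S (S (S (S
  (S (S (S (S (S (S (S (B (L 19765) (L 19854) N))))))))))))) (L 19792) N)))))))))))) N (L
  62489))) (S (S (S (S (S (S (S (S (S (S (S (S (B (L 19881) (L 23807) N))))))))))))) N)) N)) (S
  (S (S (B (B (S (S (S (S (S (S (S (S (S (S (S (S (B (S (S (B (L 32305) (L 31763) N))) (L 31365)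
  N))))))))))))) (S (S (S (S (S (S (S (S (S (S (S (S (B (S (B (B (L 75105) (L 74980) N) (L 75333)
  N)) (L 75284) N))))))))))))) N) (S (S (S (S (S (S (S (S (S (S (S (S (S (S (S (S (S (S (S (S (B
  (L 31887) (L 32456) N))))))))))))))))))))) N)))) N)))"

definition tree16 :: tree where
  "tree16 = S (B (S (B (B (B (B (B (B (S (B (L 32402) (L 31559) N)) (S (S (S (B (L 32011) (L 423)
  N)))) N) (S (S (S (S (S (S (S (S (S (S (S (S (S (S (S (S (S (S (S (S (B (S (S (S (S (B (L
  62710) (L 74899) N))))) (L 62586) N))))))))))))))))))))) (L 31957)) (L 74926) N) (S (S (S (B (B
  (L 32208) (L 75007) N) (L 31790) N)))) N) (S (S (B (L 31984) (B (L 31930) (L 396) N) N))) N) (B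
  (S (S (B (B (L 32429) (L 32038) N) N (L 62462)))) (L 31860) N) N)) (S (S (S (B (S (B (L 74953)
  (S (B (S (B (L 19827) (L 31311) N)) (L 62613) N)) N)) (L 31462) N)))) N)"

definition tree17 :: tree where
  "tree17 = B (B (B (B (B (S (S (S (S (S (S (S (S (S (S (S (S (S (S (S (S (S (S (S (S (S (B (S (B
  (L 75203) (L 75051) N)) (L 75127) N)))))))))))))))))))))) (S (S (S (B (L 75252) (S (S (S (S (S
  (S (S (S (S (S (S (S (S (S (S (S (S (B (S (B (B (L 75100) (L 74975) N) (L 75328) N)) (L 75279)
  N)))))))))))))))))) N)))) (L 75176)) (L 75360) N) (S (B (L 75002) (L 74948) N)) N) (B (S (B (B
  (B (B (B (B (S (S (S (S (S (S (S (S (S (S (S (S (S (S (S (S (S (S (S (S (S (B (S (B (L 75198)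
  (L 75046) N)) (L 75122) N)))))))))))))))))))))) N (L 75171)) (L 75355) N) (L 74997) N) (L
  75350) N) (B (L 75225) (L 75073) N) N) (S (S (S (B (L 75301) (S (S (S (S (S (S (S (S (S (S (S
  (S (S (S (S (S (S (S (S (S (S (S (B (L 75024) N (L 75149)))))))))))))))))))))))) N)))) N)) (L
  75355) (L 75355)) N) (B (L 75230) (L 75078) N) N"

definition tree18 :: tree where
  "tree18 = B (B (S (B (S (B (B (B (L 32622) (L 66825) N) (L 31995) N) (B (B (S (B (S (S (S (B (L
  32247) N (L 62404))))) (L 32092) N)) (S (B (S (B (S (S (S (B (L 32150) (L 66686) N)))) (L
  32719) N)) (L 32564) N)) N) (L 62307) N) N)) (L 62551) (S (S (S (S (S (S (S (B (L 75235) (L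
  31666) N)))))))))) (L 31516) N) (L 75083) N"

definition tree19 :: tree where
  "tree19 = B (S (S (B (B (S (B (B (S (S (S (S (B (L 75311) (L 31392) N))))) (L 31941) N) (S (S
  (S (S (S (B (L 66771) (L 32510) N)))))) N)) (S (S (B (B (S (B (L 19908) (S (B (L 62702) (S (S
  (S (S (S (S (S (S (S (B (L 19819) (L 31303) N)))))))))) N)) N)) (L 62543) N) (B (L 62694) (L
  66620) N) N))) N) (S (S (S (S (B (S (S (S (S (S (S (S (S (S (S (S (S (S (S (S (S (S (B (L
  31817) N (L 32359))))))))))))))))))) (S (S (S (B (S (S (S (S (S (S (S (S (S (S (S (S (S (B (L
  75034) N (L 75159))))))))))))))) (S (S (S (S (S (S (S (S (S (S (S (S (S (B (L 32235) N (L
  62392))))))))))))))) N)))) N))))) N))) (S (S (B (S (S (S (B (L 32053) (L 407) N)))) (L 66628)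
  N))) N"

definition tree20 :: tree where
  "tree20 = B (B (B (S (B (L 19570) (S (S (S (S (B (S (S (S (S (S (S (S (S (S (S (S (S (S (S (S
  (S (S (S (S (S (S (S (S (S (S (S (S (S (S (B (L 32627) (L 74766)
  N)))))))))))))))))))))))))))))) (L 32440) N))))) N)) (S (S (S (S (S (S (S (B (S (S (B (S (S (S
  (S (S (S (S (S (S (S (S (S (S (S (S (S (S (S (S (S (S (S (S (B (L 31475) (L 32318)
  N)))))))))))))))))))))))) (L 31776) N))) (L 31378) N)))))))) N) (S (S (S (S (S (S (S (B (S (S
  (B (S (S (B (L 31825) N (L 32367)))) (L 31427) N))) (L 31728) N)))))))) N) (S (S (S (B (S (B (B
  (B (B N (L 32107) (L 70832)) (L 42) N) (S (S (S (S (S (S (S (B (L 527) N (L 19617))))))))) N)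
  (S (B (L 32658) (L 74797) N)) N)) (S (S (S (S (B (B (L 19558) (L 66830) N) (S (S (B (L 32676)
  (L 66755) N))) N))))) N)))) N"

definition tree21 :: tree where
  "tree21 = B (S (S (B (B (B (S (B (L 62323) (S (S (S (S (S (S (S (B (S (S (S (S (S (S (S (S (S
  (S (S (B (S (S (S (S (B (L 273) (L 74825) N))))) (L 70) N)))))))))))) N (L 117))))))))) N)) (L
  66738) N) (S (S (S (B (L 32000) (L 66814) N)))) N) (L 498) N))) (S (S (S (B (B (S (B (L 710) (B
  (L 574) (L 245) N) N)) (L 19753) N) (S (S (S (B (L 19605) (L 19542) N)))) N)))) N"

definition tree22 :: tree where
  "tree22 = B (B (S (B (B (S (B (B (B (L 32252) (L 31598) N) (S (S (S (B (S (S (S (B (L 31683) (L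
  62560) N)))) (S (S (S (S (S (S (S (B (L 31409) (L 509) N)))))))) N)))) (L 62409)) (L 74873) N))
  (S (S (B (B (S (S (S (S (S (B (L 31904) (L 32473) N)))))) (L 31506) N) (S (S (S (S (S (S (S (S
  (S (S (S (S (S (S (S (S (S (S (S (S (S (S (S (S (S (S (B (L 31807) N (L
  32349)))))))))))))))))))))))))))) N))) N) (S (S (S (S (B (L 32097) (S (S (S (S (S (B (L 62351)
  (L 32194) N)))))) N))))) N)) (S (B (S (B (S (S (B (B (L 32155) (L 66691) N) (S (S (S (S (S (S
  (S (S (S (S (S (S (S (S (S (S (S (S (S (S (S (S (S (S (S (S (B N (L 66842) (L
  70768)))))))))))))))))))))))))))) N))) (L 32724) N)) (L 32569) N)) N) (L 62312) N"

definition tree23 :: tree where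
  "tree23 = S (S (B (B (B (B (B (B (S (B (S (S (S (S (S (S (S (S (S (S (S (S (S (S (S (S (S (S (S
  (B (L 31635) (L 62361) N)))))))))))))))))))) (S (S (S (S (S (S (S (S (S (S (S (S (S (S (S (S (S
  (S (S (S (S (S (S (S (S (S (S (B (L 32688) (L 62276) N)))))))))))))))))))))))))))) N)) (S (S (S
  (S (S (S (S (S (S (S (S (S (S (S (S (S (S (S (S (S (S (S (S (S (B (L 32301) (L 31759)
  N))))))))))))))))))))))))) N) (L 322) N) (S (B (S (B (B (B (S (S (S (S (B (L 32398) (L 31555)
  N))))) (L 32204) N) (L 392) N) (B (L 62458) (L 31856) N) N)) (L 31458) N)) N) (S (S (S (S (B (L
  74944) (S (S (B (S (B (B (S (B (S (S (S (S (S (S (S (S (S (S (S (S (S (S (S (S (S (S (S (S (S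
  (B (L 75042) (L 75118) N)))))))))))))))))))))) N (L 75167))) (L 74993) N) (L 75346) N)) (L
  75297) N))) N))))) N) (S (S (S (S (S (B (L 32618) (S (B (S (S (S (S (S (B (L 32243) N (L
  62400))))))) (S (S (S (S (S (S (S (B (L 32146) (L 66682) N)))))))) N)) N)))))) N) (B (L 66767)
  (L 32049) N) N))"

definition tree24 :: tree where
  "tree24 = S (S (S (B (B (B (B (S (S (S (S (B (L 38) (L 19554) N))))) (B (L 494) (S (S (S (B (B
  (L 706) (L 19749) N) (L 19601) N)))) N) (L 18074)) (S (S (S (S (B (S (B (L 62556) (L 74869) N))
  (S (S (S (S (S (S (S (S (S (B (L 31900) (L 32469) N)))))))))) N))))) N) (S (S (S (B (S (B (L
  318) (L 31551) N)) (L 32614) N)))) N) (S (S (S (B (S (S (B (L 34) (S (S (S (S (S (B (L 702) (L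
  19745) N)))))) (L 18070)))) (S (S (S (B (L 30) (L 26) N)))) (L 19690))))) (L 19694))))"

definition tree25 :: tree where
  "tree25 = B (S (S (B (B (S (B (B (S (S (S (S (B (L 75316) (L 31397) N))))) (L 31946) N) (B (S
  (S (S (S (B (S (B (L 66776) (L 66637) N)) (L 32515) N))))) (L 31587) N) N)) (S (S (B (B (S (B
  (S (S (S (S (S (B (L 19913) (L 31362) N)))))) (S (B (L 62707) (S (S (S (S (S (S (S (S (S (B (L
  19824) (L 31308) N)))))))))) N)) N)) (S (S (S (B (L 32089) (L 62548) N)))) N) (B (L 62699) (L
  66625) N) N))) N) (S (S (S (S (B (S (S (S (S (S (S (S (S (S (S (S (S (S (S (S (S (S (B (L
  31822) N (L 32364))))))))))))))))))) (S (S (S (B (S (S (S (S (S (S (S (S (S (S (S (S (S (B (L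
  75039) N (L 75164))))))))))))))) (S (S (S (S (S (S (S (S (S (S (S (S (S (B (L 32240) N (L
  62397))))))))))))))) N)))) N))))) N))) (S (S (B (S (S (S (B (L 32058) (L 412) N)))) (L 66633)
  N))) N"

definition tree26 :: tree where
  "tree26 = S (B (S (B (S (B (B (B (B (B (L 465) (S (S (S (B (S (B (L 32165) (L 31525) N)) (L
  31747) N)))) N) (L 74964) N) (S (S (S (B (L 66701) (L 74815) N)))) N) (S (S (S (S (S (S (S (S
  (S (S (S (S (S (S (S (S (S (S (S (S (S (S (S (S (S (S (B N (L 66852) (L
  70778)))))))))))))))))))))))))))) N) (S (B (S (B (B (B (B (B (L 32581) (S (S (S (S (B (L 23839)
  (L 19838) N))))) N) (L 24050) N) (L 23901) N) (S (B (B (L 62632) (L 19900) N) (L 23826) N)) N)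
  (L 31322) N)) (L 62624) N)) N)) (S (S (S (B (S (B (L 31473) (L 32734) N)) (L 32612) N)))) N))
  (S (S (S (B (L 32579) (L 32610) N)))) N)"

definition tree27 :: tree where
  "tree27 = S (S (B (B (B (B (B (B (L 31875) (S (S (S (B (B (B (S (B (L 32061) (S (S (S (B (L
  31334) (L 721) N)))) N)) (L 338) N) (L 74890) N) (L 264) N)))) N) (B (S (S (B (B (B (S (B (L
  18116) N (L 585))) (L 23976) N) (S (S (S (S (B (L 415) (L 75092) N))))) N) (S (S (S (B (L
  32293) N (L 182))))) N))) (S (S (S (B (L 256) (L 108) N)))) N) N) (L 75370) N) (L 19764) N) (S
  (S (S (B (S (B (B (L 19616) (B (S (S (S (B (B (S (B (L 62322) (L 116) N)) (L 66888) N) (L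
  66813) N)))) (L 573) N) N) (L 31597) N)) (L 19553) N)))) N) (S (S (S (S (S (S (S (B (L 66636)
  (L 31586) N)))))))) N))"

definition one_tree :: tree where
  "one_tree = B (B (B (B (B (B (B (B (B (B (B (B (S (B (B (S (S (S (S (S (S (S (S (S (S (S (S (S
  (S (S (S (S (S (S (S (S (S (S (S (S (S (S (S (S (S (B N (S (S (S (S (S (B (L 675) (L 19718)
  N)))))) (L 18043)))))))))))))))))))))))))))))))) (S (S (S (S (S (S (S (S (S (S (S (S (S (S (S
  (S (S (S (S (S (S (S (S (S (S (S (S (B (L 467) (L 19574) N)))))))))))))))))))))))))))) N) (L
  62529) N)) tree1 (S (S (S (B (L 19663) (L 32413) N))))) (S (S (B (S (B (S (S (B (L 32589) (S (S
  (S (S (S (S (S (B N (S (S (S (S (S (S (S (S (S (S (S (B (L 66711) (S (S (S (B (L 218) (L 19515)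
  N)))) N)))))))))))) (L 18847))))))))) N))) (B (S (S (S (S (B (L 31876) (L 31919) N))))) (L
  31570) N) N)) (L 31351) N))) (L 18179)) tree2 N) tree3 (S (S (S (B (L 70844) (L 31701) N)))))
  (S (S (S (B (B (B (B (B tree4 tree5 (S (S (S (S (S (S (S (S (S (S (S (B (L 128) (L 18858)
  N))))))))))))) (B (S (S (B (S (B (S (B (S (S (S (B N (S (S (S (S (S (S (S (S (S (S (S (S (S (S
  (S (B (L 605) (L 531) N)))))))))))))))) (L 19648))))) N (L 19621))) (S (S (S (S (S (S (S (B (S
  (S (B (L 23996) (L 32537) N))) (S (S (S (S (S (S (S (S (S (S (B (L 24023) (L 29847)
  N))))))))))) N)))))))) N)) (S (S (S (S (S (S (S (S (S (S (S (B (L 18136) N (L 632)))))))))))))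
  N))) (S (S (S (S (S (S (S (S (S (S (S (B (S (S (S (B (L 66873) (L 66798) N)))) (L 558)
  N)))))))))))) N) (L 70799)) tree6 N) (S (S (B (S (S (B (S (S (S (S (S (S (S (S (S (B (S (S (S
  (S (S (S (S (S (S (S (S (S (S (B (L 19846) (L 19784) N)))))))))))))) (S (S (S (S (S (S (S (S (S
  (S (S (S (B (L 19873) (L 23799) N))))))))))))) N)))))))))) (S (B (S (S (S (S (B (B N (S (S (S
  (S (S (S (S (S (S (S (S (S (S (S (S (S (S (S (S (S (B (L 74891) (L 62578)
  N))))))))))))))))))))) (L 31949)) (L 74918) N))))) (L 62605) N)) N))) (S (S (S (S (S (S (S (S
  (S (S (S (S (S (S (S (S (S (S (S (S (S (S (B (L 19811) (L 31295) N))))))))))))))))))))))) N)))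
  N) tree7 N)))) (S (S (S (B (L 31968) (S (S (S (B (B (B (B (B (L 62419) (S (S (S (S (S (S (S (S
  (S (S (S (S (S (S (S (S (S (S (B N (L 593) (L 19636)))))))))))))))))))) N) (B (L 136) (L 18866)
  N) N) (L 31617) N) (L 75186) N) (L 32386) N)))) N))))) (B (S (S (B (B (B tree8 (S (B (S (B (S
  (B (S (S (S (S (S (S (S (S (S (S (S (S (S (S (S (S (S (S (S (S (S (S (B (L 24058) (L 23861)
  N))))))))))))))))))))))) (S (B (S (S (B (S (S (S (S (S (S (S (S (S (S (S (S (S (S (S (S (S (S
  (S (S (S (S (S (B (S (S (B (L 23977) (L 32518) N))) (L 24004) N)))))))))))))))))))))))) (L
  32545) N))) (S (S (S (S (S (S (S (S (S (S (B (L 24031) (L 29855) N))))))))))) N)) N)) (S (S (S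
  (B (L 66742) (L 74856) N)))) N)) (L 23888) N)) N) (S (S (S (B (B (S (S (S (S (B (S (S (S (S (S
  (S (S (S (B (L 32004) (L 416) N))))))))) (L 32031) N))))) (S (S (S (S (B (L 75093) (L 75370)
  N))))) N) (L 66818) N)))) N) (S (S (S (B (B (L 502) (S (S (S (S (B (B (L 32294) (S (B (L 385)
  (L 31451) N)) N) (L 74937) N))))) N) (S (S (S (B (L 311) (L 19683) N)))) (S (S (S (S (S (S (S
  (B (S (S (S (S (S (S (S (S (S (S (S (S (S (S (S (S (S (S (S (S (S (S (B N (L 183) (L
  18144)))))))))))))))))))))))) N (L 640))))))))))))) N))) tree9 N) (S (S (S (B (L 18082) (L
  70807) N))))) (B (B (S (B (B (B (B (B (B (B (B (B N (S (S (S (B (L 32256) (S (S (S (S (S (S (S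
  (S (S (S (S (S (S (S (S (B (L 62440) (L 31838) N)))))))))))))))) N)))) (L 32407)) (S (S (S (S
  (B (L 32583) (L 31564) N))))) N) (L 32219) N) (S (S (S (B (S (S (B (L 31602) (L 32016) N))) (S
  (S (S (B (S (S (S (S (S (S (S (S (S (S (S (B (L 32643) (L 74782) N)))))))))))) N (L 428)))))
  N)))) N) tree10 (S (S (S (B (L 31962) (S (S (S (B (L 62413) (L 32380) N)))) N))))) (B (S (S (B
  (S (B (S (S (S (S (S (S (S (S (S (S (S (S (S (S (S (S (S (S (S (S (S (B (L 23909) (L 23936)
  N)))))))))))))))))))))) (S (B (S (S (S (S (S (S (S (S (S (S (S (S (S (S (S (S (S (S (S (S (S (S
  (S (S (S (S (B (L 24052) (L 23855) N))))))))))))))))))))))))))) (L 23882) N)) N)) (L 74931)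
  N))) (S (S (S (S (S (S (B (L 74877) (L 23963) N))))))) N) N) tree11 N) tree12 N) tree13 (L
  62502))) tree14 N) (L 62316) N) N) (B (B (B (B (B (B (B (B (S (B (B (S (S (S (S (B (B (S (S (S
  (S (S (S (S (S (S (S (S (S (B (L 31639) (L 62365) N))))))))))))) (S (S (S (S (S (S (S (S (S (S
  (S (S (B (S (B (L 75208) (L 75056) N)) (L 75132) N))))))))))))) N) (S (S (S (S (S (S (S (S (S
  (S (S (S (S (B (L 31489) (L 32332) N)))))))))))))) N))))) (L 31914) N) (S (S (S (S (S (B (S (S
  (S (S (S (S (S (S (S (S (S (S (S (S (S (S (S (S (S (S (S (B (L 32692) (L 62280)
  N)))))))))))))))))))))) (L 32483) N)))))) N)) tree15 (L 75181)) (B (S (S (B (L 75365) (S (S (S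
  (S (S (S (S (S (S (S (S (S (B (L 380) (L 31446) N))))))))))))) N))) (L 326) N) N) tree16 N) (B
  (S (B tree17 (S (S (S (B (L 75306) (S (S (S (S (S (S (S (S (S (S (S (S (S (S (S (S (S (S (S (S
  (S (S (B (L 75029) N (L 75154)))))))))))))))))))))))) N)))) N)) (L 75360) (L 75360)) N) tree18
  N) tree19 N) (L 23834) N) (S (S (B (L 75365) (L 31581) N))) (L 75365)) N) (B (B (S (B (B (B (B
  tree20 tree21 (L 18078)) tree22 N) tree23 N) tree24 (S (S (S (B (L 62473) (S (S (S (B (B (B (S
  (S (S (S (S (S (S (S (S (B (L 19698) (S (S (S (S (S (S (S (S (S (S (B N (L 190) (L
  18151)))))))))))) N)))))))))) (L 443) N) (L 75240) N) (L 31671) (L 647))))) N)))))) (S (S (S (S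
  (S (S (S (S (S (B (L 461) (L 31521) N)))))))))) N) (S (S (S (S (S (S (B (B (L 31871) (L 31330)
  N) (S (S (S (B (L 75088) (L 32289) N)))) N))))))) N) (S (S (S (B (L 62477) (S (S (S (B (B (B (S
  (S (S (S (S (S (S (S (S (B (L 659) (S (S (S (S (S (S (S (S (S (S (B N (S (S (S (S (S (S (S (S
  (S (S (S (S (S (S (S (B N (L 194) (L 18823))))))))))))))))) (L 18155)))))))))))) N)))))))))) (S
  (S (S (S (S (B (L 70818) (L 447) N)))))) N) (S (S (S (S (B (L 62508) (L 75244) N))))) N) (L
  31675) (L 651))))) N))))) tree25 N) tree26 N) tree27 (L 75370)"

definition tree29 :: tree where
  "tree29 = S (S (B (S (B (S (B (L 70853) (S (S (S (S (B (S (B (L 18190) (L 19675) N)) (S (S (S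
  (S (S (B (L 62481) (L 31976) N)))))) N))))) (S (S (S (B (L 18089) (L 18097) N)))))) (L 75371)
  N)) (S (S (S (B (B (B (B (B (L 62427) (S (S (S (S (S (S (B (B (L 663) (S (S (S (S (S (S (S (S
  (S (S (B N (S (S (S (S (S (S (S (S (S (S (S (S (S (S (S (B N (L 198) (L 18827)))))))))))))))))
  (L 18159)))))))))))) N) (S (S (S (S (S (S (S (S (S (S (S (B N (L 601) (L 19644)))))))))))))
  N))))))) N) (B (L 144) (S (S (S (S (S (S (S (B (L 18105) (L 18874) N)))))))) N) N) (S (S (S (B
  (L 31710) (S (B (S (S (B (L 70822) (L 31625) N))) (L 451) N)) N)))) N) (S (S (S (S (B (B (L
  62512) (L 32425) N) (S (S (S (S (B (L 75248) (L 75194) N))))) N))))) N) (S (S (S (S (B (L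
  31679) (L 32394) N))))) (S (S (S (S (S (S (S (S (S (B (L 655) (L 70814) N)))))))))))))) N))"

definition two_tree :: tree where
  "two_tree = S tree29"

lemmas tree_defs = tree1_def tree2_def tree3_def tree4_def tree5_def tree6_def tree7_def
  tree8_def tree9_def tree10_def tree11_def tree12_def tree13_def tree14_def tree15_def
  tree16_def tree17_def tree18_def tree19_def tree20_def tree21_def tree22_def tree23_def
  tree24_def tree25_def tree26_def tree27_def one_tree_def tree29_def two_tree_def

section \<open>The finite verification\<close>

section \<open>Evaluation of the scanners\<close>

definition segment_block :: "segment \<Rightarrow> (nat \<times> sym) list \<times> nat" where
  "segment_block = (\<lambda>(b, cs, k). (labelled (b, concat cs), k))"

definition segments_word :: "segment list \<Rightarrow> (nat \<times> sym) list" where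
  "segments_word ss = blocks (map segment_block ss)"

fun chunk_labels :: "nat \<Rightarrow> sym list list \<Rightarrow> (nat \<times> sym list) list" where
  "chunk_labels b [] = []"
| "chunk_labels b (c # cs) = (b, c) # chunk_labels (b + length c) cs"

definition stream :: "segment list \<Rightarrow> (nat \<times> sym list) list" where
  "stream ss = concat (map (\<lambda>(b, cs, k). list_power (chunk_labels b cs) k) ss)"

lemma concat_chunk_labels: "concat (map labelled (chunk_labels b cs)) = labelled (b, concat cs)"
  by (induction cs arbitrary: b) (simp_all add: labelled_append, simp add: labelled_def)

lemma concat_map_list_power: "concat (map f (list_power w k)) = list_power (concat (map f w)) k"
  by (induction k) auto

lemma segments_word_stream: "concat (map labelled (stream ss)) = segments_word ss"
proof (induction ss)
  case (Cons s ss)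
  obtain b cs k where s: "s = (b, cs, k)" by (cases s)
  have "concat (map labelled (stream (s # ss))) =
      concat (map labelled (list_power (chunk_labels b cs) k)) @ concat (map labelled (stream ss))"
    by (simp add: stream_def s)
  then show ?case using Cons
    by (simp add: segments_word_def blocks_def segment_block_def s concat_map_list_power
        concat_chunk_labels)
qed (simp add: stream_def segments_word_def blocks_def)

lemma map_snd_segments_word: "map snd (segments_word ss) = concat (map snd (stream ss))"
  by (simp add: map_snd_labelled map_concat o_def flip: segments_word_stream)

definition steady :: "nat \<Rightarrow> segment" where
  "steady n = (75019, pu, n)"

text \<open>Each count is the least \<open>k\<close> with \<open>p + 513 \<le> k * p\<close>, where
  \<open>p\<close> is the length of the cycle.\<close>

definition reduced :: "segment list" where
  "reduced = segs 2 5 4 5 2 5 5 2 @ [steady 3]"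

definition full :: "nat \<Rightarrow> segment list" where
  "full n = segs 26 25 25 9 26 26 26 2 @ [steady n]"

lemma reduced_full:
  assumes "3 \<le> n" "k \<le> 513"
  shows "list_all2 (pumped k) (map segment_block reduced) (map segment_block (full n))"
proof -
  have len: "length (labelled (b, w)) = length w" for b w by (simp add: labelled_def)
  show ?thesis using assms
    by (simp add: reduced_def full_def segs_def steady_def segment_block_def pumped_def len
        pa_def pb_def pc_def pd_def pe_def pf_def pu_def chunk_length)
qed

lemma stream_cong: "ss = ts \<Longrightarrow> stream ss = concat (map (\<lambda>(b, cs, k). list_power (chunk_labels b cs) k) ts)"
  by (simp add: stream_def)

lemma list_power_numerals:
  "list_power w 1 = w" "list_power w 2 = w @ w" "list_power w 3 = w @ w @ w"
  "list_power w 4 = w @ w @ w @ w" "list_power w 5 = w @ w @ w @ w @ w"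
  by (simp_all add: numeral_eq_Suc)

lemmas reduced_stream =
  stream_cong[OF reduced_def, simplified segs_def steady_def pa_def pb_def pc_def pd_def pe_def
    pf_def pu_def chunk_labels.simps chunk_length append.simps list.map prod.case concat.simps
    list_power_numerals arith_simps arith_special append_Nil2]

text \<open>Counters become towers of \<open>Suc\<close>, the form on which the recursion equations
  of the scanners match.\<close>

lemma nat_unary:
  "(numeral (num.Bit0 n) :: nat) = numeral n + numeral n"
  "(numeral (num.Bit1 n) :: nat) = Suc (numeral n + numeral n)"
  "(numeral num.One :: nat) = Suc 0" "(1 :: nat) = Suc 0"
  by (simp_all add: numeral.simps)

lemmas unary = nat_unary add_Suc add_0

lemmas chunk_stream = reduced_stream[THEN arg_cong[of _ _ "map snd"], simplified list.map snd_conv]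

lemmas chk_eval = chk_stream_simps chunk_defs[THEN chk_stream_unfold(1)]
  chunk_defs[THEN chk_stream_unfold(2)] chunk_defs[THEN chk_stream_unfold(3)]

text \<open>The extra letter \<open>I\<close> in front is the last letter of the aperiodic part of the word.\<close>

lemma chk_reduced:
  "list_all (\<lambda>(d, k). chk_skip d k ([I] # map snd (stream reduced)) [] ([I] # map snd (stream reduced)))
    [(23, 3), (46, 7), (69, 11), (92, 15), (115, 19), (138, 23), (161, 27), (184, 31), (207, 35),
     (230, 39), (253, 43), (276, 47), (299, 51), (322, 55), (345, 59), (368, 63), (391, 67),
     (414, 71), (437, 75)]"
  unfolding chunk_stream by (simp only: list.pred_inject prod.case unary chk_eval simp_thms)

lemma forbidden_eval:
  "forbidden s h \<longleftrightarrow> ends_match (drop 22 h) s 3 h \<or> ends_match (drop 45 h) s 7 h \<or>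
    ends_match (drop 68 h) s 11 h"
  by (simp add: forbidden_def forbids_def)

lemma eqs_eval:
  "eqs Z Z" "eqs I I" "eqs D D" "eqs I J" "eqs J I" "eqs J J" "eqs D E" "eqs E D" "eqs E E"
  "\<not> eqs Z I" "\<not> eqs Z D" "\<not> eqs I Z" "\<not> eqs I D" "\<not> eqs D Z" "\<not> eqs D I" "\<not> eqs W b" "\<not> eqs a W"
  "\<not> eqs Z J" "\<not> eqs Z E" "\<not> eqs I E" "\<not> eqs D J"
  "\<not> eqs J Z" "\<not> eqs J D" "\<not> eqs J E" "\<not> eqs E Z" "\<not> eqs E I" "\<not> eqs E J"
  by (simp_all add: eqs_def)

lemma all_minimal_reduced: "all_minimal [] [] (map snd (stream reduced))"
  unfolding chunk_stream
  by (simp only: all_minimal.simps minimal.simps forbidden_eval unary take_Suc_Cons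
      take_0 take_Nil drop_Suc_Cons drop_0 drop_Nil ends_match.simps match_upto.simps eqs_eval
      chunk_defs[THEN all_minimal_unfold] simp_thms cong: conj_left_cong)

lemmas locates_eval = locates_stream_simps tree_defs[THEN tree_unfold(1)]
  chunk_defs[THEN locates_stream_unfold]

lemma all_located_reduced: "all_located one_tree two_tree 0 [] (stream reduced)"
  unfolding reduced_stream
  by (simp only: all_located_simps all_located.simps(1,2) locates_eval
      chunk_defs[THEN all_located_unfold] Suc_numeral One_nat_def[symmetric] Suc_1 add_num_simps
      numeral_eq_iff num.inject num.distinct simp_thms cong: conj_left_cong)

lemma depth_trees: "depth_le 52 one_tree" "depth_le 52 two_tree"
  unfolding unary by (simp_all only: depth_le.simps tree_defs[THEN tree_unfold(2)] simp_thms)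

section \<open>The infinite word and its labels\<close>

section \<open>The infinite labelled word\<close>

definition prefix_segs :: "segment list" where
  "prefix_segs = segs 26 25 25 9 26 26 26 2"

text \<open>Any number of blocks that reaches position \<open>i\<close> gives the same value
  (\<open>nth_full\<close>); \<open>Suc i\<close> blocks always do.\<close>

definition word_at :: "nat \<Rightarrow> nat \<times> sym" where
  "word_at i = segments_word (full (Suc i)) ! i"

definition lab :: "nat \<Rightarrow> nat" where "lab i = fst (word_at i)"

definition ltr :: "nat \<Rightarrow> sym" where "ltr i = snd (word_at i)"

lemma length_labelled: "length (labelled (b, w)) = length w"
  by (simp add: labelled_def)

lemma nth_labelled: "i < length w \<Longrightarrow> labelled (b, w) ! i = (b + i, w ! i)"
  by (simp add: labelled_def)

lemma segments_word_Nil: "segments_word [] = []"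
  by (simp add: segments_word_def blocks_def)

lemma segments_word_Cons:
  "segments_word ((b, cs, k) # ss) = list_power (labelled (b, concat cs)) k @ segments_word ss"
  by (simp add: segments_word_def blocks_def segment_block_def)

lemma segments_word_append: "segments_word (ss @ ts) = segments_word ss @ segments_word ts"
  by (simp add: segments_word_def blocks_def)

lemma segments_word_full:
  "segments_word (full n) = segments_word prefix_segs @ list_power (labelled (75019, concat pu)) n"
  by (simp add: full_def prefix_segs_def steady_def segments_word_append segments_word_Cons
      segments_word_Nil)

lemma length_concat_pu: "length (concat pu) = 353"
  by (simp add: pu_def chunk_length)

lemma length_prefix_segs: "length (segments_word prefix_segs) = 75019"
  by (simp add: prefix_segs_def segs_def segments_word_Cons segments_word_Nil length_list_power
      length_labelled pa_def pb_def pc_def pd_def pe_def pf_def chunk_length)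

lemma length_full: "length (segments_word (full n)) = 75019 + 353 * n"
  by (simp add: segments_word_full length_prefix_segs length_list_power length_labelled
      length_concat_pu)

lemma nth_full: "i < 75019 + 353 * n \<Longrightarrow> segments_word (full n) ! i = word_at i"
  by (auto simp: word_at_def segments_word_full nth_append length_prefix_segs nth_list_power
      length_labelled length_concat_pu simp del: replicate_Suc)

lemma word_at_steady: "word_at (75019 + q) = (75019 + q mod 353, concat pu ! (q mod 353))"
  by (simp add: word_at_def segments_word_full nth_append length_prefix_segs nth_list_power
      length_labelled length_concat_pu nth_labelled del: replicate_Suc)

fun positions_from :: "nat \<Rightarrow> segment list \<Rightarrow> (nat \<times> segment) list" where
  "positions_from s [] = []"
| "positions_from s ((b, cs, k) # ss) =
    (s, b, cs, k) # positions_from (s + k * length (concat cs)) ss"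

lemma positions_from_nth:
  assumes "i < length (segments_word ss)"
  shows "\<exists>(s, b, cs, k) \<in> set (positions_from t ss). s \<le> t + i \<and> t + i < s + k * length (concat cs) \<and>
    segments_word ss ! i =
      (b + (t + i - s) mod length (concat cs), concat cs ! ((t + i - s) mod length (concat cs)))"
  using assms
proof (induction ss arbitrary: t i)
  case (Cons x ss)
  obtain b cs k where x: "x = (b, cs, k)" by (cases x)
  show ?case
  proof (cases "i < k * length (concat cs)")
    case True
    then have "0 < length (concat cs)" by (metis mult_0_right not_less0 not_gr_zero)
    then have "i mod length (concat cs) < length (concat cs)" by simp
    then show ?thesis using True
      by (intro bexI[of _ "(t, b, cs, k)"])
        (simp_all add: x segments_word_Cons nth_append length_list_power length_labelled
          nth_list_power nth_labelled)
  next
    case False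
    let ?n = "k * length (concat cs)"
    have "i - ?n < length (segments_word ss)"
      using False Cons.prems by (simp add: x segments_word_Cons length_list_power length_labelled)
    from Cons.IH[OF this, of "t + ?n"] show ?thesis
      using False by (auto simp: x segments_word_Cons nth_append length_list_power length_labelled)
  qed
qed (simp add: segments_word_Nil)

definition positions :: "(nat \<times> segment) list" where
  "positions = positions_from 0 prefix_segs"

lemma word_at_prefix:
  assumes "i < 75019"
  obtains s b cs k where "(s, b, cs, k) \<in> set positions" "s \<le> i" "i < s + k * length (concat cs)"
    "word_at i = (b + (i - s) mod length (concat cs), concat cs ! ((i - s) mod length (concat cs)))"
proof -
  have "word_at i = segments_word prefix_segs ! i"
    using assms by (simp add: word_at_def segments_word_full nth_append length_prefix_segs)
  then show ?thesis
    using positions_from_nth[of i prefix_segs 0] assms that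
    by (auto simp: length_prefix_segs positions_def)
qed

lemma positions_cong: "ss = ts \<Longrightarrow> positions_from n ss = positions_from n ts"
  by simp

lemmas positions_eval =
  trans[OF positions_def positions_cong[OF prefix_segs_def], unfolded segs_def pa_def pb_def pc_def
    pd_def pe_def pf_def, simplified
    positions_from.simps concat.simps length_append list.size chunk_length arith_simps
    arith_special add_num_simps mult_1 mult_1_right add_0 add_0_right]

text \<open>The transfer principle: a check on the shortened word becomes a statement about all
  factors of the infinite word. The prefix \<open>u\<close> provides context in front of it, either
  padding or the fictitious letter 1.\<close>

lemma window_index:
  assumes "all_windows k Q (u @ segments_word reduced)" "k \<le> 513"
  shows "Q (map (\<lambda>j. if j < length u then u ! j else word_at (j - length u)) [i..<i + k])"
    (is "Q ?w")
proof -
  define n where "n = 3 + i + k"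
  then have n: "3 \<le> n" "i + k \<le> n" by simp_all
  have "list_all2 (pumped k) (map segment_block reduced) (map segment_block (full n))"
    using reduced_full[OF n(1) assms(2)] .
  moreover have "all_windows k Q (u @ blocks (map segment_block reduced) @ [])"
    using assms(1) by (simp only: segments_word_def append_Nil2)
  ultimately have "all_windows k Q (u @ blocks (map segment_block (full n)) @ [])"
    by (rule all_windows_blocks)
  then have w: "all_windows k Q (u @ segments_word (full n))"
    by (simp only: segments_word_def append_Nil2)
  have len: "i + k \<le> length u + length (segments_word (full n))"
    using n unfolding length_full by linarith
  have "take k (drop i (u @ segments_word (full n))) = ?w"
  proof (rule nth_equalityI)
    show "length (take k (drop i (u @ segments_word (full n)))) = length ?w"
      using len by simp
  next
    fix j assume "j < length (take k (drop i (u @ segments_word (full n))))"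
    then have j: "j < k" by simp
    then have "i + j - length u < 75019 + 353 * n" using n by linarith
    note nth_full[OF this]
    moreover have "take k (drop i (u @ segments_word (full n))) ! j = (u @ segments_word (full n)) ! (i + j)"
      using j len by (simp only: nth_take) (simp only: nth_drop length_append)
    ultimately show "take k (drop i (u @ segments_word (full n))) ! j = ?w ! j"
      using j by (simp add: nth_append del: drop_append take_append)
  qed
  then show ?thesis using w len unfolding all_windows_def by (metis length_append)
qed

section \<open>Stretches in which a cycle runs on\<close>

section \<open>Periodic stretches\<close>

definition periodic_labels :: "nat \<Rightarrow> sym list list \<Rightarrow> nat \<Rightarrow> nat \<Rightarrow> nat \<Rightarrow> bool" where
  "periodic_labels b P d s e \<longleftrightarrow> (\<forall>q. s \<le> q \<and> q < e \<longrightarrow> lab q = b + (q + d) mod length (concat P))"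

definition periodic_letters :: "sym list list \<Rightarrow> nat \<Rightarrow> nat \<Rightarrow> nat \<Rightarrow> bool" where
  "periodic_letters P d s e \<longleftrightarrow>
    (\<forall>q. s \<le> q \<and> q < e \<longrightarrow> um (ltr q) = um (concat P ! ((q + d) mod length (concat P))))"

text \<open>The chunks are cut so finely that each segment of a stretch begins at a chunk boundary
  of its cycle, so phases are compared chunk by chunk. A phase inside a chunk gives
  \<open>[]\<close>, which fails the test \<open>prefix_um\<close>.\<close>

fun drop_chunks :: "nat \<Rightarrow> 'a list list \<Rightarrow> 'a list list" where
  "drop_chunks n [] = []"
| "drop_chunks n (c # cs) =
    (if n = 0 then c # cs else if length c \<le> n then drop_chunks (n - length c) cs else [])"

fun prefix_um :: "sym list list \<Rightarrow> sym list list \<Rightarrow> bool" where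
  "prefix_um [] ds = True"
| "prefix_um (c # cs) [] = False"
| "prefix_um (c # cs) (d # ds) \<longleftrightarrow> map um c = map um d \<and> prefix_um cs ds"

lemma concat_drop_chunks: "drop_chunks n cs \<noteq> [] \<Longrightarrow> concat (drop_chunks n cs) = drop n (concat cs)"
  by (induction n cs rule: drop_chunks.induct) (auto split: if_splits)

lemma prefix_um_D:
  "prefix_um cs ds \<Longrightarrow> \<exists>w. map um (concat ds) = map um (concat cs) @ w"
  by (induction cs ds rule: prefix_um.induct) auto

definition phase_ok :: "nat \<Rightarrow> nat \<Rightarrow> nat \<Rightarrow> nat \<Rightarrow> bool" where
  "phase_ok p o' n k \<longleftrightarrow> (k = 1 \<and> o' + n \<le> p \<or> o' = 0 \<and> n = p)"

text \<open>No copy wraps around the period: a single piece lies inside one period, and repeated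
  pieces are whole periods entered at phase 0.\<close>

lemma phase_ok_D:
  assumes "phase_ok p ((s + d) mod p) n k" "s \<le> q" "q < s + k * n"
  shows "(q + d) mod p = (s + d) mod p + (q - s) mod n"
proof -
  have q: "(q + d) mod p = ((s + d) mod p + (q - s)) mod p"
    using assms(2) by (metis add.assoc add.commute le_add_diff_inverse2 mod_add_left_eq)
  show ?thesis
  proof (cases "k = 1 \<and> (s + d) mod p + n \<le> p")
    case True
    then have "q - s < n" "(s + d) mod p + (q - s) < p" using assms(2,3) by auto
    then show ?thesis unfolding q by (simp only: mod_less)
  next
    case False
    then show ?thesis using assms(1) unfolding q by (auto simp: phase_ok_def)
  qed
qed

definition positions_length :: "(nat \<times> nat \<times> sym list list \<times> nat \<times> nat) list" where
  "positions_length = map (\<lambda>(s, b, cs, k). (s, b, cs, k, length (concat cs))) positions"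

definition outside :: "nat \<Rightarrow> nat \<Rightarrow> nat \<Rightarrow> nat \<Rightarrow> nat \<Rightarrow> bool" where
  "outside s e s' k n \<longleftrightarrow> (if k * n + s' \<le> s then True else e \<le> s')"

fun labels_ok :: "nat \<Rightarrow> nat \<Rightarrow> nat \<Rightarrow> nat \<Rightarrow> nat \<Rightarrow> nat \<times> nat \<times> sym list list \<times> nat \<times> nat \<Rightarrow> bool"
where
  "labels_ok b p d s e (s', b', cs, k, n) = (if outside s e s' k n then True
    else b' = b + (s' + d) mod p \<and> phase_ok p ((s' + d) mod p) n k)"

fun letters_ok ::
  "sym list list \<Rightarrow> nat \<Rightarrow> nat \<Rightarrow> nat \<Rightarrow> nat \<Rightarrow> nat \<times> nat \<times> sym list list \<times> nat \<times> nat \<Rightarrow> bool"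
where
  "letters_ok P p d s e (s', b', cs, k, n) = (if outside s e s' k n then True
    else prefix_um cs (drop_chunks ((s' + d) mod p) P) \<and> phase_ok p ((s' + d) mod p) n k)"

lemma periodic_labels_I:
  assumes "length (concat P) = p" "e \<le> 75019"
    and "list_all (labels_ok b p d s e) positions_length"
  shows "periodic_labels b P d s e"
  unfolding periodic_labels_def
proof (intro allI impI)
  fix q assume q: "s \<le> q \<and> q < e"
  then have "q < 75019" using assms(2) by simp
  then obtain s' b' cs k where p: "(s', b', cs, k) \<in> set positions" "s' \<le> q"
    "q < s' + k * length (concat cs)"
    "word_at q = (b' + (q - s') mod length (concat cs), concat cs ! ((q - s') mod length (concat cs)))"
    by (rule word_at_prefix)
  then have "labels_ok b p d s e (s', b', cs, k, length (concat cs))"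
    using assms(3) unfolding list_all_iff positions_length_def by force
  with p q have b: "b' = b + (s' + d) mod p"
    and "phase_ok p ((s' + d) mod p) (length (concat cs)) k"
    by (simp_all add: outside_def split: if_splits)
  from phase_ok_D[OF this(2) p(2,3)] show "lab q = b + (q + d) mod length (concat P)"
    using p(4) b by (simp add: lab_def assms(1))
qed

lemma periodic_letters_I:
  assumes "length (concat P) = p" "e \<le> 75019"
    and "list_all (letters_ok P p d s e) positions_length"
  shows "periodic_letters P d s e"
  unfolding periodic_letters_def
proof (intro allI impI)
  fix q assume q: "s \<le> q \<and> q < e"
  then have "q < 75019" using assms(2) by simp
  then obtain s' b' cs k where p: "(s', b', cs, k) \<in> set positions" "s' \<le> q"
    "q < s' + k * length (concat cs)"
    "word_at q = (b' + (q - s') mod length (concat cs), concat cs ! ((q - s') mod length (concat cs)))"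
    by (rule word_at_prefix)
  let ?o = "(s' + d) mod p" and ?i = "(q - s') mod length (concat cs)"
  from p have "letters_ok P p d s e (s', b', cs, k, length (concat cs))"
    using assms(3) unfolding list_all_iff positions_length_def by force
  with p q have um: "prefix_um cs (drop_chunks ?o P)"
    and ok: "phase_ok p ?o (length (concat cs)) k"
    by (simp_all add: outside_def split: if_splits)
  have "0 < length (concat cs)" using p(2,3) by (metis add_0_right leD mult_0_right not_gr_zero)
  then have i: "?i < length (concat cs)" by simp
  then have "cs \<noteq> []" by auto
  then have "drop_chunks ?o P \<noteq> []" using um by (cases cs) auto
  from concat_drop_chunks[OF this] have c: "concat (drop_chunks ?o P) = drop ?o (concat P)" .
  obtain w where w: "map um (concat (drop_chunks ?o P)) = map um (concat cs) @ w"
    using prefix_um_D[OF um] by blast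
  then have "length (concat cs) \<le> length (drop ?o (concat P))"
    unfolding c by (metis length_append length_map le_add1)
  then have "?o + ?i < length (concat P)" using i by simp
  moreover have "map um (drop ?o (concat P)) ! ?i = map um (concat cs) ! ?i"
    using i unfolding w[unfolded c] by (simp add: nth_append)
  ultimately have "um (concat P ! (?o + ?i)) = um (concat cs ! ?i)" using i by simp
  with phase_ok_D[OF ok p(2,3)] show "um (ltr q) = um (concat P ! ((q + d) mod length (concat P)))"
    using p(4) by (simp add: ltr_def assms(1))
qed

lemma map_cong2: "xs = ys \<Longrightarrow> map f xs = map f ys"
  by simp

lemmas positions_length_eval =
  trans[OF positions_length_def map_cong2[OF positions_eval], simplified
    list.map prod.case concat.simps length_append list.size chunk_length arith_simps arith_special
    add_num_simps add_0 add_0_right]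

lemma period_length:
  "length (concat pa) = 668" "length (concat pb) = 151" "length (concat pc) = 224"
  "length (concat pd) = 1138" "length (concat pe) = 151" "length (concat pf) = 151"
  "length (concat px) = 16"
  by (simp_all add: pa_def pb_def pc_def pd_def pe_def pf_def px_def chunk_length)

lemma chunk_um:
  "map um pa1 = map um pb1" "map um li5 = map um pb2" "map um pb9 = map um pc1"
  "map um li6 = map um pc2" "map um pb7 = map um pc5" "map um li7 = map um pb8"
  by (simp_all add: chunk_defs)

lemma label_stretches:
  "periodic_labels 54 pa 614 54 18043"
  "periodic_labels 54 pa 21 18191 18823"
  "periodic_labels 54 pa 21 18875 19507"
  "periodic_labels 19765 pb 16 19765 23793"
  "periodic_labels 23840 pc 128 23840 29835"
  "periodic_labels 19765 pb 8 29863 31289"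
  "periodic_labels 31598 pd 266 31598 62276"
  "periodic_labels 62561 pe 104 62561 66587"
  "periodic_labels 66738 pf 4 66738 70768"
  "periodic_labels 31598 pd 233 70854 74766"
  by (rule periodic_labels_I, rule period_length, simp,
      simp add: positions_length_eval outside_def phase_ok_def)+

text \<open>The first ten stretches run up to the interrupting letter, beyond the label stretches.
  Near the end the cycle still continues, but the 52 letters after a position already see the
  interruption, so positions there are labelled individually. The last three stretches only serve to
  find forcing powers.\<close>

lemma letter_stretches:
  "periodic_letters pa 614 54 18089"
  "periodic_letters pa 21 18191 18874"
  "periodic_letters pa 21 18875 19558"
  "periodic_letters pb 16 19765 23841"
  "periodic_letters pc 128 23840 29887"
  "periodic_letters pb 8 29863 31334"
  "periodic_letters pd 266 31598 62323"
  "periodic_letters pe 104 62561 66637"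
  "periodic_letters pf 4 66738 70814"
  "periodic_letters pd 233 70854 74817"
  "periodic_letters pa 275 19699 19770"
  "periodic_letters px 8 31480 31496"
  "periodic_letters px 12 31572 31587"
  by (rule periodic_letters_I, rule period_length, simp,
      simp add: positions_length_eval outside_def phase_ok_def chunk_length chunk_um pa_def pb_def
        pc_def pd_def pe_def pf_def px_def)+

definition literal_intervals :: "(nat \<times> nat) list" where
  "literal_intervals = [(0, 54), (18043, 18191), (18823, 18875), (19507, 19702), (19711, 19765),
    (23793, 23840), (29835, 29863), (31289, 31598), (62276, 62561), (66587, 66738), (70768, 70854),
    (74766, 75018)]"

fun shift_ok :: "nat \<Rightarrow> nat \<Rightarrow> nat \<Rightarrow> nat \<Rightarrow> nat \<times> nat \<times> sym list list \<times> nat \<times> nat \<Rightarrow> bool"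
where
  "shift_ok x y s e (s', b', cs, k, n) =
    (if outside s e s' k n then True else b' + x = s' + y \<and> k = 1)"

lemma shifted_label:
  assumes "list_all (shift_ok x y s e) positions_length" "e \<le> 75019" "s \<le> q" "q < e"
  shows "lab q + x = q + y"
proof -
  have "q < 75019" using assms by simp
  then obtain s' b' cs k where p: "(s', b', cs, k) \<in> set positions" "s' \<le> q"
    "q < s' + k * length (concat cs)"
    "word_at q = (b' + (q - s') mod length (concat cs), concat cs ! ((q - s') mod length (concat cs)))"
    by (rule word_at_prefix)
  then have "shift_ok x y s e (s', b', cs, k, length (concat cs))"
    using assms(1) unfolding list_all_iff positions_length_def by force
  with p assms(3,4) have "b' + x = s' + y" "k = 1" by (simp_all add: outside_def split: if_splits)
  then show ?thesis using p by (simp add: lab_def)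
qed

lemma literal_label:
  assumes "(s, e) \<in> set literal_intervals" "s \<le> q" "q < e"
  shows "lab q = q"
proof -
  have "list_all (\<lambda>(s, e). list_all (shift_ok 0 0 s e) positions_length) literal_intervals"
    by (simp add: literal_intervals_def positions_length_eval outside_def)
  then have "list_all (shift_ok 0 0 s e) positions_length"
    using assms(1) by (auto simp: list_all_iff)
  moreover have "e \<le> 75019" using assms(1) by (auto simp: literal_intervals_def)
  ultimately show ?thesis using shifted_label[OF _ _ assms(2,3)] by fastforce
qed

lemma irregular_label:
  assumes "19702 \<le> q" "q < 19711"
  shows "lab q + 19043 = q"
  using shifted_label[OF _ _ assms, of 19043 0] by (simp add: positions_length_eval outside_def)

lemma lab_75018: "lab 75018 = 75371"
  using shifted_label[of 0 353 75018 75019 75018] by (simp add: positions_length_eval outside_def)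

text \<open>The offset comes from \<open>75019 + 170 = 213 * 353\<close>. The formula starts at
  75018 because that letter is labelled like the end of a block.\<close>

lemma lab_steady: "75018 \<le> q \<Longrightarrow> lab q = 75019 + (q + 170) mod 353"
proof (cases "q = 75018")
  case False
  assume "75018 \<le> q"
  then obtain r where "q = 75019 + r" using False by (metis Suc_leI le_Suc_ex le_neq_implies_less
      One_nat_def numeral_plus_one Suc_eq_plus1 semiring_norm(5) eval_nat_numeral(3))
  moreover have "(75019 + r + 170) mod 353 = r mod 353"
    using mod_mult_self1[of r 213 353] by (simp add: ac_simps)
  ultimately show ?thesis by (simp add: lab_def word_at_steady)
qed (simp add: lab_75018)

section \<open>The morphism read position by position\<close>

section \<open>The word\<close>

text \<open>The fixed-point equation for positions: first \<open>v\<close>, then for each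
  \<open>j\<close> the word \<open>u\<close> followed by the letter at position
  \<open>j\<close>.\<close>

function xw :: "nat \<Rightarrow> nat" where
  "xw n = (if n < 75019 \<or> (n - 75019) mod 353 < 352 then val (ltr n) else xw ((n - 75019) div 353))"
  by auto
termination
proof (relation "measure id")
  fix n :: nat assume "\<not> (n < 75019 \<or> (n - 75019) mod 353 < 352)"
  then have "75019 \<le> n" by simp
  moreover have "(n - 75019) div 353 \<le> n - 75019" by (rule div_le_dividend)
  ultimately show "((n - 75019) div 353, n) \<in> measure id" by simp
qed simp

declare xw.simps [simp del]

lemma xw_prefix: "n < 75019 \<Longrightarrow> xw n = val (ltr n)"
  by (subst xw.simps) simp

lemma ltr_block: "r < 353 \<Longrightarrow> ltr (75019 + 353 * j + r) = concat pu ! r"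
  using word_at_steady[of "353 * j + r"] by (simp add: ltr_def add.assoc)

lemma xw_block:
  "r < 352 \<Longrightarrow> xw (75019 + 353 * j + r) = val (concat pu ! r)"
  "xw (75019 + 353 * j + 352) = xw j"
proof -
  show "xw (75019 + 353 * j + r) = val (concat pu ! r)" if "r < 352"
    using that ltr_block[of r j] by (subst xw.simps) simp
  have "(75019 + 353 * j + 352 - 75019) div 353 = j" "(75019 + 353 * j + 352 - 75019) mod 353 = 352"
    by simp_all
  then show "xw (75019 + 353 * j + 352) = xw j"
    by (subst xw.simps) (simp only: , simp)
qed

lemma steady_cases:
  fixes n :: nat
  assumes "75019 \<le> n"
  obtains j r where "n = 75019 + 353 * j + r" "r < 352" | j where "n = 75019 + 353 * j + 352"
      "j < n"
proof -
  define j r where "j = (n - 75019) div 353" and "r = (n - 75019) mod 353"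
  have "n - 75019 = 353 * j + r" by (simp add: j_def r_def)
  then have n: "n = 75019 + 353 * j + r" using assms by linarith
  have "r < 353" by (simp add: r_def)
  then consider "r < 352" | "r = 352" by linarith
  then show thesis
  proof cases
    case 1 then show thesis using that(1) n by blast
  next
    case 2 then show thesis using that(2)[of j] n by simp
  qed
qed

lemma val_le: "val a \<le> 2"
  by (cases a) simp_all

lemma xw_le: "xw n \<le> 2"
proof (induction n rule: less_induct)
  case (less n)
  show ?case
  proof (cases "n < 75019")
    case True then show ?thesis by (simp add: xw_prefix val_le)
  next
    case False
    then have "75019 \<le> n" by simp
    then show ?thesis
    proof (cases rule: steady_cases)
      case (1 j r) then show ?thesis by (simp only: xw_block val_le)
    next
      case (2 j) then show ?thesis using less[of j] by (simp only: xw_block)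
    qed
  qed
qed

fun no_wild :: "nat \<times> nat \<times> sym list list \<times> nat \<times> nat \<Rightarrow> bool" where
  "no_wild (s, b, cs, k, n) = list_all (list_all (\<lambda>a. a \<noteq> W)) cs"

lemma ltr_not_W:
  assumes "n < 75019"
  shows "ltr n \<noteq> W"
proof -
  from assms obtain s b cs k where p: "(s, b, cs, k) \<in> set positions" "s \<le> n"
    "n < s + k * length (concat cs)"
    "word_at n = (b + (n - s) mod length (concat cs), concat cs ! ((n - s) mod length (concat cs)))"
    by (rule word_at_prefix)
  have "list_all no_wild positions_length"
    by (simp add: positions_length_eval chunk_defs)
  then have "no_wild (s, b, cs, k, length (concat cs))"
    using p(1) unfolding list_all_iff positions_length_def by force
  then have "\<forall>a \<in> set (concat cs). a \<noteq> W" by (auto simp: list_all_iff)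
  moreover have "0 < length (concat cs)" using p(2,3) by (metis add_0_right leD mult_0_right not_gr_zero)
  then have "concat cs ! ((n - s) mod length (concat cs)) \<in> set (concat cs)"
    by (intro nth_mem mod_less_divisor)
  ultimately have "concat cs ! ((n - s) mod length (concat cs)) \<noteq> W" by blast
  then show ?thesis unfolding ltr_def p(4) snd_conv .
qed

lemma um_eq_W: "um a = W \<longleftrightarrow> a = W"
  by (cases a) simp_all

lemma steady_letters: "r < 352 \<Longrightarrow> concat pu ! r \<noteq> W" "concat pu ! 352 = W"
proof -
  have e: "concat pu = (pu1 @ pu2) @ [W]" by (simp add: pu_def pu3_def)
  have "\<forall>a \<in> set (pu1 @ pu2). a \<noteq> W" by (simp add: pu1_def pu2_def)
  moreover have l: "length (pu1 @ pu2) = 352" by (simp add: chunk_length)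
  ultimately show "concat pu ! r \<noteq> W" if "r < 352"
    using that nth_mem[of r "pu1 @ pu2"] unfolding e nth_append[of "pu1 @ pu2"] by metis
  show "concat pu ! 352 = W" unfolding e by (subst nth_append) (simp only: l less_irrefl if_False diff_self_eq_0 nth_Cons_0)
qed

text \<open>Makes the checks applicable: what they establish for all values of \<open>W\<close>
  holds for \<open>xw\<close>.\<close>

lemma agrees_xw: "agrees (ltr n) (xw n)"
proof (cases "n < 75019")
  case True
  then show ?thesis using ltr_not_W[of n] by (simp add: agrees_def um_eq_W xw_prefix)
next
  case False
  then have "75019 \<le> n" by simp
  then show ?thesis
  proof (cases rule: steady_cases)
    case (1 j r)
    then show ?thesis using steady_letters(1)[of r]
      by (simp add: agrees_def um_eq_W xw_block ltr_block)
  next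
    case (2 j)
    have "ltr n = W" using ltr_block[of 352 j] steady_letters(2) 2 by simp
    then show ?thesis by (simp add: agrees_def xw_le)
  qed
qed

section \<open>Freeness for \<open>m < 20\<close>\<close>

section \<open>Powers of small period\<close>

definition repeats :: "nat \<Rightarrow> nat \<Rightarrow> bool" where
  "repeats m i \<longleftrightarrow> (\<forall>k<4 * m. xw (i + k) = xw (i + 23 * m + k))"

lemma small_windows:
  assumes "0 < m" "m < 20"
  shows "all_windows (27 * m) (\<lambda>x. \<exists>k<4 * m. mis (x ! k) (x ! (23 * m + k)))
    (map snd ([(0, I)] @ segments_word reduced))"
proof -
  let ?w = "[I] # map snd (stream reduced)"
  have "m \<in> set [1..<20]" using assms by simp
  then have "(23 * m, 4 * m - 1) \<in> set (map (\<lambda>m. (23 * m, 4 * m - 1)) [1..<20])" by auto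
  moreover have "map (\<lambda>m. (23 * m, 4 * m - 1)) [1..<20] =
    [(23, 3), (46, 7), (69, 11), (92, 15), (115, 19), (138, 23), (161, 27), (184, 31), (207, 35),
     (230, 39), (253, 43), (276, 47), (299, 51), (322, 55), (345, 59), (368, 63), (391, 67),
     (414, 71), (437, 75)]"
    by (simp add: upt_rec)
  ultimately have "(23 * m, 4 * m - 1) \<in> set [(23, 3), (46, 7), (69, 11), (92, 15), (115, 19),
      (138, 23), (161, 27), (184, 31), (207, 35), (230, 39), (253, 43), (276, 47), (299, 51),
      (322, 55), (345, 59), (368, 63), (391, 67), (414, 71), (437, 75)]"
    by (simp only:)
  from bspec[OF chk_reduced[unfolded list_all_iff] this]
  have "chk_skip (23 * m) (4 * m - 1) ?w [] ?w" by (simp only: prod.case)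
  then have "chk (4 * m - 1) (4 * m - 1) (concat ?w) (drop (23 * m) (concat ?w))"
    by (simp add: chk_skip_def)
  from chk_all_windows[OF this assms(1)] show ?thesis
    by (simp add: map_snd_segments_word)
qed

text \<open>Indices are shifted by one, the additional place in front being taken by the fictitious
  letter 1.\<close>

lemma small_window:
  assumes "0 < m" "m < 20"
  shows "\<exists>k<4 * m. mis (if i + k = 0 then I else ltr (i + k - 1))
    (ltr (i + 23 * m + k - 1))"
proof -
  have "all_windows (27 * m) (\<lambda>x. \<exists>k<4 * m. mis (map snd x ! k) (map snd x ! (23 * m + k)))
      ([(0, I)] @ segments_word reduced)"
    using small_windows[OF assms] by (simp only: all_windows_map)
  moreover have "27 * m \<le> 513" using assms by simp
  ultimately have "\<exists>k<4 * m.
      mis (map snd (map (\<lambda>j. if j < length [(0::nat, I)] then [(0, I)] ! j else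
        word_at (j - length [(0::nat, I)])) [i..<i + 27 * m]) ! k)
      (map snd (map (\<lambda>j. if j < length [(0::nat, I)] then [(0, I)] ! j else
        word_at (j - length [(0::nat, I)])) [i..<i + 27 * m]) ! (23 * m + k))"
    by (rule window_index)
  then obtain k where k: "k < 4 * m"
    "mis (snd (if i + k < 1 then [(0, I)] ! (i + k) else word_at (i + k - 1)))
      (snd (if i + (23 * m + k) < 1 then [(0, I)] ! (i + (23 * m + k)) else
        word_at (i + (23 * m + k) - 1)))"
    by (auto cong: if_cong)
  then show ?thesis using assms
    by (intro exI[of _ k]) (cases "i + k", auto simp: ltr_def add.assoc split: if_splits)
qed

lemma not_repeats_small:
  assumes "0 < m" "m < 20"
  shows "\<not> repeats m i"
proof -
  obtain k where "k < 4 * m" "mis (ltr (i + k)) (ltr (i + 23 * m + k))"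
    using small_window[OF assms, of "Suc i"] by auto
  then show ?thesis using mis_agrees agrees_xw unfolding repeats_def by blast
qed

text \<open>
  Excludes repetitions that start at the last letter of the aperiodic part, which is \<open>1\<close>.
\<close>

lemma not_repeats_prefix_small:
  assumes "0 < m" "m < 20" "xw (23 * m - 1) = 1"
  shows "\<exists>k<4 * m - 1. xw k \<noteq> xw (23 * m + k)"
proof -
  obtain k where k: "k < 4 * m" "mis (if k = 0 then I else ltr (k - 1)) (ltr (23 * m + k - 1))"
    using small_window[OF assms(1,2), of 0] unfolding add_0 by blast
  show ?thesis
  proof (cases k)
    case 0
    then have "mis I (ltr (23 * m - 1))" using k by simp
    moreover have "agrees I 1" by (simp add: agrees_def)
    ultimately have "1 \<noteq> xw (23 * m - 1)" by (rule mis_agrees) (rule agrees_xw)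
    then show ?thesis using assms(3) by simp
  next
    case (Suc l)
    then have "mis (ltr l) (ltr (23 * m + l))" using k by simp
    then show ?thesis using mis_agrees agrees_xw k Suc by (intro exI[of _ l]) auto
  qed
qed

text \<open>Freeness for \<open>m = 1\<close> yields two differing letters in the window, and one of
  them is nonzero.\<close>

lemma nonzero_in_window:
  obtains q where "i \<le> q" "q \<le> i + 26" "xw q \<noteq> 0"
proof -
  obtain k where "k < 4" "xw (i + k) \<noteq> xw (i + 23 + k)"
    using not_repeats_small[of 1 i] by (auto simp: repeats_def)
  then show thesis using that[of "i + k"] that[of "i + 23 + k"] by (cases "xw (i + k) = 0") auto
qed

section \<open>Leastness\<close>

section \<open>Letters forced by powers\<close>

text \<open>Writing \<open>c\<close> at \<open>n\<close> after the first \<open>n\<close> letters of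
  \<open>xw\<close> would complete a 27/23-power. The condition \<open>27 * m \<le> n + 1\<close>
  keeps all subtractions exact.\<close>

definition forced :: "nat \<Rightarrow> nat \<Rightarrow> bool" where
  "forced n c \<longleftrightarrow> (\<exists>m>0. 27 * m \<le> n + 1 \<and> xw (n - 23 * m) = c \<and>
    (\<forall>t<4 * m - 1. xw (n - 1 - t) = xw (n - 1 - t - 23 * m)))"

lemma minimal_window:
  "minimal (ltr n) (rev (map (\<lambda>j. if j < 80 then W else ltr (j - 80)) [n..<n + 80]))"
proof -
  define u where "u = replicate 80 (0 :: nat, W)"
  have u: "length u = 80" "map snd u = replicate 80 W" "\<And>j. j < 80 \<Longrightarrow> u ! j = (0, W)"
    by (simp_all add: u_def)
  let ?Q = "\<lambda>x. minimal (x ! 80) (rev (take 80 x))"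
  let ?f = "\<lambda>j. if j < 80 then W else ltr (j - 80)"
  have "all_windows 81 ?Q (map snd (u @ segments_word reduced))"
    using all_minimal_windows[OF all_minimal_reduced]
    by (simp only: map_append u map_snd_segments_word)
  then have "all_windows 81 (\<lambda>x. ?Q (map snd x)) (u @ segments_word reduced)"
    by (simp only: all_windows_map)
  moreover have "(81 :: nat) \<le> 513" by simp
  ultimately have *: "?Q (map snd (map (\<lambda>j. if j < length u then u ! j else word_at (j - length u))
      [n..<n + 81]))"
    by (rule window_index)
  have "map snd (map (\<lambda>j. if j < length u then u ! j else word_at (j - length u)) [n..<n + 81]) =
      map ?f [n..<n + 81]"
    unfolding map_map u(1) by (rule map_cong[OF refl]) (simp add: u(3) ltr_def)
  moreover have "[n..<n + 81] = [n..<n + 80] @ [n + 80]"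
  proof -
    have "n + 81 = Suc (n + 80)" by simp
    then show ?thesis by (simp only: upt_Suc_append le_add1)
  qed
  moreover have "?f (n + 80) = ltr n" by simp
  ultimately have e: "map snd (map (\<lambda>j. if j < length u then u ! j else word_at (j - length u))
      [n..<n + 81]) = map ?f [n..<n + 80] @ [ltr n]"
    by (simp only: map_append list.map)
  have q: "(xs @ [a]) ! 80 = a \<and> take 80 (xs @ [a]) = xs" if "length xs = 80" for xs and a :: sym
    using that nth_append_length[of xs a "[]"] by simp
  have "length (map ?f [n..<n + 80]) = 80" by simp
  with * show ?thesis unfolding e by (simp only: q)
qed

lemma nth_rev_map_upt: "t < k \<Longrightarrow> rev (map f [n..<n + k]) ! t = f (n + (k - Suc t))"
  by (simp add: rev_nth)

definition history :: "nat \<Rightarrow> sym list" where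
  "history n = rev (map (\<lambda>j. if j < 80 then W else ltr (j - 80)) [n..<n + 80])"

lemma nth_history: "t < 80 \<Longrightarrow> history n ! t = (if n \<le> t then W else ltr (n - 1 - t))"
proof -
  assume t: "t < 80"
  define j where "j = 80 - Suc t"
  have "history n ! t = (if n + j < 80 then W else ltr (n + j - 80))"
    unfolding j_def history_def by (rule nth_rev_map_upt[OF t])
  moreover have "n + j < 80 \<longleftrightarrow> n \<le> t" "n + j - 80 = n - 1 - t"
    using t unfolding j_def by linarith+
  ultimately show ?thesis by (simp only:)
qed

lemma forbids_forced:
  assumes "forbids m s (history n)" "0 < m" "m \<le> 3"
  shows "forced n (val s)"
proof -
  have a: "eqs (history n ! (23 * m - 1)) s"
    "\<And>t. t < 4 * m - 1 \<Longrightarrow> eqs (history n ! t) (history n ! (23 * m + t))"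
    using assms(1) unfolding forbids_iff[OF assms(2)] by blast+
  have b: "23 * m - 1 < 80" "27 * m \<le> 81" using assms(3) by simp_all
  have "eqs (if n \<le> 23 * m - 1 then W else ltr (n - 1 - (23 * m - 1))) s"
    using a(1) unfolding nth_history[OF b(1)] .
  then have c: "23 * m - 1 < n" "eqs (ltr (n - 23 * m)) s"
    using assms(2) by (auto simp: eqs_def split: if_splits)
  have d: "23 * m + t < n \<and> eqs (ltr (n - 1 - t)) (ltr (n - 1 - t - 23 * m))" if t: "t < 4 * m - 1" for t
  proof -
    have 80: "t < 80" "23 * m + t < 80" using t b by linarith+
    have "eqs (if n \<le> t then W else ltr (n - 1 - t))
        (if n \<le> 23 * m + t then W else ltr (n - 1 - (23 * m + t)))"
      using a(2)[OF t] unfolding nth_history[OF 80(1)] nth_history[OF 80(2)] .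
    moreover have "n - 1 - (23 * m + t) = n - 1 - t - 23 * m" by simp
    ultimately show ?thesis by (auto simp: eqs_def split: if_splits)
  qed
  have "23 * m + (4 * m - 2) < n" using d[of "4 * m - 2"] assms(2) by simp
  then have "27 * m \<le> n + 1" using assms(2) by simp
  moreover have "xw (n - 23 * m) = val s"
  proof -
    have "agrees s (val s)" using c(2) by (auto simp: agrees_def eqs_def)
    from eqs_agrees[OF c(2) agrees_xw this] show ?thesis .
  qed
  moreover have "\<forall>t<4 * m - 1. xw (n - 1 - t) = xw (n - 1 - t - 23 * m)"
    using d eqs_agrees agrees_xw by blast
  ultimately show ?thesis using assms(2) unfolding forced_def by blast
qed

lemma forbidden_forced: "forbidden s (history n) \<Longrightarrow> forced n (val s)"
  using forbids_forced[of 1 s n] forbids_forced[of 2 s n] forbids_forced[of 3 s n]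
  unfolding forbidden_def by auto

lemma forced_ltr:
  "ltr n = I \<Longrightarrow> forced n 0" "ltr n = D \<Longrightarrow> forced n 0" "ltr n = D \<Longrightarrow> forced n 1"
  "ltr n = E \<Longrightarrow> forced n 0"
  using minimal_window[of n, folded history_def] forbidden_forced[of Z n] forbidden_forced[of I n]
  by simp_all

definition j_marks :: "nat list" where
  "j_marks = [19558, 19770, 23841, 29887, 31334, 31587, 62323, 66637, 74817]"

definition e_marks :: "nat list" where
  "e_marks = [18089, 18874, 70814]"

text \<open>Marks occur only at the beginning of a segment.\<close>

fun marks_ok :: "nat \<times> nat \<times> sym list list \<times> nat \<times> nat \<Rightarrow> bool" where
  "marks_ok (s, b, c # cs, k, n) \<longleftrightarrow> c \<noteq> [] \<and>
    list_all (list_all (\<lambda>a. a \<noteq> J \<and> a \<noteq> E)) (tl c # cs) \<and>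
    (hd c = J \<longrightarrow> s \<in> set j_marks \<and> k = 1) \<and> (hd c = E \<longrightarrow> s \<in> set e_marks \<and> k = 1)"
| "marks_ok (s, b, [], k, n) \<longleftrightarrow> True"

lemma ltr_marks:
  assumes "n < 75019"
  shows "ltr n = J \<Longrightarrow> n \<in> set j_marks" and "ltr n = E \<Longrightarrow> n \<in> set e_marks"
proof -
  from assms obtain s b cs k where p: "(s, b, cs, k) \<in> set positions" "s \<le> n"
    "n < s + k * length (concat cs)"
    "word_at n = (b + (n - s) mod length (concat cs), concat cs ! ((n - s) mod length (concat cs)))"
    by (rule word_at_prefix)
  let ?i = "(n - s) mod length (concat cs)"
  have "list_all marks_ok positions_length"
    by (simp add: positions_length_eval chunk_defs j_marks_def e_marks_def)
  then have ok: "marks_ok (s, b, cs, k, length (concat cs))"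
    using p(1) unfolding list_all_iff positions_length_def by force
  have "0 < length (concat cs)" using p(2,3) by (metis add_0_right leD mult_0_right not_gr_zero)
  then have i: "?i < length (concat cs)" by simp
  then obtain c cs' where cs: "cs = c # cs'" by (cases cs) auto
  have "c \<noteq> []" using ok cs by simp
  then obtain a w where c: "c = a # w" by (cases c) auto
  have l: "ltr n = (a # w @ concat cs') ! ?i" using p(4) by (simp add: ltr_def cs c)
  have i': "?i < length (a # w @ concat cs')" using i by (simp add: cs c)
  have plain: "\<forall>x \<in> set (w @ concat cs'). x \<noteq> J \<and> x \<noteq> E"
    using ok by (auto simp: cs c list_all_iff)
  have *: "?i = 0 \<and> k = 1 \<and> ltr n = a" if "ltr n = J \<or> ltr n = E"
  proof -
    have "?i = 0"
    proof (rule ccontr)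
      assume "?i \<noteq> 0"
      then obtain j where j: "?i = Suc j" by (cases ?i) auto
      then have "ltr n = (w @ concat cs') ! j" "j < length (w @ concat cs')"
        using l i' by simp_all
      then show False using plain that nth_mem by metis
    qed
    then have "ltr n = a" using l by simp
    then show ?thesis using \<open>?i = 0\<close> ok that by (auto simp: cs c)
  qed
  have **: "n = s" if "ltr n = J \<or> ltr n = E"
    using *[OF that] p(2,3) by auto
  show "n \<in> set j_marks" if "ltr n = J"
    using * ** ok that by (simp add: cs c)
  show "n \<in> set e_marks" if "ltr n = E"
    using * ** ok that by (simp add: cs c)
qed

text \<open>The two ends of the power, of length \<open>4 * m\<close> each, lie in stretches of the
  same cycle, possibly in the same stretch, and the congruence puts them in the same phase. So the
  letter with which the cycle would go on at \<open>n\<close> completes the power.\<close>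

lemma forced_periodic:
  assumes P: "periodic_letters P d' s' e'" "periodic_letters P d s n" "length (concat P) = p"
    and m: "(23 * m + d) mod p = d' mod p" "0 < m"
    and n: "s' + 27 * m \<le> n + 1" "n < e' + 23 * m" "s + 4 * m \<le> n + 1" "n < 75019"
    and c: "val (concat P ! ((n - 23 * m + d') mod p)) = c"
  shows "forced n c"
proof -
  have v: "xw q = val (concat P ! ((q + d') mod p))" if "s' \<le> q" "q < e'" "q < 75019" for q
  proof -
    have "um (ltr q) = um (concat P ! ((q + d') mod p))"
      using P(1) that unfolding periodic_letters_def P(3) by blast
    then show ?thesis using xw_prefix[OF that(3)] by (metis val_um)
  qed
  have w: "xw q = val (concat P ! ((q + d) mod p))" if "s \<le> q" "q < n" for q
  proof -
    have "um (ltr q) = um (concat P ! ((q + d) mod p))"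
      using P(2) that unfolding periodic_letters_def P(3) by blast
    then show ?thesis using xw_prefix[of q] that n(4) by (metis order_less_trans val_um)
  qed
  have "xw (n - 1 - t) = xw (n - 1 - t - 23 * m)" if t: "t < 4 * m - 1" for t
  proof -
    define q where "q = n - 1 - t - 23 * m"
    have q: "n - 1 - t = q + 23 * m" using t n(1) unfolding q_def by linarith
    have "s' \<le> q" "q < e'" "q < 75019" using t n unfolding q_def by linarith+
    then have "xw q = val (concat P ! ((q + d') mod p))" by (rule v)
    moreover have "s \<le> n - 1 - t" "n - 1 - t < n" using t n m(2) by linarith+
    then have "xw (n - 1 - t) = val (concat P ! ((n - 1 - t + d) mod p))" by (rule w)
    moreover have "(n - 1 - t + d) mod p = (q + d') mod p"
      unfolding q using m(1) by (metis add.assoc mod_add_right_eq)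
    ultimately show ?thesis unfolding q_def by simp
  qed
  moreover have "xw (n - 23 * m) = c"
    using v[of "n - 23 * m"] n c m(2) by auto
  ultimately show ?thesis unfolding forced_def using m(2) n(1) by (intro exI[of _ m]) auto
qed

lemma period_nth:
  "concat pa ! 667 = I"
  "concat pa ! 191 = I"
  "concat pa ! 207 = Z"
  "concat pa ! 5 = Z"
  "concat pb ! 150 = Z"
  "concat pb ! 85 = Z"
  "concat pc ! 223 = Z"
  "concat pd ! 1137 = Z"
  "concat pd ! 1080 = Z"
  "concat pe ! 150 = Z"
  "concat pf ! 150 = I"
  "concat px ! 15 = Z"
  by (simp_all add: pa_def pb_def pc_def pd_def pe_def pf_def px_def nth_append chunk_length,
      simp_all add: chunk_defs)

text \<open>The last number in each rule instance is \<open>m\<close>. Between two stretches it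
  solves the congruence of their phases. Within one stretch it is the period, and the power then
  begins exactly where the cycle was entered, so such a run is stopped at the first full power of
  its period.\<close>

lemma forced_marks:
  shows "forced 18089 1"
    and "forced 18874 1"
    and "forced 19558 0"
    and "forced 19770 0"
    and "forced 23841 0"
    and "forced 29887 0"
    and "forced 31334 0"
    and "forced 31587 0"
    and "forced 62323 0"
    and "forced 66637 0"
    and "forced 70814 1"
    and "forced 74817 0"
proof -
  show "forced 18089 1"
    by (rule forced_periodic[OF letter_stretches(1) letter_stretches(1) period_length(1), of 668])
      (simp_all add: period_nth)
  show "forced 18874 1"
    by (rule forced_periodic[OF letter_stretches(1) letter_stretches(2) period_length(1), of 171])
      (simp_all add: period_nth)
  show "forced 19558 0"
    by (rule forced_periodic[OF letter_stretches(1) letter_stretches(3) period_length(1), of 171])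
      (simp_all add: period_nth)
  show "forced 19770 0"
    by (rule forced_periodic[OF letter_stretches(3) letter_stretches(11) period_length(1), of 18])
      (simp_all add: period_nth)
  show "forced 23841 0"
    by (rule forced_periodic[OF letter_stretches(4) letter_stretches(4) period_length(2), of 151])
      (simp_all add: period_nth)
  show "forced 29887 0"
    by (rule forced_periodic[OF letter_stretches(5) letter_stretches(5) period_length(3), of 224])
      (simp_all add: period_nth)
  show "forced 31334 0"
    by (rule forced_periodic[OF letter_stretches(4) letter_stretches(6) period_length(2), of 368])
      (simp_all add: period_nth)
  \<comment> \<open>\<open>px\<close> is not a cycle of the rule: its 16 letters form the two ends
    of a power with \<open>m = 4\<close>, just beyond the reach of the rule.\<close>
  show "forced 31587 0"
    by (rule forced_periodic[OF letter_stretches(12) letter_stretches(13) period_length(7), of 4])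
      (simp_all add: period_nth)
  show "forced 62323 0"
    by (rule forced_periodic[OF letter_stretches(7) letter_stretches(7) period_length(4), of 1138])
      (simp_all add: period_nth)
  show "forced 66637 0"
    by (rule forced_periodic[OF letter_stretches(8) letter_stretches(8) period_length(5), of 151])
      (simp_all add: period_nth)
  show "forced 70814 1"
    by (rule forced_periodic[OF letter_stretches(9) letter_stretches(9) period_length(6), of 151])
      (simp_all add: period_nth)
  show "forced 74817 0"
    by (rule forced_periodic[OF letter_stretches(7) letter_stretches(10) period_length(4), of 991])
      (simp_all add: period_nth)
qed

fun letter_at :: "nat \<Rightarrow> sym \<Rightarrow> nat \<times> nat \<times> sym list list \<times> nat \<times> nat \<Rightarrow> bool" where
  "letter_at q a (s, b, cs, k, n) =
    (if outside q (Suc q) s k n then True else concat cs ! ((q - s) mod n) = a)"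

lemma letter_at_D:
  assumes "list_all (letter_at q a) positions_length" "q < 75019"
  shows "ltr q = a"
proof -
  from assms(2) obtain s b cs k where p: "(s, b, cs, k) \<in> set positions" "s \<le> q"
    "q < s + k * length (concat cs)"
    "word_at q = (b + (q - s) mod length (concat cs), concat cs ! ((q - s) mod length (concat cs)))"
    by (rule word_at_prefix)
  then have "letter_at q a (s, b, cs, k, length (concat cs))"
    using assms(1) unfolding list_all_iff positions_length_def by force
  with p show ?thesis by (simp add: outside_def ltr_def split: if_splits)
qed

lemma ltr_values:
  "ltr 0 = Z"
  "ltr 26 = I"
  "ltr 46 = I"
  "ltr 53 = Z"
  "ltr 2725 = I"
  "ltr 14941 = I"
  "ltr 15417 = I"
  "ltr 15625 = Z"
  "ltr 18043 = I"
  "ltr 18089 = E"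
  "ltr 18190 = D"
  "ltr 18823 = I"
  "ltr 18874 = E"
  "ltr 19507 = I"
  "ltr 19558 = J"
  "ltr 19698 = I"
  "ltr 19718 = I"
  "ltr 19764 = I"
  "ltr 20368 = Z"
  "ltr 22870 = Z"
  "ltr 23793 = I"
  "ltr 23839 = I"
  "ltr 23841 = J"
  "ltr 29835 = I"
  "ltr 29862 = I"
  "ltr 31289 = I"
  "ltr 31334 = J"
  "ltr 31597 = I"
  "ltr 36149 = Z"
  "ltr 52024 = Z"
  "ltr 62276 = I"
  "ltr 62323 = J"
  "ltr 62560 = I"
  "ltr 63164 = Z"
  "ltr 66587 = I"
  "ltr 66637 = J"
  "ltr 66730 = I"
  "ltr 66737 = Z"
  "ltr 67341 = I"
  "ltr 70210 = I"
  "ltr 70768 = I"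
  "ltr 70814 = E"
  "ltr 70853 = D"
  "ltr 74766 = I"
  "ltr 74817 = J"
  "ltr 75012 = I"
  "ltr 75017 = Z"
  "ltr 75018 = I"
  by (rule letter_at_D, simp add: positions_length_eval outside_def nth_append chunk_length,
      (simp add: chunk_defs)?, simp)+

text \<open>A power ending at position \<open>j\<close> is carried by the morphism to one ending at the last letter of
  the \<open>j\<close>-th block.\<close>

lemma forced_block:
  assumes "forced j c"
  shows "forced (75019 + 353 * j + 352) c"
proof -
  obtain m where m: "0 < m" "27 * m \<le> j + 1" "xw (j - 23 * m) = c"
    "\<And>t. t < 4 * m - 1 \<Longrightarrow> xw (j - 1 - t) = xw (j - 1 - t - 23 * m)"
    using assms unfolding forced_def by blast
  let ?n = "75019 + 353 * j + 352" and ?m = "353 * m"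
  have "27 * ?m \<le> ?n + 1" using m(2) by linarith
  moreover have "?n - 23 * ?m = 75019 + 353 * (j - 23 * m) + 352" using m(2) by linarith
  then have "xw (?n - 23 * ?m) = c" using xw_block(2)[of "j - 23 * m"] m(3) by simp
  moreover have "xw (?n - 1 - t) = xw (?n - 1 - t - 23 * ?m)" if t: "t < 4 * ?m - 1" for t
  proof -
    \<comment> \<open>The position is split into block \<open>j - h\<close> and column
      \<open>352 - g\<close>. For \<open>g = 0\<close> it is the end of a block, where the power for
      \<open>m\<close> applies; in the other columns both letters come from
      \<open>u\<close>.\<close>
    define h g where "h = (t + 1) div 353" and "g = (t + 1) mod 353"
    have hg: "t + 1 = 353 * h + g" "g < 353" by (simp_all add: h_def g_def)
    then have h: "h \<le> 4 * m - 1" using t m(1) by linarith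
    have e: "?n - 1 - t = 75019 + 353 * (j - h) + (352 - g)"
      "?n - 1 - t - 23 * ?m = 75019 + 353 * (j - h - 23 * m) + (352 - g)"
      using hg h m(1,2) by linarith+
    have "xw (75019 + 353 * (j - h) + (352 - g)) = xw (75019 + 353 * (j - h - 23 * m) + (352 - g))"
    proof (cases "g = 0")
      case True
      then have "0 < h" using hg by simp
      then have "xw (j - h) = xw (j - h - 23 * m)" using m(4)[of "h - 1"] h by simp
      then show ?thesis unfolding True diff_zero xw_block .
    next
      case False
      then have "352 - g < 352" by simp
      then show ?thesis by (simp only: xw_block)
    qed
    with e show ?thesis by (simp only:)
  qed
  ultimately show ?thesis unfolding forced_def using m(1) by (intro exI[of _ ?m]) auto
qed

lemma steady_unmarked: "r < 352 \<Longrightarrow> concat pu ! r \<in> {Z, I, D}"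
proof -
  assume r: "r < 352"
  have e: "concat pu = (pu1 @ pu2) @ [W]" by (simp add: pu_def pu3_def)
  have "\<forall>a \<in> set (pu1 @ pu2). a \<in> {Z, I, D}" by (simp add: pu1_def pu2_def)
  moreover have "length (pu1 @ pu2) = 352" by (simp add: chunk_length)
  ultimately show ?thesis
    using r nth_mem[of r "pu1 @ pu2"] unfolding e nth_append[of "pu1 @ pu2"] by metis
qed

text \<open>Leastness in local form. The induction hypothesis is used at the ends of blocks, where
  the forcing power is inflated from a shorter prefix.\<close>

lemma forced_less:
  assumes "c < xw n"
  shows "forced n c"
  using assms
proof (induction n rule: less_induct)
  case (less n)
  have zid: "forced n c" if h: "ltr n \<in> {Z, I, D}" "xw n = val (ltr n)"
  proof -
    consider "ltr n = Z" | "ltr n = I" | "ltr n = D" using h(1) by auto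
    then show ?thesis
    proof cases
      case 1 then show ?thesis using less.prems h(2) by simp
    next
      case 2 then show ?thesis using less.prems h(2) forced_ltr(1) by simp
    next
      case 3
      then have "c = 0 \<or> c = 1" using less.prems h(2) by auto
      then show ?thesis using 3 forced_ltr(2,3) by auto
    qed
  qed
  show ?case
  proof (cases "n < 75019")
    case True
    note x = xw_prefix[OF True]
    consider "ltr n \<in> {Z, I, D}" | "ltr n = J" | "ltr n = E"
      using ltr_not_W[OF True] by (cases "ltr n") auto
    then show ?thesis
    proof cases
      case 1 then show ?thesis using zid x by blast
    next
      case 2
      then have "c = 0" using less.prems x by simp
      moreover have "n \<in> set j_marks" using ltr_marks(1)[OF True 2] .
      ultimately show ?thesis using forced_marks by (auto simp: j_marks_def)
    next
      case 3
      then have "c = 0 \<or> c = 1" using less.prems x by auto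
      moreover have "n \<in> set e_marks" using ltr_marks(2)[OF True 3] .
      then have "forced n 1" using forced_marks by (auto simp: e_marks_def)
      ultimately show ?thesis using forced_ltr(4)[OF 3] by auto
    qed
  next
    case False
    then have "75019 \<le> n" by simp
    then show ?thesis
    proof (cases rule: steady_cases)
      case (1 j r)
      have "ltr n = concat pu ! r" unfolding 1(1) using 1(2) by (intro ltr_block) simp
      moreover have "xw n = val (concat pu ! r)" unfolding 1(1) using 1(2) by (rule xw_block)
      ultimately show ?thesis using zid steady_unmarked[OF 1(2)] by simp
    next
      case (2 j)
      have "xw n = xw j" unfolding 2(1) by (rule xw_block)
      then have "forced j c" using less.IH[OF 2(2)] less.prems by simp
      then show ?thesis unfolding 2(1) by (rule forced_block)
    qed
  qed
qed

lemma xw_values: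
  "xw 53 \<noteq> xw 15417" "xw 2725 \<noteq> xw 18089" "xw 14941 \<noteq> xw 18874" "xw 15625 \<noteq> xw 19558"
  "xw 20368 \<noteq> xw 23841" "xw 22870 \<noteq> xw 31334" "xw 36149 \<noteq> xw 62323" "xw 52024 \<noteq> xw 74817"
  "xw 63164 \<noteq> xw 66637" "xw 66737 \<noteq> xw 70210" "xw 67341 \<noteq> xw 70814"
  "xw 75017 = 0" "xw 75018 = 1" "xw 0 = 0"
  by (simp_all add: xw_prefix ltr_values)

section \<open>Freeness for \<open>m \<ge> 20\<close>\<close>

section \<open>Powers of large period\<close>

lemma located_window:
  "located one_tree two_tree (ltr q) (map ltr [Suc q..<q + 53]) (lab q)"
proof -
  have "all_windows 53 (\<lambda>x. located one_tree two_tree (snd (x ! 0)) (map snd (tl x)) (fst (x ! 0)))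
      ([] @ segments_word reduced)"
    using all_located_windows[OF all_located_reduced, of 53]
    by (simp add: segments_word_stream)
  moreover have "(53 :: nat) \<le> 513" by simp
  ultimately have *: "located one_tree two_tree (snd (w ! 0)) (map snd (tl w)) (fst (w ! 0))"
    if "w = map (\<lambda>j. if j < length ([] :: (nat \<times> sym) list) then [] ! j else
      word_at (j - length ([] :: (nat \<times> sym) list))) [q..<q + 53]" for w
    unfolding that by (rule window_index)
  have "word_at q # map word_at [Suc q..<q + 53] =
      map (\<lambda>j. if j < length ([] :: (nat \<times> sym) list) then [] ! j else
        word_at (j - length ([] :: (nat \<times> sym) list))) [q..<q + 53]"
    by (simp add: upt_conv_Cons)
  from *[OF this] show ?thesis by (simp add: ltr_def[abs_def] lab_def o_def)
qed

lemma walk_lab: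
  assumes "xw q \<noteq> 0"
  shows "walk (if xw q = 1 then one_tree else two_tree) (map xw [Suc q..<q + 53]) = lab q"
proof -
  have "list_all2 agrees (map ltr [Suc q..<q + 53]) (map xw [Suc q..<q + 53])"
    by (simp add: list_all2_conv_all_nth agrees_xw)
  moreover have "length (map ltr [Suc q..<q + 53]) = 52" by simp
  ultimately have w: "walk t (map xw [Suc q..<q + 53]) = lab q"
    if "locates t (map ltr [Suc q..<q + 53]) (lab q)" "depth_le 52 t" for t
    using walk_locates[OF that(1)] that(2) by simp
  have "agrees (ltr q) (xw q)" by (rule agrees_xw)
  moreover have "xw q = 1 \<or> xw q = 2" using assms xw_le[of q] by linarith
  ultimately show ?thesis
    using located_window[of q] w[OF _ depth_trees(1)] w[OF _ depth_trees(2)] assms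
    by (cases "ltr q") (auto simp: agrees_def)
qed

text \<open>Both labels are computed by \<open>walk\<close> from the same 53 letters.\<close>

lemma lab_eq:
  assumes "xw q \<noteq> 0" "\<And>k. k < 53 \<Longrightarrow> xw (q + k) = xw (q' + k)"
  shows "lab q = lab q'"
proof -
  have "map xw [Suc q..<q + 53] = map xw [Suc q'..<q' + 53]"
  proof (rule nth_equalityI)
    fix k assume "k < length (map xw [Suc q..<q + 53])"
    then show "map xw [Suc q..<q + 53] ! k = map xw [Suc q'..<q' + 53] ! k"
      using assms(2)[of "Suc k"] by simp
  qed simp
  moreover have "xw q = xw q'" using assms(2)[of 0] by simp
  ultimately show ?thesis using walk_lab[OF assms(1)] walk_lab[of q'] assms(1) by simp
qed

definition literal :: "nat \<Rightarrow> bool" where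
  "literal q \<longleftrightarrow> (\<exists>(s, e) \<in> set literal_intervals. s \<le> q \<and> q < e)"

definition special :: "nat \<Rightarrow> bool" where
  "special q \<longleftrightarrow> xw q \<noteq> 0 \<and> literal q"

lemma literal_lab: "literal q \<Longrightarrow> lab q = q"
  using literal_label by (auto simp: literal_def)

lemma between:
  fixes r :: nat
  shows "xs \<noteq> [] \<Longrightarrow> hd xs \<le> r \<Longrightarrow> r < last xs \<Longrightarrow> \<exists>(a, b) \<in> set (zip xs (tl xs)). a \<le> r \<and> r < b"
proof (induction xs)
  case (Cons x xs)
  then obtain y ys where xs: "xs = y # ys" by (cases xs) auto
  then show ?case using Cons by (cases "r < y") auto
qed simp

lemma periodic_labels_D:
  assumes "periodic_labels b P d s e" "length (concat P) = p" "s \<le> q" "q < e"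
  shows "lab q = b + (q + d) mod p"
  using assms unfolding periodic_labels_def by blast

lemmas stretch_lab =
  label_stretches(1)[THEN periodic_labels_D, OF period_length(1)]
  label_stretches(2)[THEN periodic_labels_D, OF period_length(1)]
  label_stretches(3)[THEN periodic_labels_D, OF period_length(1)]
  label_stretches(4)[THEN periodic_labels_D, OF period_length(2)]
  label_stretches(5)[THEN periodic_labels_D, OF period_length(3)]
  label_stretches(6)[THEN periodic_labels_D, OF period_length(2)]
  label_stretches(7)[THEN periodic_labels_D, OF period_length(4)]
  label_stretches(8)[THEN periodic_labels_D, OF period_length(5)]
  label_stretches(9)[THEN periodic_labels_D, OF period_length(6)]
  label_stretches(10)[THEN periodic_labels_D, OF period_length(4)]

text \<open>
  An entry \<open>(a, s, e, b, p, d)\<close> describes a periodic stretch \<open>[s, e)\<close> with labels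
  \<open>b + (q + d) mod p\<close>; the last nonzero letter before it is at \<open>a\<close>, and there is one at \<open>e\<close>.
\<close>

definition zones :: "(nat \<times> nat \<times> nat \<times> nat \<times> nat \<times> nat) list" where
  "zones = [
    (46, 54, 18043, 54, 668, 614),
    (18190, 18191, 18823, 54, 668, 21),
    (18874, 18875, 19507, 54, 668, 21),
    (19764, 19765, 23793, 19765, 151, 16),
    (23839, 23840, 29835, 23840, 224, 128),
    (29862, 29863, 31289, 19765, 151, 8),
    (31597, 31598, 62276, 31598, 1138, 266),
    (62560, 62561, 66587, 62561, 151, 104),
    (66730, 66738, 70768, 66738, 151, 4),
    (70853, 70854, 74766, 31598, 1138, 233)]"

lemma zones_label:
  assumes "(a, s, e, b, p, d) \<in> set zones" "s \<le> q" "q < e"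
  shows "lab q = b + (q + d) mod p"
proof -
  have "list_all (\<lambda>(a, s, e, b, p, d). \<forall>q. s \<le> q \<and> q < e \<longrightarrow> lab q = b + (q + d) mod p) zones"
    unfolding zones_def list.pred_inject prod.case
    by (intro conjI allI impI list.pred_inject(1); elim conjE; rule stretch_lab; assumption)
  then show ?thesis using assms by (auto simp: list_all_iff)
qed

definition bases :: "(nat \<times> nat) list" where
  "bases = [(54, 668), (19765, 151), (23840, 224), (31598, 1138), (62561, 151), (66738, 151)]"

lemma zones_bases: "(a, s, e, b, p, d) \<in> set zones \<Longrightarrow> (b, p) \<in> set bases"
  by (auto simp: zones_def bases_def)

lemma bases_pos: "(b, p) \<in> set bases \<Longrightarrow> 0 < p"
  by (auto simp: bases_def)

lemma label_cases:
  assumes "r < 75018"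
  shows "literal r \<or> (\<exists>(b, p) \<in> set bases. b \<le> lab r \<and> lab r < b + p)"
proof -
  define xs :: "nat list" where
    "xs = [0, 54, 18043, 18191, 18823, 18875, 19507, 19702, 19711, 19765, 23793, 23840, 29835,
      29863, 31289, 31598, 62276, 62561, 66587, 66738, 70768, 70854, 74766, 75018]"
  have "\<exists>(x, y) \<in> set (zip xs (tl xs)). x \<le> r \<and> r < y"
    using assms by (intro between) (simp_all add: xs_def)
  then obtain x y where xy: "(x, y) \<in> set (zip xs (tl xs))" "x \<le> r" "r < y" by blast
  have "list_all (\<lambda>(x, y). (x, y) \<in> set literal_intervals \<or> x = 19702 \<and> y = 19711 \<or>
      (x, y) \<in> set (map (\<lambda>(a, s, e, b, p, d). (s, e)) zones)) (zip xs (tl xs))"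
    by (simp add: xs_def literal_intervals_def zones_def)
  then consider "(x, y) \<in> set literal_intervals" | "x = 19702" "y = 19711" |
      "(x, y) \<in> set (map (\<lambda>(a, s, e, b, p, d). (s, e)) zones)"
    using xy(1) unfolding list_all_iff by blast
  then show ?thesis
  proof cases
    case 1
    then show ?thesis using xy unfolding literal_def by blast
  next
    case 2
    then have "lab r + 19043 = r" using irregular_label xy by simp
    then have "54 \<le> lab r \<and> lab r < 54 + 668" using 2 xy by linarith
    moreover have "(54, 668) \<in> set bases" by (simp add: bases_def)
    ultimately show ?thesis by blast
  next
    case 3
    then obtain a b p d where z: "(a, x, y, b, p, d) \<in> set zones" by auto
    then have "lab r = b + (r + d) mod p" "(b, p) \<in> set bases" "0 < p"
      using zones_label zones_bases bases_pos xy by blast+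
    then have "b \<le> lab r \<and> lab r < b + p" by simp
    then show ?thesis using \<open>(b, p) \<in> set bases\<close> by blast
  qed
qed

lemma bases_literal:
  assumes "(b, p) \<in> set bases" "b \<le> q" "q < b + p"
  shows "\<not> literal q"
proof -
  have "list_all (\<lambda>(b, p). list_all (\<lambda>(x, y). y \<le> b \<or> b + p \<le> x) literal_intervals) bases"
    by (simp add: bases_def literal_intervals_def)
  then have *: "y \<le> b \<or> b + p \<le> x" if "(x, y) \<in> set literal_intervals" for x y
    using assms(1) that unfolding list_all_iff by blast
  show ?thesis
  proof
    assume "literal q"
    then obtain x y where "(x, y) \<in> set literal_intervals" "x \<le> q" "q < y"
      by (auto simp: literal_def)
    then show False using *[of x y] assms(2,3) by linarith
  qed
qed

lemma literal_less: "literal q \<Longrightarrow> q < 75018"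
  by (auto simp: literal_def literal_intervals_def)

text \<open>Individual labels avoid the label ranges of the cycles and stay below those of the
  blocks. Consequently the starts whose 53 letters lie in a match, and their shifts by
  \<open>23 * m\<close>, are never special.\<close>

lemma special_unique:
  assumes "special q" "lab r = lab q"
  shows "r = q"
proof -
  have q: "literal q" using assms(1) by (simp add: special_def)
  then have l: "lab r = q" using literal_lab assms(2) by simp
  have "q < 75018" using literal_less[OF q] .
  then have "r < 75018" using l lab_steady[of r] by linarith
  from label_cases[OF this] show ?thesis
  proof
    assume "literal r"
    then show ?thesis using literal_lab l by simp
  next
    assume "\<exists>(b, p) \<in> set bases. b \<le> lab r \<and> lab r < b + p"
    then show ?thesis using bases_literal q unfolding l by blast
  qed
qed

text \<open>Any gap between \<open>a\<close> and \<open>s\<close> is labelled individually, so a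
  nonzero letter in it would be special.\<close>

lemma zone_label:
  assumes z: "(a, s, e, b, p, d) \<in> set zones" and q: "a < q" "q < e" "xw q \<noteq> 0" "\<not> special q"
  shows "lab q = b + (q + d) mod p"
proof -
  have "list_all (\<lambda>(a, s, e, b, p, d). s \<le> Suc a \<or>
      list_ex (\<lambda>(x, y). x \<le> a \<and> y = s) literal_intervals) zones"
    by (simp add: zones_def literal_intervals_def)
  then have "s \<le> Suc a \<or> (\<exists>(x, y) \<in> set literal_intervals. x \<le> a \<and> y = s)"
    using z unfolding list_all_iff list_ex_iff by blast
  moreover have "\<not> literal q" using q by (simp add: special_def)
  ultimately have "s \<le> q" using q(1) unfolding literal_def by fastforce
  then show ?thesis using zones_label[OF z] q(2) by blast
qed

text \<open>Special positions chosen so that two neighbours bound a zone, or enclose only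
  individually labelled positions, or are at most 28 apart.\<close>

definition landmarks :: "nat list" where
  "landmarks = [26, 46, 18043, 18190, 18823, 18874, 19507, 19698, 19718, 19764, 23793, 23839, 29835,
    29862, 31289, 31597, 62276, 62560, 66587, 66730, 70768, 70853, 74766, 75012]"

lemma special_landmark: "q \<in> set landmarks \<Longrightarrow> special q"
proof -
  assume q: "q \<in> set landmarks"
  have "list_all (\<lambda>q. xw q \<noteq> 0) landmarks"
    by (simp add: landmarks_def xw_prefix ltr_values)
  moreover have "list_all (\<lambda>q. list_ex (\<lambda>(x, y). x \<le> q \<and> q < y) literal_intervals) landmarks"
    by (simp add: landmarks_def literal_intervals_def)
  ultimately show ?thesis
    using q unfolding special_def literal_def list_all_iff list_ex_iff by blast
qed

text \<open>At least 28 positions do not fit strictly between landmarks at most 28 apart. They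
  contain a nonzero letter, which would be special between landmarks of one literal interval. Only
  zones remain.\<close>

lemma zone_of_window:
  assumes "\<And>q. i \<le> q \<Longrightarrow> q \<le> i + n \<Longrightarrow> \<not> special q" "27 \<le> n" "i \<le> 75012"
  shows "\<exists>(a, s, e, b, p, d) \<in> set zones. a < i \<and> i + n < e"
proof -
  have "special 26" by (rule special_landmark) (simp add: landmarks_def)
  then have "26 < i" using assms(1)[of 26] assms(2) by linarith
  then have "hd landmarks \<le> i - 1" "i - 1 < last landmarks" "landmarks \<noteq> []"
    using assms(3) by (simp_all add: landmarks_def)
  from between[OF this(3,1,2)] obtain a c where ac: "(a, c) \<in> set (zip landmarks (tl landmarks))"
    "a < i" "i \<le> c" using \<open>26 < i\<close> by auto
  have "c \<in> set landmarks" using set_zip_rightD[OF ac(1)] by (auto simp: landmarks_def)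
  then have "special c" by (rule special_landmark)
  then have c: "i + n < c" using assms(1)[of c] ac(3) by linarith
  obtain q where q: "i \<le> q" "q \<le> i + 26" "xw q \<noteq> 0" by (rule nonzero_in_window)
  then have "\<not> literal q" using assms(1)[of q] assms(2) by (simp add: special_def)
  moreover have "a < q" "q < c" "a + 28 < c" using q c assms(2) ac(2) by linarith+
  moreover have "list_all (\<lambda>(a, c). c \<le> a + 28 \<or>
      list_ex (\<lambda>(x, y). x \<le> a \<and> c \<le> y) literal_intervals \<or>
      (a, c) \<in> set (map (\<lambda>(a, s, e, b, p, d). (a, e)) zones)) (zip landmarks (tl landmarks))"
    by (simp add: landmarks_def literal_intervals_def zones_def)
  then have "c \<le> a + 28 \<or> (\<exists>(x, y) \<in> set literal_intervals. x \<le> a \<and> c \<le> y) \<or>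
      (a, c) \<in> set (map (\<lambda>(a, s, e, b, p, d). (a, e)) zones)"
    using ac(1) unfolding list_all_iff list_ex_iff by blast
  ultimately have "(a, c) \<in> set (map (\<lambda>(a, s, e, b, p, d). (a, e)) zones)"
    unfolding literal_def by fastforce
  then show ?thesis using ac(2) c by force
qed

text \<open>Here \<open>w\<close> is the inverse of 23 modulo \<open>p\<close>, and \<open>r\<close>
  the known solution of the congruence between the phase shifts.\<close>

lemma mod_inverse_step:
  fixes m p w r q d d' :: nat
  assumes "(q + 23 * m + d') mod p = (q + d) mod p" "(23 * w) mod p = 1"
      "(23 * r + d') mod p = d mod p"
    "r < p"
  shows "m mod p = r"
proof -
  have "int p dvd int (q + 23 * m + d') - int (q + d)"
    using assms(1) by (metis mod_eq_dvd_iff of_nat_mod)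
  moreover have "int p dvd int (23 * r + d') - int d"
    using assms(3) by (metis mod_eq_dvd_iff of_nat_mod)
  ultimately have "int p dvd (int (q + 23 * m + d') - int (q + d)) - (int (23 * r + d') - int d)"
    by (rule dvd_diff)
  then have a: "int p dvd 23 * (int m - int r)" by (simp add: algebra_simps)
  have "int p dvd int (23 * w) - int 1"
    using assms(2,4) by (metis mod_eq_dvd_iff of_nat_mod mod_mod_trivial)
  then have "int p dvd (int (23 * w) - 1) * (int m - int r)" by simp
  moreover have "int p dvd int w * (23 * (int m - int r))" using a by simp
  ultimately have "int p dvd int w * (23 * (int m - int r)) - (int (23 * w) - 1) * (int m - int r)"
    by (rule dvd_diff[rotated])
  then have "int p dvd int m - int r" by (simp add: algebra_simps)
  then have "int m mod int p = int r mod int p" by (simp add: mod_eq_dvd_iff)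
  then have "m mod p = r mod p" by (metis of_nat_eq_iff of_nat_mod)
  then show ?thesis using assms(4) by simp
qed

text \<open>The label ranges of different cycles do not overlap, so a common label identifies the
  cycle.\<close>

lemma bases_disjoint:
  assumes "(b, p) \<in> set bases" "(b', p') \<in> set bases" "b + x = b' + y" "x < p" "y < p'"
  shows "b = b' \<and> p = p'"
  using assms by (auto simp: bases_def)

text \<open>
  The remaining coincidences of two windows, with the possible starting positions.  Each of them
  is refuted by one of the letters that interrupt the periodic stretches.
\<close>

definition coincidences :: "(nat \<times> nat \<times> nat) list" where
  "coincidences = [(668, 47, 59), (171, 14258, 14258), (171, 14942, 14942), (151, 19765, 19768),
    (368, 21399, 21405), (1138, 31598, 31602), (991, 48061, 48061), (151, 62561, 62562),
    (151, 66731, 66743)]"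

lemma zones_by_base:
  assumes "(a, s, e, b, p, d) \<in> set zones"
  shows "b = 54 \<Longrightarrow> p = 668 \<and> (a = 46 \<and> e = 18043 \<and> d = 614 \<or> a = 18190 \<and> e = 18823 \<and> d = 21 \<or>
      a = 18874 \<and> e = 19507 \<and> d = 21)"
    and "b = 19765 \<Longrightarrow> p = 151 \<and> (a = 19764 \<and> e = 23793 \<and> d = 16 \<or> a = 29862 \<and> e = 31289 \<and> d = 8)"
    and "b = 23840 \<Longrightarrow> p = 224 \<and> a = 23839 \<and> e = 29835 \<and> d = 128"
    and "b = 31598 \<Longrightarrow> p = 1138 \<and>
      (a = 31597 \<and> e = 62276 \<and> d = 266 \<or> a = 70853 \<and> e = 74766 \<and> d = 233)"
    and "b = 62561 \<Longrightarrow> p = 151 \<and> a = 62560 \<and> e = 66587 \<and> d = 104"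
    and "b = 66738 \<Longrightarrow> p = 151 \<and> a = 66730 \<and> e = 70768 \<and> d = 4"
  using assms by (auto simp: zones_def)

lemma coincidence_arith:
  fixes i m t r a e a' e' d d' :: nat
  assumes w: "a < i" "i + (4 * m - 53) < e" "a' < i + 23 * m" "i + 23 * m + (4 * m - 53) < e'"
    and m: "20 \<le> m"
  shows "m = 668 * t + r \<Longrightarrow>
      a = 46 \<and> e = 18043 \<and> d = 614 \<or> a = 18190 \<and> e = 18823 \<and> d = 21 \<or>
          a = 18874 \<and> e = 19507 \<and> d = 21 \<Longrightarrow>
      a' = 46 \<and> e' = 18043 \<and> d' = 614 \<or> a' = 18190 \<and> e' = 18823 \<and> d' = 21 \<or>
        a' = 18874 \<and> e' = 19507 \<and> d' = 21 \<Longrightarrow>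
      d' = d \<and> r = 0 \<or> d = 614 \<and> d' = 21 \<and> r = 171 \<or> d = 21 \<and> d' = 614 \<and> r = 497 \<Longrightarrow>
      m = 668 \<and> 47 \<le> i \<and> i \<le> 59 \<or> m = 171 \<and> 14258 \<le> i \<and> i \<le> 14258 \<or> m = 171 \<and> 14942 \<le> i \<and> i \<le> 14942"
    and "m = 151 * t + r \<Longrightarrow>
      a = 19764 \<and> e = 23793 \<and> d = 16 \<or> a = 29862 \<and> e = 31289 \<and> d = 8 \<Longrightarrow>
      a' = 19764 \<and> e' = 23793 \<and> d' = 16 \<or> a' = 29862 \<and> e' = 31289 \<and> d' = 8 \<Longrightarrow>
      d' = d \<and> r = 0 \<or> d = 16 \<and> d' = 8 \<and> r = 66 \<or> d = 8 \<and> d' = 16 \<and> r = 85 \<Longrightarrow>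
      m = 151 \<and> 19765 \<le> i \<and> i \<le> 19768 \<or> m = 368 \<and> 21399 \<le> i \<and> i \<le> 21405"
    and "m = 224 * t \<Longrightarrow> a = 23839 \<and> e = 29835 \<Longrightarrow> a' = 23839 \<and> e' = 29835 \<Longrightarrow> False"
    and "m = 1138 * t + r \<Longrightarrow>
      a = 31597 \<and> e = 62276 \<and> d = 266 \<or> a = 70853 \<and> e = 74766 \<and> d = 233 \<Longrightarrow>
      a' = 31597 \<and> e' = 62276 \<and> d' = 266 \<or> a' = 70853 \<and> e' = 74766 \<and> d' = 233 \<Longrightarrow>
      d' = d \<and> r = 0 \<or> d = 266 \<and> d' = 233 \<and> r = 991 \<or> d = 233 \<and> d' = 266 \<and> r = 147 \<Longrightarrow>
      m = 1138 \<and> 31598 \<le> i \<and> i \<le> 31602 \<or> m = 991 \<and> 48061 \<le> i \<and> i \<le> 48061"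
    and "m = 151 * t \<Longrightarrow> a = 62560 \<and> e = 66587 \<Longrightarrow> a' = 62560 \<and> e' = 66587 \<Longrightarrow>
      m = 151 \<and> 62561 \<le> i \<and> i \<le> 62562"
    and "m = 151 * t \<Longrightarrow> a = 66730 \<and> e = 70768 \<Longrightarrow> a' = 66730 \<and> e' = 70768 \<Longrightarrow>
      m = 151 \<and> 66731 \<le> i \<and> i \<le> 66743"
proof -
  \<comment> \<open>From three periods on, the two ends of the power are too far apart for the zones
    of the cycle; the smaller quotients are computed.\<close>
  consider (0) "t = 0" | (1) "t = 1" | (2) "t = 2" | (3) "3 \<le> t" by linarith
  note t = this
  define c where "c = 4 * m - 53"
  have c: "c + 53 = 4 * m" using m by (simp add: c_def)
  note w' = w[folded c_def]
  show "m = 668 \<and> 47 \<le> i \<and> i \<le> 59 \<or> m = 171 \<and> 14258 \<le> i \<and> i \<le> 14258 \<or>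
      m = 171 \<and> 14942 \<le> i \<and> i \<le> 14942"
    if "m = 668 * t + r" "a = 46 \<and> e = 18043 \<and> d = 614 \<or> a = 18190 \<and> e = 18823 \<and> d = 21 \<or>
        a = 18874 \<and> e = 19507 \<and> d = 21" "a' = 46 \<and> e' = 18043 \<and> d' = 614 \<or>
        a' = 18190 \<and> e' = 18823 \<and> d' = 21 \<or> a' = 18874 \<and> e' = 19507 \<and> d' = 21" "d' = d \<and> r = 0 \<or>
        d = 614 \<and> d' = 21 \<and> r = 171 \<or> d = 21 \<and> d' = 614 \<and> r = 497"
    using t by cases (use that w' c m in \<open>elim disjE conjE; linarith?\<close>; auto)+
  show "m = 151 \<and> 19765 \<le> i \<and> i \<le> 19768 \<or> m = 368 \<and> 21399 \<le> i \<and> i \<le> 21405"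
    if "m = 151 * t + r" "a = 19764 \<and> e = 23793 \<and> d = 16 \<or> a = 29862 \<and> e = 31289 \<and> d = 8"
        "a' = 19764 \<and> e' = 23793 \<and> d' = 16 \<or> a' = 29862 \<and> e' = 31289 \<and> d' = 8" "d' = d \<and> r = 0 \<or>
        d = 16 \<and> d' = 8 \<and> r = 66 \<or> d = 8 \<and> d' = 16 \<and> r = 85"
    using t by cases (use that w' c m in \<open>elim disjE conjE; linarith?\<close>; auto)+
  show "False"
    if "m = 224 * t" "a = 23839 \<and> e = 29835" "a' = 23839 \<and> e' = 29835"
    using t by cases (use that w' c m in \<open>elim disjE conjE; linarith?\<close>; auto)+
  show "m = 1138 \<and> 31598 \<le> i \<and> i \<le> 31602 \<or> m = 991 \<and> 48061 \<le> i \<and> i \<le> 48061"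
    if "m = 1138 * t + r" "a = 31597 \<and> e = 62276 \<and> d = 266 \<or> a = 70853 \<and> e = 74766 \<and> d = 233"
        "a' = 31597 \<and> e' = 62276 \<and> d' = 266 \<or> a' = 70853 \<and> e' = 74766 \<and> d' = 233"
        "d' = d \<and> r = 0 \<or> d = 266 \<and> d' = 233 \<and> r = 991 \<or> d = 233 \<and> d' = 266 \<and> r = 147"
    using t by cases (use that w' c m in \<open>elim disjE conjE; linarith?\<close>; auto)+
  show "m = 151 \<and> 62561 \<le> i \<and> i \<le> 62562"
    if "m = 151 * t" "a = 62560 \<and> e = 66587" "a' = 62560 \<and> e' = 66587"
    using t by cases (use that w' c m in \<open>elim disjE conjE; linarith?\<close>; auto)+
  show "m = 151 \<and> 66731 \<le> i \<and> i \<le> 66743"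
    if "m = 151 * t" "a = 66730 \<and> e = 70768" "a' = 66730 \<and> e' = 70768"
    using t by cases (use that w' c m in \<open>elim disjE conjE; linarith?\<close>; auto)+
qed

lemma coincidence:
  assumes z: "(a, s, e, b, p, d) \<in> set zones" "(a', s', e', b', p', d') \<in> set zones"
    and w: "a < i" "i + (4 * m - 53) < e" "a' < i + 23 * m" "i + 23 * m + (4 * m - 53) < e'"
    and l: "b + (q + d) mod p = b' + (q + 23 * m + d') mod p'" and m: "20 \<le> m"
  shows "\<exists>(m', x, y) \<in> set coincidences. m = m' \<and> x \<le> i \<and> i \<le> y"
proof -
  note bp = zones_bases[OF z(1)] zones_bases[OF z(2)]
  have lt: "(q + d) mod p < p" "(q + 23 * m + d') mod p' < p'"
    using bases_pos[OF bp(1)] bases_pos[OF bp(2)] by simp_all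
  from bases_disjoint[OF bp l lt] have e: "b' = b" "p' = p" by simp_all
  with l have c: "(q + 23 * m + d') mod p = (q + d) mod p" by simp
  note step = mod_inverse_step[OF c]
  note arith = coincidence_arith[OF w m]
  note z' = z(2)[unfolded e]
  define t where "t = m div p"
  have t: "m = p * t + m mod p" by (simp add: t_def)
  consider "b = 54" | "b = 19765" | "b = 23840" | "b = 31598" | "b = 62561" | "b = 66738"
    using bp(1) by (auto simp: bases_def)
  then show ?thesis
  proof cases
    case 1
    note zz = zones_by_base(1)[OF z(1) 1] zones_by_base(1)[OF z' 1]
    have p: "p = 668" using zz by simp
    \<comment> \<open>639 is the inverse of 23 modulo 668; below, 46, 39 and 99 are its inverses
      modulo 151, 224 and 1138. The opposite residues 171 and 497 belong to the two orders in which
      stretches with different phase shifts can occur.\<close>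
    have "d' = d \<and> m mod 668 = 0 \<or> d = 614 \<and> d' = 21 \<and> m mod 668 = 171 \<or>
        d = 21 \<and> d' = 614 \<and> m mod 668 = 497"
      using zz step[of 639 0] step[of 639 171] step[of 639 497] unfolding p by auto
    from arith(1)[OF t[unfolded p] _ _ this] show ?thesis
      using zz by (auto simp: coincidences_def)
  next
    case 2
    note zz = zones_by_base(2)[OF z(1) 2] zones_by_base(2)[OF z' 2]
    have p: "p = 151" using zz by simp
    have "d' = d \<and> m mod 151 = 0 \<or> d = 16 \<and> d' = 8 \<and> m mod 151 = 66 \<or>
        d = 8 \<and> d' = 16 \<and> m mod 151 = 85"
      using zz step[of 46 0] step[of 46 66] step[of 46 85] unfolding p by auto
    from arith(2)[OF t[unfolded p] _ _ this] show ?thesis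
      using zz by (auto simp: coincidences_def)
  next
    case 3
    note zz = zones_by_base(3)[OF z(1) 3] zones_by_base(3)[OF z' 3]
    have p: "p = 224" using zz by simp
    have "m mod 224 = 0" using zz step[of 39 0] unfolding p by auto
    then show ?thesis using arith(3)[of t] t[unfolded p] zz by simp
  next
    case 4
    note zz = zones_by_base(4)[OF z(1) 4] zones_by_base(4)[OF z' 4]
    have p: "p = 1138" using zz by simp
    have "d' = d \<and> m mod 1138 = 0 \<or> d = 266 \<and> d' = 233 \<and> m mod 1138 = 991 \<or>
        d = 233 \<and> d' = 266 \<and> m mod 1138 = 147"
      using zz step[of 99 0] step[of 99 991] step[of 99 147] unfolding p by auto
    from arith(4)[OF t[unfolded p] _ _ this] show ?thesis
      using zz by (auto simp: coincidences_def)
  next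
    case 5
    note zz = zones_by_base(5)[OF z(1) 5] zones_by_base(5)[OF z' 5]
    have p: "p = 151" using zz by simp
    have "m mod 151 = 0" using zz step[of 46 0] unfolding p by auto
    then show ?thesis using arith(5)[of t] t[unfolded p] zz by (simp add: coincidences_def)
  next
    case 6
    note zz = zones_by_base(6)[OF z(1) 6] zones_by_base(6)[OF z' 6]
    have p: "p = 151" using zz by simp
    have "m mod 151 = 0" using zz step[of 46 0] unfolding p by auto
    then show ?thesis using arith(6)[of t] t[unfolded p] zz by (simp add: coincidences_def)
  qed
qed

lemma repeats_D:
  assumes "repeats m i" "i \<le> x" "x < i + 4 * m"
  shows "xw x = xw (x + 23 * m)"
proof -
  have "x - i < 4 * m" using assms(2,3) by linarith
  then have "xw (i + (x - i)) = xw (i + 23 * m + (x - i))"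
    using assms(1) unfolding repeats_def by blast
  moreover have "i + (x - i) = x" "i + 23 * m + (x - i) = x + 23 * m" using assms(2) by simp_all
  ultimately show ?thesis by (simp only:)
qed

lemma not_repeats_coincidence:
  assumes "(m, x, y) \<in> set coincidences" "x \<le> i" "i \<le> y"
  shows "\<not> repeats m i"
proof
  assume r: "repeats m i"
  have e: False if "i \<le> z" "z < i + 4 * m" "xw z \<noteq> xw (z + 23 * m)" for z
    using repeats_D[OF r that(1,2)] that(3) by simp
  have "m = 668 \<and> x = 47 \<and> y = 59 \<or> m = 171 \<and> x = 14258 \<and> y = 14258 \<or>
      m = 171 \<and> x = 14942 \<and> y = 14942 \<or> m = 151 \<and> x = 19765 \<and> y = 19768 \<or>
      m = 368 \<and> x = 21399 \<and> y = 21405 \<or> m = 1138 \<and> x = 31598 \<and> y = 31602 \<or>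
      m = 991 \<and> x = 48061 \<and> y = 48061 \<or> m = 151 \<and> x = 62561 \<and> y = 62562 \<or>
      m = 151 \<and> x = 66731 \<and> y = 66743"
    using assms(1) by (simp add: coincidences_def)
  then show False
  proof (elim disjE conjE)
    \<comment> \<open>\<open>18089 = 2725 + 23 * 668\<close> is the interrupting letter, but for
      \<open>i \<le> 53\<close> the match ends before 2725. Then the letter at 53, just before the
      cycle, differs from its counterpart.\<close>
    assume h: "m = 668" "x = 47" "y = 59"
    show False
      using e[of 53] e[of 2725] xw_values(1) xw_values(2) assms(2,3) unfolding h by (cases "i \<le> 53") simp_all
  next
    assume h: "m = 171" "x = 14258" "y = 14258"
    show False using e[of 14941] xw_values(3) assms(2,3) unfolding h by simp
  next
    assume h: "m = 171" "x = 14942" "y = 14942"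
    show False using e[of 15625] xw_values(4) assms(2,3) unfolding h by simp
  next
    assume h: "m = 151" "x = 19765" "y = 19768"
    show False using e[of 20368] xw_values(5) assms(2,3) unfolding h by simp
  next
    assume h: "m = 368" "x = 21399" "y = 21405"
    show False using e[of 22870] xw_values(6) assms(2,3) unfolding h by simp
  next
    assume h: "m = 1138" "x = 31598" "y = 31602"
    show False using e[of 36149] xw_values(7) assms(2,3) unfolding h by simp
  next
    assume h: "m = 991" "x = 48061" "y = 48061"
    show False using e[of 52024] xw_values(8) assms(2,3) unfolding h by simp
  next
    assume h: "m = 151" "x = 62561" "y = 62562"
    show False using e[of 63164] xw_values(9) assms(2,3) unfolding h by simp
  next
    assume h: "m = 151" "x = 66731" "y = 66743"
    show False
      using e[of 66737] e[of 67341] xw_values(10) xw_values(11) assms(2,3) unfolding h by (cases "i \<le> 66737") simp_all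
  qed
qed

text \<open>The last column is counted from 75018, which takes the place of the end of a block
  before the first one.\<close>

lemma xw_column: "xw (75018 + 353 * Suc h) = xw h"
proof -
  have "75018 + 353 * Suc h = 75019 + 353 * h + 352" by simp
  then show ?thesis using xw_block(2)[of h] by (simp only:)
qed

text \<open>A shift by \<open>23 * (353 * m)\<close> moves exactly \<open>23 * m\<close> blocks, so
  entries of the last column are compared at that distance.\<close>

lemma repeats_column:
  assumes "repeats (353 * m) i" "i \<le> 75018 + 353 * Suc h" "75018 + 353 * Suc h < i + 353 * (4 * m)"
  shows "xw h = xw (h + 23 * m)"
proof -
  have "i + 353 * (4 * m) = i + 4 * (353 * m)" by simp
  then have "xw (75018 + 353 * Suc h) = xw (75018 + 353 * Suc h + 23 * (353 * m))"
    using assms by (intro repeats_D[OF assms(1)]) (simp_all only:)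
  moreover have "75018 + 353 * Suc h + 23 * (353 * m) = 75018 + 353 * Suc (h + 23 * m)" by simp
  ultimately show ?thesis using xw_column[of h] xw_column[of "h + 23 * m"] by (simp only:)
qed

lemma zone_of_windowE:
  assumes "\<And>q. i \<le> q \<Longrightarrow> q \<le> i + n \<Longrightarrow> \<not> special q" "27 \<le> n" "i \<le> 75012"
  obtains a s e b p d where "(a, s, e, b, p, d) \<in> set zones" "a < i" "i + n < e"
proof -
  from zone_of_window[OF assms] obtain z where z: "z \<in> set zones"
    "case z of (a, s, e, b, p, d) \<Rightarrow> a < i \<and> i + n < e" by blast
  obtain a s e b p d where "z = (a, s, e, b, p, d)" by (rule prod_cases6)
  then show thesis using that[of a s e b p d] z by simp
qed

text \<open>
  Occurrences of the same long factor far enough to the right start in the same column, so the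
  shift is a multiple of 353 and the last column contains the same repetition on a smaller scale.
\<close>

theorem not_repeats: "0 < m \<Longrightarrow> \<not> repeats m i"
proof (induction m arbitrary: i rule: less_induct)
  case (less m)
  show ?case
  proof (cases "m < 20")
    case True
    then show ?thesis using less.prems not_repeats_small by blast
  next
    case False
    then have m: "20 \<le> m" by simp
    show ?thesis
    proof
      assume r: "repeats m i"
      \<comment> \<open>For a start in \<open>[i, i + n]\<close> all 53 letters lie inside the
        match. Here \<open>20 \<le> m\<close> gives the 27 needed for a nonzero start.\<close>
      define n where "n = 4 * m - 53"
      have n: "27 \<le> n" "n + 53 = 4 * m" using m by (simp_all add: n_def)
      have eq: "xw q = xw (q + 23 * m)" if "i \<le> q" "q \<le> i + n" for q
        using that n by (intro repeats_D[OF r]) linarith+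
      have lab: "lab q = lab (q + 23 * m)" if "i \<le> q" "q \<le> i + n" "xw q \<noteq> 0" for q
      proof (rule lab_eq[OF that(3)])
        fix k :: nat assume "k < 53"
        then have "xw (q + k) = xw (q + k + 23 * m)"
          using that n by (intro repeats_D[OF r]) linarith+
        moreover have "q + k + 23 * m = q + 23 * m + k" by simp
        ultimately show "xw (q + k) = xw (q + 23 * m + k)" by (simp only:)
      qed
      have ns: "\<not> special q" if "i \<le> q" "q \<le> i + n" for q
      proof
        assume s: "special q"
        then have "xw q \<noteq> 0" unfolding special_def ..
        from special_unique[OF s lab[OF that this, symmetric]] show False using m by linarith
      qed
      have ns': "\<not> special q'" if "i + 23 * m \<le> q'" "q' \<le> i + 23 * m + n" for q'
      proof
        assume s: "special q'"
        define q where "q = q' - 23 * m"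
        have q: "q' = q + 23 * m" "i \<le> q" "q \<le> i + n" using that unfolding q_def by linarith+
        have "xw q' \<noteq> 0" using s unfolding special_def ..
        then have "xw q \<noteq> 0" using eq[OF q(2,3)] q(1) by (simp only: not_False_eq_True)
        from special_unique[OF s] lab[OF q(2,3) this] have "q = q'" unfolding q(1) by blast
        then show False using q(1) m by linarith
      qed
      obtain q where q: "i \<le> q" "q \<le> i + 26" "xw q \<noteq> 0" by (rule nonzero_in_window)
      then have qn: "q \<le> i + n" using n by linarith
      have q': "xw (q + 23 * m) \<noteq> 0" using eq[OF q(1) qn] q(3) by metis
      have l: "lab q = lab (q + 23 * m)" by (rule lab[OF q(1) qn q(3)])
      have nsq: "\<not> special q" "\<not> special (q + 23 * m)"
        using ns[OF q(1) qn] ns'[of "q + 23 * m"] q(1) qn by linarith+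
      \<comment> \<open>All positions from 75013 to 75017 are labelled individually, so a nonzero
        letter there would be special.\<close>
      have late: "75018 \<le> x" if "75012 < x" "xw x \<noteq> 0" "\<not> special x" for x
      proof (rule ccontr)
        assume "\<not> 75018 \<le> x"
        have "(74766, 75018) \<in> set literal_intervals" by (simp add: literal_intervals_def)
        moreover have "74766 \<le> x" "x < 75018" using \<open>\<not> 75018 \<le> x\<close> that(1) by linarith+
        ultimately have "literal x" unfolding literal_def by blast
        then show False using that(2,3) unfolding special_def by blast
      qed
      show False
      proof (cases "i \<le> 75012")
        case True
        obtain a s e b p d where z: "(a, s, e, b, p, d) \<in> set zones" "a < i" "i + n < e"
          using zone_of_windowE[OF ns n(1) True] by metis
        have lq: "lab q = b + (q + d) mod p"
          using zone_label[OF z(1)] q nsq z qn by simp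
        show False
        proof (cases "i + 23 * m \<le> 75012")
          case True
          obtain a' s' e' b' p' d' where z': "(a', s', e', b', p', d') \<in> set zones"
              "a' < i + 23 * m"
            "i + 23 * m + n < e'"
            using zone_of_windowE[OF ns' n(1) True] by metis
          have "lab (q + 23 * m) = b' + (q + 23 * m + d') mod p'"
            using zone_label[OF z'(1)] q q' nsq z' qn by simp
          then have "b + (q + d) mod p = b' + (q + 23 * m + d') mod p'" using l lq by simp
          from coincidence[OF z(1) z'(1) z(2) z(3)[unfolded n_def] z'(2) z'(3)[unfolded n_def] this m]
          obtain c where c: "c \<in> set coincidences" "case c of (m', x, y) \<Rightarrow> m = m' \<and> x \<le> i \<and> i \<le> y"
            by blast
          obtain m' x y where "c = (m', x, y)" by (rule prod_cases3)
          then show False using c not_repeats_coincidence[of m x y i] r by simp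
        next
          case False
          \<comment> \<open>One window is in a zone and the other among the blocks; labels of cycles
            stay below 75019, those of blocks do not.\<close>
          then have "75012 < q + 23 * m" using q(1) by simp
          then have "75018 \<le> q + 23 * m" using late q' nsq(2) by blast
          then have "75019 \<le> lab q" using lab_steady l by simp
          moreover have "b + p \<le> 75018" using zones_bases[OF z(1)] by (auto simp: bases_def)
          moreover have "(q + d) mod p < p" using bases_pos[OF zones_bases[OF z(1)]] by simp
          ultimately show False using lq by linarith
        qed
      next
        case False
        then have "75018 \<le> q" "75018 \<le> q + 23 * m" using late q q' nsq by simp_all
        then have "(q + 23 * m + 170) mod 353 = (q + 170) mod 353"
          using l lab_steady by simp
        \<comment> \<open>\<open>23 * 307 = 20 * 353 + 1\<close>.\<close>
        from mod_inverse_step[OF this, of 307 0] have "m mod 353 = 0" by simp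
        then obtain m' where m': "m = 353 * m'" by (auto elim: dvdE simp flip: dvd_eq_mod_eq_0)
        have m'0: "0 < m'" "m' < m" using m m' by simp_all
        \<comment> \<open>An earlier start would match the 0 at 75017 with the last letter of
          \<open>u\<close>, which is 1.\<close>
        have i: "75018 \<le> i"
        proof (rule ccontr)
          assume "\<not> 75018 \<le> i"
          then have "xw 75017 = xw (75017 + 23 * m)"
            using False m by (intro repeats_D[OF r]) simp_all
          moreover have "75017 + 23 * m = 75019 + 353 * (23 * m' - 1) + 351" using m' m'0 by simp
          then have "xw (75017 + 23 * m) = val (concat pu ! 351)" using xw_block(1)[of 351] by simp
          moreover have "concat pu ! 351 = I"
            by (simp add: pu_def nth_append chunk_length, simp add: pu2_def)
          ultimately show False using xw_values(12) by simp
        qed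
        have r': "repeats (353 * m') i" using r unfolding m' .
        show False
        proof (cases "i = 75018")
          \<comment> \<open>The 1 at 75018 acts as a letter at position -1. Scaling down leaves a
            match of \<open>4 * m' - 1\<close> letters from position 0, together with a 1 at
            \<open>23 * m' - 1\<close>.\<close>
          case True
          have "75018 + 23 * m = 75018 + 353 * Suc (23 * m' - 1)" using m' m'0 by simp
          then have "xw (75018 + 23 * m) = xw (23 * m' - 1)" by (simp only: xw_column)
          moreover have "xw 75018 = xw (75018 + 23 * m)"
            using True m by (intro repeats_D[OF r]) simp_all
          ultimately have one: "xw (23 * m' - 1) = 1" using xw_values(13) by simp
          have rep: "xw k = xw (23 * m' + k)" if "k < 4 * m' - 1" for k
          proof -
            have "Suc k < 4 * m'" using that by linarith
            then have "353 * Suc k < 353 * (4 * m')"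
              by (simp only: mult_less_cancel1 zero_less_numeral simp_thms)
            then have "75018 + 353 * Suc k < i + 353 * (4 * m')"
              unfolding True by (rule add_strict_left_mono)
            moreover have "i \<le> 75018 + 353 * Suc k" unfolding True by (rule le_add1)
            ultimately have "xw k = xw (k + 23 * m')" using repeats_column[OF r'] by blast
            then show ?thesis by (simp only: add.commute)
          qed
          show False
          proof (cases "m' < 20")
            case True
            then show False using not_repeats_prefix_small[OF m'0(1) _ one] rep by blast
          next
            case False
            \<comment> \<open>The special letter 26 and the 52 letters after it end at 78, just
              inside a match of \<open>4 * m' - 1 \<ge> 79\<close> letters.\<close>
            have sp: "special 26" by (rule special_landmark) (simp add: landmarks_def)
            have "lab 26 = lab (26 + 23 * m')"
            proof (rule lab_eq)
              show "xw 26 \<noteq> 0" using sp unfolding special_def ..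
              fix k :: nat assume "k < 53"
              then have "xw (26 + k) = xw (23 * m' + (26 + k))"
                using False by (intro rep) linarith
              moreover have "23 * m' + (26 + k) = 26 + 23 * m' + k" by simp
              ultimately show "xw (26 + k) = xw (26 + 23 * m' + k)" by (simp only:)
            qed
            from special_unique[OF sp this[symmetric]] show False using m'0 by linarith
          qed
        next
          case False
          then have i': "75019 \<le> i" using i by linarith
          \<comment> \<open>The end of the block containing \<open>i\<close> is the first entry of
            the last column at or after \<open>i\<close>.\<close>
          define h where "h = (i - 75019) div 353"
          have h: "i - 75019 < 353 * h + 353" "353 * h + 75019 \<le> i"
          proof -
            have "353 * h + (i - 75019) mod 353 = i - 75019" "(i - 75019) mod 353 < 353"
              by (simp_all add: h_def)
            then show "i - 75019 < 353 * h + 353" "353 * h + 75019 \<le> i" using i' by linarith+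
          qed
          have "repeats m' h"
            unfolding repeats_def
          proof (intro allI impI)
            fix k assume "k < 4 * m'"
            then have k: "353 * Suc k \<le> 353 * (4 * m')"
              by (simp only: mult_le_cancel1 Suc_le_eq simp_thms)
            have e: "353 * Suc (h + k) = 353 * h + 353 * Suc k"
                "353 * Suc (h + k) = 353 * h + 353 + 353 * k"
              by simp_all
            have "75018 + 353 * Suc (h + k) < i + 353 * (4 * m')"
              unfolding e(1) using h(2) k by linarith
            moreover have "i \<le> 75018 + 353 * Suc (h + k)"
              unfolding e(2) using h(1) i' by linarith
            ultimately have "xw (h + k) = xw (h + k + 23 * m')" by (intro repeats_column[OF r'])
            moreover have "h + k + 23 * m' = h + 23 * m' + k" by simp
            ultimately show "xw (h + k) = xw (h + 23 * m' + k)" by (simp only:)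
          qed
          then show False using less.IH[OF m'0(2,1)] by blast
        qed
      qed
    qed
  qed
qed

section \<open>From local leastness to lexicographic leastness\<close>

section \<open>The lexicographically least 27/23-power-free word\<close>

lemma frac_power_27_23:
  assumes "length v = 23 * m"
  shows "frac_power 27 23 v = v @ take (4 * m) v"
  using assms by (simp add: frac_power_def)

lemma frac_power_free_xw: "frac_power_free 27 23 xw"
  unfolding frac_power_free_def is_frac_power_def
proof (intro allI notI, elim exE conjE)
  fix i j :: nat and v :: "nat list"
  assume v: "v \<noteq> []" "23 dvd length v" and y: "(xw [i \<rightarrow> j]) = frac_power 27 23 v"
  then obtain m where m: "length v = 23 * m" by blast
  then have y': "(xw [i \<rightarrow> j]) = v @ take (4 * m) v" using y frac_power_27_23 by simp
  from arg_cong[OF this, of length] have len: "j - i = 27 * m" using m by simp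
  have "0 < m" using m v(1) by (cases m) auto
  have nth: "xw (i + k) = (v @ take (4 * m) v) ! k" if "k < 27 * m" for k
    using that len by (simp flip: y')
  have "repeats m i"
    unfolding repeats_def
  proof (intro allI impI)
    fix k assume k: "k < 4 * m"
    have "xw (i + k) = v ! k" using nth[of k] k m by (simp add: nth_append)
    moreover have "xw (i + (23 * m + k)) = v ! k" using nth[of "23 * m + k"] k m by (simp add: nth_append)
    ultimately show "xw (i + k) = xw (i + 23 * m + k)" by (simp add: add.assoc)
  qed
  then show False using not_repeats \<open>0 < m\<close> by blast
qed

lemma forced_not_free:
  assumes "forced n c" "\<And>k. k < n \<Longrightarrow> y k = xw k" "y n = c"
  shows "\<not> frac_power_free 27 23 y"
proof -
  obtain m where m: "0 < m" "27 * m \<le> n + 1" "xw (n - 23 * m) = c"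
    "\<And>t. t < 4 * m - 1 \<Longrightarrow> xw (n - 1 - t) = xw (n - 1 - t - 23 * m)"
    using assms(1) unfolding forced_def by blast
  define i where "i = n + 1 - 27 * m"
  have n: "n = i + 27 * m - 1" using m(1,2) unfolding i_def by linarith
  have eq: "y (i + k) = y (i + 23 * m + k)" if k: "k < 4 * m" for k
  proof (cases "k = 4 * m - 1")
    case True
    then have e: "i + k = n - 23 * m" "i + 23 * m + k = n" using n m(1) by linarith+
    have "n - 23 * m < n" using n m(1) by linarith
    then show ?thesis unfolding e using assms(2,3) m(3) by simp
  next
    case False
    define t where "t = 4 * m - 2 - k"
    have t: "t < 4 * m - 1" "i + k = n - 1 - t - 23 * m" "i + 23 * m + k = n - 1 - t"
      using k False n m(1) unfolding t_def by linarith+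
    have "n - 1 - t < n" "n - 1 - t - 23 * m < n" using n m(1) by linarith+
    then show ?thesis unfolding t(2,3) using assms(2) m(4)[OF t(1)] by simp
  qed
  define v where "v = (y [i \<rightarrow> i + 23 * m])"
  have v: "length v = 23 * m" by (simp add: v_def)
  have "(y [i \<rightarrow> i + 27 * m]) = v @ take (4 * m) v"
  proof (rule nth_equalityI)
    show "length (y [i \<rightarrow> i + 27 * m]) = length (v @ take (4 * m) v)" using v by simp
    fix k assume "k < length (y [i \<rightarrow> i + 27 * m])"
    then have k: "k < 27 * m" by simp
    show "(y [i \<rightarrow> i + 27 * m]) ! k = (v @ take (4 * m) v) ! k"
    proof (cases "k < 23 * m")
      case True
      then show ?thesis by (simp add: nth_append v_def)
    next
      case False
      then obtain l where l: "k = 23 * m + l" using le_Suc_ex not_less by blast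
      then have "l < 4 * m" using k by simp
      then show ?thesis using eq[of l] l v by (simp add: nth_append v_def add.assoc)
    qed
  qed
  then have "(y [i \<rightarrow> i + 27 * m]) = frac_power 27 23 v" using frac_power_27_23[OF v] by simp
  moreover have "v \<noteq> []" "23 dvd length v" using v m(1) by auto
  ultimately show ?thesis unfolding frac_power_free_def is_frac_power_def by blast
qed

text \<open>Where another free word first deviates, its letter cannot be smaller, since every
  smaller letter completes a power.\<close>

theorem lex_least_free_27_23: "lex_least_free 27 23 = xw"
proof -
  have "less_fun xw y" if y: "frac_power_free 27 23 y" "y \<noteq> xw" for y
  proof -
    define n where "n = (LEAST n. y n \<noteq> xw n)"
    have "\<exists>n. y n \<noteq> xw n" using y(2) by auto
    then have n: "y n \<noteq> xw n" unfolding n_def by (rule LeastI_ex)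
    have less: "y k = xw k" if "k < n" for k
      using that not_less_Least unfolding n_def by blast
    have "\<not> y n < xw n"
    proof
      assume "y n < xw n"
      then have "forced n (y n)" by (rule forced_less)
      then show False using forced_not_free[of n "y n" y] less y(1) by simp
    qed
    then have "xw n < y n" using n by simp
    then show ?thesis using less by (intro less_funI exI[of _ n]) simp
  qed
  then have "is_lex_least {w. frac_power_free 27 23 w} xw"
    using frac_power_free_xw by (simp add: is_lex_least_def)
  moreover have "is_lex_least {w. frac_power_free 27 23 w} (lex_least_free 27 23)"
    by (rule lex_least_free_is_lex_least) simp_all
  ultimately show ?thesis by (rule is_lex_least_unique[rotated])
qed

section \<open>The fixed point of the morphism\<close>

section \<open>The word as a fixed point\<close>

definition u_word :: "letter list" where
  "u_word = map (\<lambda>r. Num (val (concat pu ! r))) [0..<352]"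

definition primed :: "nat \<Rightarrow> letter" where
  "primed n = (if n = 0 then Zero' else Num (xw n))"

definition v_word :: "letter list" where
  "v_word = map primed [0..<75019]"

lemma length_uv: "length u_word = 352" "length v_word = 75019"
  unfolding u_word_def v_word_def length_map length_upt by simp_all

lemma nth_u_word: "r < 352 \<Longrightarrow> u_word ! r = Num (val (concat pu ! r))"
  unfolding u_word_def by (simp only: nth_map length_upt diff_zero nth_upt add_0)

lemma nth_v_word: "n < 75019 \<Longrightarrow> v_word ! n = primed n"
  unfolding v_word_def by (simp only: nth_map length_upt diff_zero nth_upt add_0)

lemma v_word_Cons: "v_word = Zero' # map primed [Suc 0..<75019]"
proof -
  have "[0..<75019] = 0 # [Suc 0..<75019]" by (rule upt_conv_Cons) simp
  moreover have "primed 0 = Zero'" by (simp add: primed_def)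
  ultimately show ?thesis unfolding v_word_def by (simp only: list.map)
qed

lemma length_concat_blocks: "length (concat (map (\<lambda>i. u_word @ [Num (xw i)]) [0..<j])) = 353 * j"
  by (induction j) (simp_all add: length_uv)

lemma nth_concat_blocks:
  assumes "r < 353"
  shows "concat (map (\<lambda>i. u_word @ [Num (xw i)]) [0..<Suc j]) ! (353 * j + r) = Num (xw (75019 + 353 * j + r))"
proof -
  have "concat (map (\<lambda>i. u_word @ [Num (xw i)]) [0..<Suc j]) =
      concat (map (\<lambda>i. u_word @ [Num (xw i)]) [0..<j]) @ (u_word @ [Num (xw j)])"
    by simp
  then have "concat (map (\<lambda>i. u_word @ [Num (xw i)]) [0..<Suc j]) ! (353 * j + r) =
      (u_word @ [Num (xw j)]) ! r"
    using nth_append_length_plus[of "concat (map (\<lambda>i. u_word @ [Num (xw i)]) [0..<j])"]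
    by (simp only: length_concat_blocks)
  also have "\<dots> = Num (xw (75019 + 353 * j + r))"
  proof (cases "r < 352")
    case True
    then show ?thesis using xw_block(1)[OF True, of j] by (simp add: nth_append length_uv nth_u_word)
  next
    case False
    then have r: "r = 352" using assms by simp
    show ?thesis unfolding r xw_block(2) by (simp add: nth_append length_uv)
  qed
  finally show ?thesis .
qed

text \<open>\<open>Zero'\<close> contributes \<open>v\<close> and a block ending in 0, which is the
  block of position 0 because \<open>xw 0 = 0\<close>.\<close>

lemma image_prefix:
  "concat (map (\<phi>_of u_word v_word) (prefix (Suc j) primed)) =
    v_word @ concat (map (\<lambda>i. u_word @ [Num (xw i)]) [0..<Suc j])"
proof (induction j)
  case 0
  show ?case by (simp add: primed_def xw_values(14))
next
  case (Suc j)
  have "prefix (Suc (Suc j)) primed = prefix (Suc j) primed @ [primed (Suc j)]"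
    by (simp add: subsequence_def)
  moreover have "\<phi>_of u_word v_word (primed (Suc j)) = u_word @ [Num (xw (Suc j))]"
    by (simp add: primed_def)
  ultimately show ?case using Suc by simp
qed

lemma word_image_primed: "word_image (\<phi>_of u_word v_word) primed = primed"
proof
  fix n
  note lv = length_uv(2)
  show "word_image (\<phi>_of u_word v_word) primed n = primed n"
  proof (cases "n < 75019")
    case True
    then have "n < length (concat (map (\<phi>_of u_word v_word) (prefix (Suc 0) primed)))"
      unfolding image_prefix by (simp only: length_append lv)
    from word_image_nth[OF this] show ?thesis
      using True unfolding image_prefix by (simp add: nth_append lv nth_v_word)
  next
    case False
    define j r where "j = (n - 75019) div 353" and "r = (n - 75019) mod 353"
    have r: "r < 353" and "n - 75019 = 353 * j + r" by (simp_all add: j_def r_def)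
    then have n: "n = 75019 + (353 * j + r)" using False by linarith
    have "353 * j + r < 353 * Suc j" using r by simp
    then have "n < length (concat (map (\<phi>_of u_word v_word) (prefix (Suc j) primed)))"
      unfolding image_prefix length_append length_concat_blocks lv n by linarith
    from word_image_nth[OF this] have "word_image (\<phi>_of u_word v_word) primed n =
        concat (map (\<lambda>i. u_word @ [Num (xw i)]) [0..<Suc j]) ! (353 * j + r)"
      unfolding image_prefix n using nth_append_length_plus[of v_word] by (simp only: lv)
    also have "\<dots> = primed n"
      unfolding nth_concat_blocks[OF r] by (simp add: primed_def n add.assoc)
    finally show ?thesis .
  qed
qed

lemma primed_fixed_point: "primed = fixed_point (\<phi>_of u_word v_word) Zero'"
proof -
  have "v_word = Zero' # tl v_word" unfolding v_word_Cons by (simp only: list.sel)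
  then have "\<phi>_of u_word v_word Zero' = Zero' # (tl v_word @ u_word @ [Num 0])"
    by (metis \<phi>_of.simps(1) append_Cons)
  then show ?thesis
    by (rule fixed_point_is_fixed_point(2)[rotated])
      (auto simp: word_image_primed primed_def split: letter.splits,
       metis \<phi>_of.simps append_is_Nil_conv letter.exhaust not_Cons_self2)
qed

section \<open>An automaton reading base 353\<close>

section \<open>Automaticity\<close>

text \<open>A finite-valued invariant that can be updated digit by digit and determines the letter
  provides the states; transitions are computed through chosen representatives.\<close>

lemma k_automaticI:
  fixes f :: "nat \<Rightarrow> 's :: countable"
  assumes "2 \<le> k" "finite (range f)"
    and step: "\<And>n n' d. d < k \<Longrightarrow> f n = f n' \<Longrightarrow> f (k * n + d) = f (k * n' + d)"
    and out: "\<And>n n'. f n = f n' \<Longrightarrow> w n = w n'"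
  shows "k_automatic k w"
proof -
  define rep where "rep q = (SOME n. to_nat (f n) = q)" for q
  define \<delta> where "\<delta> q d = to_nat (f (k * rep q + d))" for q d
  have rep: "f (rep (to_nat (f n))) = f n" for n
  proof -
    have "to_nat (f (rep (to_nat (f n)))) = to_nat (f n)"
      unfolding rep_def by (rule someI[of _ n]) simp
    then show ?thesis by simp
  qed
  have "foldl \<delta> (to_nat (f n)) ds = to_nat (f (foldl (\<lambda>n d. k * n + d) n ds))"
    if "set ds \<subseteq> {..<k}" for n ds
    using that
  proof (induction ds arbitrary: n)
    case (Cons d ds)
    then have "\<delta> (to_nat (f n)) d = to_nat (f (k * n + d))"
      using step[OF _ rep] by (simp add: \<delta>_def)
    then show ?case using Cons by simp
  qed simp
  then have "w (digits_value k ds) = w (rep (foldl \<delta> (to_nat (f 0)) ds))" if "set ds \<subseteq> {..<k}" for ds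
    using that out[OF rep] by (simp add: digits_value_def)
  moreover have "finite (to_nat ` range f)" using assms(2) by simp
  moreover have "to_nat (f 0) \<in> to_nat ` range f" by simp
  moreover have "\<forall>q \<in> to_nat ` range f. \<forall>d<k. \<delta> q d \<in> to_nat ` range f" by (simp add: \<delta>_def)
  ultimately show ?thesis unfolding k_automatic_def using assms(1)
    by (intro conjI exI[of _ "to_nat ` range f"] exI[of _ "to_nat (f 0)"] exI[of _ \<delta>]
        exI[of _ "\<lambda>q. w (rep q)"]) auto
qed

text \<open>Digits and blocks are out of step: since \<open>75019 = 212 * 353 + 183\<close>, blocks
  begin at digit 183 and end at digit 182.\<close>

definition column_letter :: "nat \<Rightarrow> nat \<Rightarrow> nat" where
  "column_letter e x = (if e = 182 then x else val (concat pu ! (if e < 182 then e + 170 else e - 183)))"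

lemma xw_digit:
  assumes "213 \<le> n" "e < 353"
  shows "xw (353 * n + e) = column_letter e (xw (n - 213))"
proof -
  obtain j where j: "n = 213 + j" using assms(1) le_Suc_ex by blast
  have nj: "n - 213 = j" using j by simp
  consider "e < 182" | "e = 182" | "182 < e" by linarith
  then show ?thesis
  proof cases
    case 1
    have "353 * n + e = 75019 + 353 * j + (e + 170)" unfolding j by simp
    moreover have "column_letter e x = val (concat pu ! (e + 170))" for x
      using 1 by (simp add: column_letter_def)
    moreover have "e + 170 < 352" using 1 by simp
    ultimately show ?thesis by (simp only: xw_block)
  next
    case 2
    have "353 * n + e = 75019 + 353 * j + 352" unfolding j 2 by simp
    moreover have "column_letter e x = x" for x by (simp add: column_letter_def 2)
    ultimately show ?thesis unfolding nj by (simp only: xw_block)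
  next
    case 3
    then obtain r where r: "e = 183 + r" using le_Suc_ex[of 183 e] by auto
    have "353 * n + e = 75019 + 353 * Suc j + r" unfolding j r by simp
    moreover have "column_letter e x = val (concat pu ! r)" for x
      by (simp add: column_letter_def r)
    moreover have "r < 352" using assms(2) r by simp
    ultimately show ?thesis by (simp only: xw_block)
  qed
qed

text \<open>\<open>xw n\<close> is the output, and the other two letters suffice to compute the
  whole next state. Numbers below 214 are kept as separate states, so the recurrence is used only
  where the subtractions are exact.\<close>

definition state :: "nat \<Rightarrow> nat + nat \<times> nat \<times> nat" where
  "state n = (if n < 214 then Inl n else Inr (xw n, xw (n - 213), xw (n - 214)))"

text \<open>Without a borrow the digit \<open>d - c\<close> is below 182, hence inside
  \<open>u\<close>, and 0 is a dummy argument. With a borrow the quotient drops to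
  \<open>n - 1\<close>, which turns 213 into 214.\<close>

lemma xw_digit_shift:
  assumes "214 \<le> n" "d < 353" "213 \<le> c" "c \<le> 214"
  shows "xw (353 * n + d - c) = (if c \<le> d then column_letter (d - c) 0 else
    column_letter (d + (353 - c)) (xw (n - 214)))"
proof (cases "c \<le> d")
  case True
  then have e: "353 * n + d - c = 353 * n + (d - c)" by simp
  have lt: "d - c < 182" "d - c < 353" "213 \<le> n" using assms by linarith+
  have "column_letter (d - c) x = column_letter (d - c) 0" for x
    using lt(1) by (simp add: column_letter_def)
  then show ?thesis unfolding e xw_digit[OF lt(3,2)] using True by metis
next
  case False
  obtain l where l: "n = Suc l" "213 \<le> l" using assms(1) by (cases n) auto
  have e: "353 * n + d - c = 353 * l + (d + (353 - c))" using False assms(4) l(1) by simp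
  have lt: "d + (353 - c) < 353" using False assms(4) by linarith
  have "n - 214 = l - 213" using l by simp
  then show ?thesis unfolding e xw_digit[OF l(2) lt] using False by simp
qed

lemma state_step:
  assumes "214 \<le> n" "d < 353"
  shows "state (353 * n + d) = Inr (column_letter d (xw (n - 213)),
    if 213 \<le> d then column_letter (d - 213) 0 else column_letter (d + (353 - 213)) (xw (n - 214)),
    if 214 \<le> d then column_letter (d - 214) 0 else column_letter (d + (353 - 214)) (xw (n - 214)))"
proof -
  have "213 \<le> n" "\<not> 353 * n + d < 214" using assms(1) by linarith+
  then show ?thesis
    using xw_digit[OF _ assms(2)] xw_digit_shift[OF assms, of 213] xw_digit_shift[OF assms, of 214]
    unfolding state_def by (simp only: if_False)
qed

lemma state_eq_iff:
  "state n = state n' \<longleftrightarrow> (if n < 214 then n = n' else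
    \<not> n' < 214 \<and> xw n = xw n' \<and> xw (n - 213) = xw (n' - 213) \<and> xw (n - 214) = xw (n' - 214))"
  unfolding state_def by (cases "n < 214"; cases "n' < 214") auto

theorem automatic_xw: "k_automatic 353 xw"
proof (rule k_automaticI[of _ state])
  have "state n \<in> Inl ` {..<214} \<union> Inr ` ({..2} \<times> {..2} \<times> {..2})" for n
    by (cases "n < 214") (simp_all add: state_def xw_le)
  then have "range state \<subseteq> Inl ` {..<214} \<union> Inr ` ({..2} \<times> {..2} \<times> {..2})" by blast
  moreover have "finite (Inl ` {..<214 :: nat} \<union> Inr ` ({..2 :: nat} \<times> {..2 :: nat} \<times> {..2 :: nat}))"
    by (intro finite_UnI finite_imageI finite_cartesian_product finite_lessThan finite_atMost)
  ultimately show "finite (range state)" by (rule finite_subset)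
  show "xw n = xw n'" if "state n = state n'" for n n'
    using that unfolding state_eq_iff by (cases "n < 214") simp_all
  show "state (353 * n + d) = state (353 * n' + d)" if d: "d < 353" and s: "state n = state n'" for n n' d
  proof (cases "n < 214")
    case True
    then have "n = n'" using s unfolding state_eq_iff by simp
    then show ?thesis by simp
  next
    case False
    then have n: "214 \<le> n" "214 \<le> n'" "xw (n - 213) = xw (n' - 213)" "xw (n - 214) = xw (n' - 214)"
      using s unfolding state_eq_iff by simp_all
    show ?thesis unfolding state_step[OF n(1) d] state_step[OF n(2) d] n(3,4) ..
  qed
qed simp

theorem theorem6p2:
  shows "(\<exists>u v :: letter list.
            length u = 352 \<and> set u \<subseteq> Num ` {0, 1, 2} \<and>
            length v = 75019 \<and> hd v = Zero' \<and> set (tl v) \<subseteq> Num ` {0, 1, 2} \<and>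
            lex_least_free 27 23 = \<tau> \<circ> fixed_point (\<phi>_of u v) Zero') \<and>
         k_automatic 353 (lex_least_free 27 23) \<and>
         range (lex_least_free 27 23) \<subseteq> {0, 1, 2}"
proof -
  have le: "n \<in> {0, 1, 2}" if "n \<le> 2" for n :: nat using that by auto
  have "set u_word \<subseteq> Num ` {0, 1, 2}"
  proof
    fix a assume "a \<in> set u_word"
    then obtain r where "a = Num (val (concat pu ! r))" unfolding u_word_def set_map by blast
    then show "a \<in> Num ` {0, 1, 2}" using le[OF val_le] by blast
  qed
  moreover have "hd v_word = Zero'" unfolding v_word_Cons by (simp only: list.sel)
  moreover have "set (tl v_word) \<subseteq> Num ` {0, 1, 2}"
  proof
    fix a assume "a \<in> set (tl v_word)"
    then obtain n where "n \<in> {Suc 0..<75019}" "a = primed n"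
      unfolding v_word_Cons list.sel set_map set_upt by blast
    then have "a = Num (xw n)" by (simp add: primed_def)
    then show "a \<in> Num ` {0, 1, 2}" using le[OF xw_le] by blast
  qed
  moreover have "xw = \<tau> \<circ> fixed_point (\<phi>_of u_word v_word) Zero'"
    unfolding primed_fixed_point[symmetric] by (auto simp: primed_def xw_values(14))
  moreover have "range xw \<subseteq> {0, 1, 2}"
  proof
    fix a assume "a \<in> range xw"
    then obtain n where "a = xw n" by blast
    then show "a \<in> {0, 1, 2}" using le[OF xw_le[of n]] by (simp only:)
  qed
  ultimately show ?thesis
    unfolding lex_least_free_27_23
    by (intro conjI exI[of _ u_word] exI[of _ v_word] automatic_xw length_uv)
qed

end
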